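(* Let $k\geq1$. The class of ${\mathrm{PCF}}^\Omega_k$-denotable procedures-in-environment $\Gamma\vdash p$ is the class generated inductively by the following rules: 1. If $\Gamma\vdash q_i$ is denotable for each $i<r$ and $x\in\Gamma$, then $\Gamma\vdash\lambda.\mathtt{case}\ x\,q_0\cdots q_{r-1}\ \mathtt{of}\ (j\Rightarrow j)$ is denotable. 2. If $\Gamma,x\vdash p$ is denotable, then $\Gamma\vdash\lambda x.p$ is denotable. 3. Each $\Gamma\vdash\lambda.n$ is denotable. 4. If $\Gamma\vdash p$ is denotable and $f:\mathbb{N}\rightharpoonup\mathbb{N}$, then $\Gamma\vdash p[i\mapsto f(i)]$ is denotable. 5. If $\Gamma\vdash p$, $\Gamma\vdash\lambda.d$ and $\Gamma\vdash\lambda.e$ are denotable, then $\Gamma\vdash p[0\mapsto d,\ i+1\mapsto e]$ is denotable. 6. If $\Gamma\vdash\lambda z^\sigma x_0^{\sigma_0}\cdots x_{r-1}^{\sigma_{r-1}}.e$ is denotable where $\sigma=\sigma_0,\ldots,\sigma_{r-1}\rightarrow\mathbb{N}$ is of level $\le k$, and $\Gamma\vdash q_i:\sigma_i$ is denotable for each $i<r$, then $\Gamma\vdash\lambda.\langle\!\langle\Pi_{\Gamma,Z}(e,\xi)\rangle\!\rangle$ is denotable, where $Z=z,\vec x$ is disjoint from $\Gamma$, $\xi(z)=\lambda\vec x.e$ and $\xi(x_i)=q_i$ for each $i$.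
   Context: Levels: ${\mathrm{lv}}(\mathbb{N})=0$, ${\mathrm{lv}}(\sigma\rightarrow\tau)=\max({\mathrm{lv}}\,\sigma+1,{\mathrm{lv}}\,\tau)$. ${\mathrm{PCF}}^\Omega$: simply typed $\lambda$-calculus over $\mathbb{N}$ with constants $\underline n$, $\mathit{suc},\mathit{pre}$, $\mathit{ifzero}$, $Y_\sigma:(\sigma\rightarrow\sigma)\rightarrow\sigma$ for all $\sigma$, and $C_f:\mathbb{N}\rightarrow\mathbb{N}$ for each partial $f:\mathbb{N}\rightharpoonup\mathbb{N}$; ${\mathrm{PCF}}^\Omega_k$ admits $Y_\sigma$ only for ${\mathrm{lv}}(\sigma)\le k$. NSPs: coinductively generated well-typed trees $p::=\lambda\vec x.e$, $e::=\bot\mid n\mid\mathtt{case}\ a\ \mathtt{of}\ (i\Rightarrow e_i\mid i\in\mathbb{N})$, $a::=x\,q_0\cdots q_{r-1}$, modulo $\alpha$; meta-terms add $P\vec Q$ and $\mathtt{case}\ G\ \mathtt{of}(\ldots)$ for arbitrary ground $G$, and $\langle\!\langle T\rangle\!\rangle$ is the limit of reduction by $\beta$, $\mathtt{case}\ \bot\rightsquigarrow\bot$, $\mathtt{case}\ n\ \mathtt{of}(i\Rightarrow E_i)\rightsquigarrow E_n$ and case-of-case commutation. Application $(\lambda x_0\cdots x_r.e)\cdot q=\lambda x_1\cdots x_r.\langle\!\langle e[x_0\mapsto q]\rangle\!\rangle$, $x^\eta=\lambda\vec z.\mathtt{case}\ x\vec z^{\,\eta}\ \mathtt{of}(i\Rightarrow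 i)$. The interpretation: $[\![x]\!]=x^\eta$, $[\![\underline n]\!]=\lambda.n$, $[\![\mathit{suc}]\!]=\lambda x.\mathtt{case}\ x\ \mathtt{of}(i\Rightarrow i+1)$, $[\![\mathit{pre}]\!]=\lambda x.\mathtt{case}\ x\ \mathtt{of}(0\Rightarrow0\mid i+1\Rightarrow i)$, $[\![\mathit{ifzero}]\!]=\lambda xyz.\mathtt{case}\ x\ \mathtt{of}(0\Rightarrow\mathtt{case}\ y\ \mathtt{of}(j\Rightarrow j)\mid i+1\Rightarrow\mathtt{case}\ z\ \mathtt{of}(j\Rightarrow j))$, $[\![C_f]\!]=\lambda x.\mathtt{case}\ x\ \mathtt{of}(i\Rightarrow f(i))$, $[\![Y_\sigma]\!]=\lambda g.F_\sigma[g]$, $F_\sigma[g]=\lambda\vec x.\mathtt{case}\ g(F_\sigma[g])\vec x^{\,\eta}\ \mathtt{of}(i\Rightarrow i)$, $[\![\lambda x.M]\!]_\Gamma=\lambda x.[\![M]\!]_{\Gamma,x}$, $[\![MN]\!]_\Gamma=[\![M]\!]_\Gamma\cdot[\![N]\!]_\Gamma$. $\Gamma\vdash p$ is ${\mathrm{PCF}}^\Omega_k$-denotable if $p=[\![M]\!]_\Gamma$ for some ${\mathrm{PCF}}^\Omega_k$ term $\Gamma\vdash M$. Rightward numeral leaves of $t$: $n$ in itself; those of $e$ in $\lambda\vec x.e$; those of each $e_i$ in $\mathtt{case}\ a\ \mathtt{of}(i\Rightarrow e_i)$; $t[i\mapsto e_i]$ replaces each rightward leaf $i$ by $e_i$ ($f(i)$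 read as $\bot$ if undefined). Plugging: for $\Gamma$, a list $Z$ of variables of level $\le k$ disjoint from $\Gamma$, $\Gamma,Z\vdash e$, and $\xi$ with $\Gamma,Z\vdash\xi(z):\sigma$ for $z^\sigma\in Z$, let $T^\circ$ replace each ground subterm $z\vec Q$ ($z\in Z$) of $T$ by $\bot$; $\Pi^0=e$, $\Pi^{m+1}=\Pi^m[z\mapsto\xi(z)\ \forall z\in Z]$, $\Pi_{\Gamma,Z}(e,\xi)=\bigsqcup_m(\Pi^m)^\circ$. *)

theory Defs
  imports Main "HOL-Library.BNF_Corec"
begin

datatype ty = N | Arr ty ty

fun lv :: "ty \<Rightarrow> nat" where
  "lv N = 0"
| "lv (Arr s t) = max (lv s + 1) (lv t)"

fun args :: "ty \<Rightarrow> ty list" where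
  "args N = []"
| "args (Arr s t) = s # args t"

definition arrs :: "ty list \<Rightarrow> ty" where
  "arrs ss = foldr Arr ss N"

text \<open>Variables are represented by de Bruijn levels: in an environment of length d
  the environment variables are 0..d-1; a lambda block with binder types bs occurring
  at depth D binds the variables D..D+length bs-1, and its body lives at depth
  D+length bs. Under this representation alpha-equivalent NSPs are equal.
  A procedure lambda xs.e is a pair (binder types, body).\<close>

codatatype nexp = Bot | Num nat | Case nat "(ty list \<times> nexp) list" "nat \<Rightarrow> nexp"
type_synonym nsp = "ty list \<times> nexp"

text \<open>Meta-terms. Ground meta-terms and meta-expressions are merged into one type:
  MCase G Es is case G of (i => E_i), MVar x Qs is x Qs, MApp P Qs is P Qs.\<close>

codatatype mexp = MBot | MNum nat | MCase mexp "nat \<Rightarrow> mexp"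
  | MVar nat "(ty list \<times> mexp) list" | MApp "ty list \<times> mexp" "(ty list \<times> mexp) list"
type_synonym mproc = "ty list \<times> mexp"

corec emb :: "nexp \<Rightarrow> mexp" where
  "emb e = (case e of Bot \<Rightarrow> MBot | Num n \<Rightarrow> MNum n
     | Case x qs es \<Rightarrow> MCase (MVar x (map (\<lambda>(bs,b). (bs, emb b)) qs)) (\<lambda>i. emb (es i)))"

definition embp :: "nsp \<Rightarrow> mproc" where
  "embp p = (fst p, emb (snd p))"

corec nren :: "(nat \<Rightarrow> nat) \<Rightarrow> nexp \<Rightarrow> nexp" where
  "nren \<rho> e = (case e of Bot \<Rightarrow> Bot | Num n \<Rightarrow> Num n
     | Case x qs es \<Rightarrow> Case (\<rho> x) (map (\<lambda>(bs,b). (bs, nren \<rho> b)) qs) (\<lambda>i. nren \<rho> (es i)))"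

definition nshift :: "nat \<Rightarrow> nat \<Rightarrow> nexp \<Rightarrow> nexp" where
  "nshift n k = nren (\<lambda>v. if v < n then v else v + k)"

definition nunshift :: "nat \<Rightarrow> nat \<Rightarrow> nexp \<Rightarrow> nexp" where
  "nunshift n k = nren (\<lambda>v. if v < n then v else v - k)"

corec mren :: "(nat \<Rightarrow> nat) \<Rightarrow> mexp \<Rightarrow> mexp" where
  "mren \<rho> e = (case e of MBot \<Rightarrow> MBot | MNum n \<Rightarrow> MNum n
     | MCase g es \<Rightarrow> MCase (mren \<rho> g) (\<lambda>i. mren \<rho> (es i))
     | MVar x qs \<Rightarrow> MVar (\<rho> x) (map (\<lambda>(bs,b). (bs, mren \<rho> b)) qs)
     | MApp (hs,h) qs \<Rightarrow> MApp (hs, mren \<rho> h) (map (\<lambda>(bs,b). (bs, mren \<rho> b)) qs))"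

definition mshiftp :: "nat \<Rightarrow> nat \<Rightarrow> mproc \<Rightarrow> mproc" where
  "mshiftp n k p = (fst p, mren (\<lambda>v. if v < n then v else v + k) (snd p))"

text \<open>Substitution on meta-terms: the variables lo..lo+r-1 are replaced by the meta-procedures
  sub 0,...,sub (r-1) (which live at depth s), variables >= lo+r are lowered by dec;
  k counts the binders passed so far (so the current target depth is s+k).\<close>
corec msub :: "nat \<Rightarrow> nat \<Rightarrow> nat \<Rightarrow> nat \<Rightarrow> (nat \<Rightarrow> mproc) \<Rightarrow> nat \<Rightarrow> mexp \<Rightarrow> mexp" where
  "msub lo r dec s sub k e = (case e of MBot \<Rightarrow> MBot | MNum n \<Rightarrow> MNum n
     | MCase g es \<Rightarrow> MCase (msub lo r dec s sub k g) (\<lambda>i. msub lo r dec s sub k (es i))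
     | MVar x qs \<Rightarrow>
         (if x < lo then MVar x (map (\<lambda>(bs,b). (bs, msub lo r dec s sub (k + length bs) b)) qs)
          else if x < lo + r then
            MApp (mshiftp s k (sub (x - lo))) (map (\<lambda>(bs,b). (bs, msub lo r dec s sub (k + length bs) b)) qs)
          else MVar (x - dec) (map (\<lambda>(bs,b). (bs, msub lo r dec s sub (k + length bs) b)) qs))
     | MApp (hs,h) qs \<Rightarrow> MApp (hs, msub lo r dec s sub (k + length hs) h)
           (map (\<lambda>(bs,b). (bs, msub lo r dec s sub (k + length bs) b)) qs))"

definition hstep :: "nat \<Rightarrow> mexp \<Rightarrow> mexp option" where
  "hstep D e = (case e of
      MCase g es \<Rightarrow> (case g of
          MBot \<Rightarrow> Some MBot
        | MNum n \<Rightarrow> Some (es n)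
        | MCase g' fs \<Rightarrow> Some (MCase g' (\<lambda>i. MCase (fs i) es))
        | MApp (hs,h) qs \<Rightarrow>
            (if length qs = length hs
             then Some (MCase (msub D (length hs) (length hs) D (\<lambda>j. qs ! j) 0 h) es)
             else None)
        | MVar _ _ \<Rightarrow> None)
    | _ \<Rightarrow> None)"

fun hiter :: "nat \<Rightarrow> nat \<Rightarrow> mexp \<Rightarrow> mexp" where
  "hiter D 0 e = e"
| "hiter D (Suc n) e = (case hstep D (hiter D n e) of None \<Rightarrow> hiter D n e | Some e' \<Rightarrow> e')"

definition is_hnf :: "mexp \<Rightarrow> bool" where
  "is_hnf e = (case e of MBot \<Rightarrow> True | MNum _ \<Rightarrow> True
      | MCase g _ \<Rightarrow> (case g of MVar _ _ \<Rightarrow> True | _ \<Rightarrow> False) | _ \<Rightarrow> False)"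

definition hnf :: "nat \<Rightarrow> mexp \<Rightarrow> mexp option" where
  "hnf D e = (if \<exists>n. is_hnf (hiter D n e)
              then Some (hiter D (LEAST n. is_hnf (hiter D n e)) e) else None)"

corec eval :: "nat \<Rightarrow> mexp \<Rightarrow> nexp" where
  "eval D e = (case hnf D e of None \<Rightarrow> Bot
     | Some h \<Rightarrow> (case h of MBot \<Rightarrow> Bot | MNum n \<Rightarrow> Num n
         | MCase g es \<Rightarrow> (case g of
              MVar x qs \<Rightarrow> Case x (map (\<lambda>(bs,b). (bs, eval (D + length bs) b)) qs) (\<lambda>i. eval D (es i))
            | _ \<Rightarrow> Bot)
         | _ \<Rightarrow> Bot))"

definition app :: "nat \<Rightarrow> nsp \<Rightarrow> nsp \<Rightarrow> nsp" where
  "app D p q = (case fst p of [] \<Rightarrow> ([], Bot)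
     | t # ts \<Rightarrow> (ts, eval (D + length ts)
                    (msub D 1 1 D (\<lambda>_. embp q) (length ts) (emb (snd p)))))"

lemma size_args_nth: "j < length (args s) \<Longrightarrow> size (args s ! j) < size s"
proof (induction s arbitrary: j)
  case N then show ?case by simp
next
  case (Arr s t) then show ?case by (cases j) fastforce+
qed

function eta :: "ty \<Rightarrow> nat \<Rightarrow> nat \<Rightarrow> nsp" where
  "eta s v D = (args s, Case v (map (\<lambda>j. eta (args s ! j) (D + j) (D + length (args s)))
                                   [0..<length (args s)]) Num)"
  by pat_completeness auto
termination
  by (relation "measure (\<lambda>(s,_,_). size s)") (auto intro: size_args_nth)

text \<open>body of F_sigma[g] (sigma with argument types ss, g at level g) as a procedure at depth D\<close>
corec Fb :: "ty list \<Rightarrow> nat \<Rightarrow> nat \<Rightarrow> nexp" where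
  "Fb ss g D = Case g ((ss, Fb ss g (D + length ss))
       # map (\<lambda>j. eta (ss ! j) (D + j) (D + length ss)) [0..<length ss]) Num"

datatype pcf = PVar nat | PNum nat | PSuc | PPre | PIfz | PY ty | PC "nat \<Rightarrow> nat option"
  | PLam ty pcf | PApp pcf pcf

inductive ptyped :: "nat \<Rightarrow> ty list \<Rightarrow> pcf \<Rightarrow> ty \<Rightarrow> bool" where
  "x < length G \<Longrightarrow> ptyped k G (PVar x) (G ! x)"
| "ptyped k G (PNum n) N"
| "ptyped k G PSuc (Arr N N)"
| "ptyped k G PPre (Arr N N)"
| "ptyped k G PIfz (Arr N (Arr N (Arr N N)))"
| "lv s \<le> k \<Longrightarrow> ptyped k G (PY s) (Arr (Arr s s) s)"
| "ptyped k G (PC f) (Arr N N)"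
| "ptyped k (G @ [s]) M t \<Longrightarrow> ptyped k G (PLam s M) (Arr s t)"
| "ptyped k G M (Arr s t) \<Longrightarrow> ptyped k G M' s \<Longrightarrow> ptyped k G (PApp M M') t"

definition lam1 :: "ty \<Rightarrow> nsp \<Rightarrow> nsp" where
  "lam1 s p = (s # fst p, snd p)"

primrec interp :: "ty list \<Rightarrow> pcf \<Rightarrow> nsp" where
  "interp G (PVar x) = eta (G ! x) x (length G)"
| "interp G (PNum n) = ([], Num n)"
| "interp G PSuc = ([N], Case (length G) [] (\<lambda>i. Num (i + 1)))"
| "interp G PPre = ([N], Case (length G) [] (\<lambda>i. Num (i - 1)))"
| "interp G PIfz = ([N, N, N], Case (length G) []
      (\<lambda>i. if i = 0 then Case (length G + 1) [] Num else Case (length G + 2) [] Num))"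
| "interp G (PY s) = (Arr s s # args s, Fb (args s) (length G) (length G + 1))"
| "interp G (PC f) = ([N], Case (length G) [] (\<lambda>i. case f i of None \<Rightarrow> Bot | Some m \<Rightarrow> Num m))"
| "interp G (PLam s M) = lam1 s (interp (G @ [s]) M)"
| "interp G (PApp M M') = app (length G) (interp G M) (interp G M')"

definition denotable :: "nat \<Rightarrow> ty list \<Rightarrow> ty \<Rightarrow> nsp \<Rightarrow> bool" where
  "denotable k G s p \<longleftrightarrow> (\<exists>M. ptyped k G M s \<and> interp G M = p)"

corec nrepl :: "(nat \<Rightarrow> nexp) \<Rightarrow> nexp \<Rightarrow> nexp" where
  "nrepl g e = (case e of Bot \<Rightarrow> Bot
     | Num n \<Rightarrow> (case g n of Bot \<Rightarrow> Bot | Num m \<Rightarrow> Num m | Case x qs es \<Rightarrow> Case x qs es)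
     | Case x qs es \<Rightarrow> Case x qs (\<lambda>i. nrepl g (es i)))"

text \<open>p[i |-> g i] for p in an environment of depth D, where each g i is an expression at depth D\<close>
definition rsub :: "nat \<Rightarrow> nsp \<Rightarrow> (nat \<Rightarrow> nexp) \<Rightarrow> nsp" where
  "rsub D p g = (fst p, nrepl (\<lambda>i. nshift D (length (fst p)) (g i)) (snd p))"

definition fnum :: "(nat \<Rightarrow> nat option) \<Rightarrow> nat \<Rightarrow> nexp" where
  "fnum f i = (case f i of None \<Rightarrow> Bot | Some m \<Rightarrow> Num m)"

corec mcirc :: "nat \<Rightarrow> nat \<Rightarrow> mexp \<Rightarrow> mexp" where
  "mcirc lo r e = (case e of MBot \<Rightarrow> MBot | MNum n \<Rightarrow> MNum n
     | MCase g es \<Rightarrow> MCase (mcirc lo r g) (\<lambda>i. mcirc lo r (es i))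
     | MVar x qs \<Rightarrow> (if lo \<le> x \<and> x < lo + r then MBot
                     else MVar x (map (\<lambda>(bs,b). (bs, mcirc lo r b)) qs))
     | MApp (hs,h) qs \<Rightarrow> MApp (hs, mcirc lo r h) (map (\<lambda>(bs,b). (bs, mcirc lo r b)) qs))"

coinductive mle :: "mexp \<Rightarrow> mexp \<Rightarrow> bool" where
  "mle MBot e"
| "mle (MNum n) (MNum n)"
| "mle g g' \<Longrightarrow> (\<And>i. mle (es i) (es' i)) \<Longrightarrow> mle (MCase g es) (MCase g' es')"
| "list_all2 (rel_prod (=) mle) qs qs' \<Longrightarrow> mle (MVar x qs) (MVar x qs')"
| "mle h h' \<Longrightarrow> list_all2 (rel_prod (=) mle) qs qs'
     \<Longrightarrow> mle (MApp (hs,h) qs) (MApp (hs,h') qs')"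

text \<open>Plugging Pi_{Gamma,Z}(e,xi): Gamma has length D, Z is the list of levels D..D+r-1,
  e is an expression at depth D+r and xi j is the procedure assigned to the j-th variable of Z
  (a procedure in environment Gamma,Z).\<close>
definition plug_approx :: "nat \<Rightarrow> nat \<Rightarrow> nexp \<Rightarrow> (nat \<Rightarrow> nsp) \<Rightarrow> nat \<Rightarrow> mexp" where
  "plug_approx D r e xi m =
     ((msub D r 0 (D + r) (\<lambda>j. embp (xi j)) 0) ^^ m) (emb e)"

definition plug :: "nat \<Rightarrow> nat \<Rightarrow> nexp \<Rightarrow> (nat \<Rightarrow> nsp) \<Rightarrow> mexp" where
  "plug D r e xi = (THE T. (\<forall>m. mle (mcirc D r (plug_approx D r e xi m)) T)
       \<and> (\<forall>U. (\<forall>m. mle (mcirc D r (plug_approx D r e xi m)) U) \<longrightarrow> mle T U))"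

inductive gen :: "nat \<Rightarrow> ty list \<Rightarrow> ty \<Rightarrow> nsp \<Rightarrow> bool" for k :: nat where
  rule1: "x < length G \<Longrightarrow> G ! x = arrs ss \<Longrightarrow> length qs = length ss
     \<Longrightarrow> (\<And>i. i < length ss \<Longrightarrow> gen k G (ss ! i) (qs ! i))
     \<Longrightarrow> gen k G N ([], Case x qs Num)"
| rule2: "gen k (G @ [s]) t p \<Longrightarrow> gen k G (Arr s t) (lam1 s p)"
| rule3: "gen k G N ([], Num n)"
| rule4: "gen k G s p \<Longrightarrow> gen k G s (rsub (length G) p (fnum f))"
| rule5: "gen k G s p \<Longrightarrow> gen k G N ([], d) \<Longrightarrow> gen k G N ([], e)
     \<Longrightarrow> gen k G s (rsub (length G) p (\<lambda>i. if i = 0 then d else e))"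
| rule6: "gen k G (Arr (arrs ss) (arrs ss)) (arrs ss # ss, e) \<Longrightarrow> lv (arrs ss) \<le> k
     \<Longrightarrow> length qs = length ss \<Longrightarrow> (\<And>i. i < length ss \<Longrightarrow> gen k G (ss ! i) (qs ! i))
     \<Longrightarrow> gen k G N ([], nunshift (length G) (length ss + 1)
            (eval (length G + length ss + 1)
               (plug (length G) (length ss + 1) e
                  (\<lambda>j. if j = 0 then (ss, nshift (length G + 1) (length ss) e)
                       else (fst (qs ! (j - 1)),
                             nshift (length G) (length ss + 1) (snd (qs ! (j - 1))))))))"

end

theory Submission
  imports Defs
begin

text \<open>
  The heart of the matter is that evaluation of infinite meta-terms is compositional: meta-terms
  with equal normal forms may be replaced by each other inside any substitution instance. To see
  this, close \<open>having equal normal forms\<close> under substitution and \<open>case\<close>, and show by induction on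
  the number of head reduction steps that related meta-terms reach related head normal forms. No
  typing is needed. Taking the closure coinductively also identifies recursive unfoldings: the fixed
  point \<open>F = \<lambda>x. case g F (x\<^sup>\<eta>) of (i \<Rightarrow> i)\<close> of \<open>g = \<lambda>z x. e\<close> agrees with
  \<open>W = \<lambda>x. e[z := W]\<close>, which is what plugging produces; thus rule 6 yields exactly the denotation of
  \<open>Y g q\<close>. Types enter only through the fact that denotable procedures are invariant under
  eta-expansion of their variables.

  Closure of the denotable procedures under the rules is then direct programming. Conversely, a
  Kripke logical relation with base case \<open>gen\<close> at ground type contains all denotations; reflection
  of variables (rule 1) and reification (rule 2) turn membership at any type into a derivation.
\<close>

section \<open>Coinduction for expressions and meta-expressions\<close>

definition map_body :: "(nat \<Rightarrow> 'a \<Rightarrow> 'b) \<Rightarrow> ty list \<times> 'a \<Rightarrow> ty list \<times> 'b" where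
  "map_body f p = (fst p, f (length (fst p)) (snd p))"

lemma map_body_simps [simp]:
  "map_body f (bs, b) = (bs, f (length bs) b)"
  "fst (map_body f p) = fst p"
  "snd (map_body f p) = f (length (fst p)) (snd p)"
  by (simp_all add: map_body_def)

lemma map_body_map_body [simp]: "map_body f (map_body g p) = map_body (\<lambda>n x. f n (g n x)) p"
  by (simp add: map_body_def)

lemma map_body_ident: "map_body (\<lambda>_ x. x) p = p" "map_body (\<lambda>_. id) p = p"
  by (simp_all add: map_body_def)

lemma case_prod_map_body:
  "(\<lambda>(bs, b). (bs, f (length bs) b)) = map_body f"
  "(\<lambda>(bs, b). (bs, g b)) = map_body (\<lambda>_. g)"
  by (auto simp: map_body_def fun_eq_iff)

definition rel_body :: "('a \<Rightarrow> 'b \<Rightarrow> bool) \<Rightarrow> ty list \<times> 'a \<Rightarrow> ty list \<times> 'b \<Rightarrow> bool" where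
  "rel_body R p q \<longleftrightarrow> fst p = fst q \<and> R (snd p) (snd q)"

lemma rel_body_simps [simp]:
  "rel_body R (map_body f p) (map_body g q) \<longleftrightarrow>
     fst p = fst q \<and> R (f (length (fst p)) (snd p)) (g (length (fst q)) (snd q))"
  "rel_body R (bs, b) (cs, c) \<longleftrightarrow> bs = cs \<and> R b c"
  by (auto simp: rel_body_def)

lemma rel_body_eq_rel_prod: "rel_body R = rel_prod (=) R"
  by (auto simp: rel_body_def fun_eq_iff rel_prod_sel)

inductive mexp_layer :: "(mexp \<Rightarrow> mexp \<Rightarrow> bool) \<Rightarrow> mexp \<Rightarrow> mexp \<Rightarrow> bool" for R where
  mexp_layer_MBot: "mexp_layer R MBot MBot"
| mexp_layer_MNum: "mexp_layer R (MNum n) (MNum n)"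
| mexp_layer_MCase:
    "R g g' \<Longrightarrow> (\<And>i. R (es i) (es' i)) \<Longrightarrow> mexp_layer R (MCase g es) (MCase g' es')"
| mexp_layer_MVar: "list_all2 (rel_body R) qs qs' \<Longrightarrow> mexp_layer R (MVar x qs) (MVar x qs')"
| mexp_layer_MApp:
    "rel_body R p p' \<Longrightarrow> list_all2 (rel_body R) qs qs' \<Longrightarrow> mexp_layer R (MApp p qs) (MApp p' qs')"

lemma mexp_coinduct_layer:
  assumes "R T T'" and step: "\<And>T T'. R T T' \<Longrightarrow> mexp_layer (\<lambda>a b. R a b \<or> a = b) T T'"
  shows "T = T'"
  using assms(1)
proof (coinduction arbitrary: T T' rule: mexp.coinduct_strong)
  case Eq_mexp
  from step[OF this] show ?case
    by cases (auto simp: rel_body_eq_rel_prod rel_fun_def)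
qed

lemma mexp_family_eqI:
  assumes "\<And>k T. mexp_layer (\<lambda>a b. (\<exists>k T. a = F k T \<and> b = G k T) \<or> a = b) (F k T) (G k T)"
  shows "F k T = G k T"
  by (rule mexp_coinduct_layer[where R = "\<lambda>a b. \<exists>k T. a = F k T \<and> b = G k T"])
    (use assms in \<open>blast+\<close>)

inductive nexp_layer :: "(nexp \<Rightarrow> nexp \<Rightarrow> bool) \<Rightarrow> nexp \<Rightarrow> nexp \<Rightarrow> bool" for R where
  nexp_layer_Bot: "nexp_layer R Bot Bot"
| nexp_layer_Num: "nexp_layer R (Num n) (Num n)"
| nexp_layer_Case:
    "list_all2 (rel_body R) qs qs' \<Longrightarrow> (\<And>i. R (es i) (es' i))
     \<Longrightarrow> nexp_layer R (Case x qs es) (Case x qs' es')"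

lemma nexp_layer_refl: "(\<And>a. R a a) \<Longrightarrow> nexp_layer R e e"
  by (cases e) (auto intro!: nexp_layer.intros list.rel_refl simp: rel_body_def)

lemma nexp_coinduct_layer:
  assumes "R T T'" and step: "\<And>T T'. R T T' \<Longrightarrow> nexp_layer (\<lambda>a b. R a b \<or> a = b) T T'"
  shows "T = T'"
  using assms(1)
proof (coinduction arbitrary: T T' rule: nexp.coinduct_strong)
  case Eq_nexp
  from step[OF this] show ?case
    by cases (auto simp: rel_body_eq_rel_prod rel_fun_def)
qed

lemma nexp_family_eqI:
  assumes "\<And>k T. nexp_layer (\<lambda>a b. (\<exists>k T. a = F k T \<and> b = G k T) \<or> a = b) (F k T) (G k T)"
  shows "F k T = G k T"
  by (rule nexp_coinduct_layer[where R = "\<lambda>a b. \<exists>k T. a = F k T \<and> b = G k T"])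
    (use assms in \<open>blast+\<close>)

lemma list_all2_map_same:
  "(\<And>x. x \<in> set xs \<Longrightarrow> R (f x) (g x)) \<Longrightarrow> list_all2 R (map f xs) (map g xs)"
  by (simp add: list.rel_map list_all2_same)

lemma emb_simps [simp]:
  "emb Bot = MBot"
  "emb (Num n) = MNum n"
  "emb (Case x qs es) = MCase (MVar x (map (map_body (\<lambda>_. emb)) qs)) (\<lambda>i. emb (es i))"
  by (subst emb.code; simp add: case_prod_map_body)+

lemma embp_map_body: "embp = map_body (\<lambda>_. emb)"
  by (simp add: embp_def map_body_def fun_eq_iff)

lemma embp_simps [simp]: "fst (embp p) = fst p" "snd (embp p) = emb (snd p)"
  by (simp_all add: embp_def)

lemma nren_simps [simp]:
  "nren \<rho> Bot = Bot"
  "nren \<rho> (Num n) = Num n"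
  "nren \<rho> (Case x qs es) = Case (\<rho> x) (map (map_body (\<lambda>_. nren \<rho>)) qs) (\<lambda>i. nren \<rho> (es i))"
  by (subst nren.code; simp add: case_prod_map_body)+

lemma mren_simps [simp]:
  "mren \<rho> MBot = MBot"
  "mren \<rho> (MNum n) = MNum n"
  "mren \<rho> (MCase g es) = MCase (mren \<rho> g) (\<lambda>i. mren \<rho> (es i))"
  "mren \<rho> (MVar x qs) = MVar (\<rho> x) (map (map_body (\<lambda>_. mren \<rho>)) qs)"
  "mren \<rho> (MApp p qs) = MApp (map_body (\<lambda>_. mren \<rho>) p) (map (map_body (\<lambda>_. mren \<rho>)) qs)"
  by (subst mren.code; simp add: case_prod_map_body split: prod.split)+

lemma nrepl_simps [simp]:
  "nrepl g Bot = Bot"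
  "nrepl g (Num n) = g n"
  "nrepl g (Case x qs es) = Case x qs (\<lambda>i. nrepl g (es i))"
  by (subst nrepl.code; simp split: nexp.split)+

lemma mcirc_simps [simp]:
  "mcirc lo r MBot = MBot"
  "mcirc lo r (MNum n) = MNum n"
  "mcirc lo r (MCase g es) = MCase (mcirc lo r g) (\<lambda>i. mcirc lo r (es i))"
  "mcirc lo r (MVar x qs) =
     (if lo \<le> x \<and> x < lo + r then MBot else MVar x (map (map_body (\<lambda>_. mcirc lo r)) qs))"
  "mcirc lo r (MApp p qs) =
     MApp (map_body (\<lambda>_. mcirc lo r) p) (map (map_body (\<lambda>_. mcirc lo r)) qs)"
  by (subst mcirc.code; simp add: case_prod_map_body split: prod.split)+

section \<open>Renaming\<close>

definition shift_var :: "nat \<Rightarrow> nat \<Rightarrow> nat \<Rightarrow> nat" where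
  "shift_var n k v = (if v < n then v else v + k)"

abbreviation mshift :: "nat \<Rightarrow> nat \<Rightarrow> mexp \<Rightarrow> mexp" where
  "mshift n k \<equiv> mren (shift_var n k)"

lemma mshiftp_map_body: "mshiftp n k = map_body (\<lambda>_. mshift n k)"
  by (simp add: mshiftp_def map_body_def fun_eq_iff shift_var_def[abs_def])

lemma mren_mren: "mren \<rho> (mren \<rho>' T) = mren (\<lambda>x. \<rho> (\<rho>' x)) T"
proof (rule mexp_family_eqI[where F = "\<lambda>_::unit. \<lambda>T. mren \<rho> (mren \<rho>' T)"], goal_cases layer)
  case (layer _ T)
  show ?case by (cases T) (auto intro!: mexp_layer.intros list_all2_map_same)
qed

lemma mren_id [simp]: "mren (\<lambda>x. x) T = T"
proof (rule mexp_family_eqI[where F = "\<lambda>_::unit. mren (\<lambda>x. x)" and G = "\<lambda>_ T. T"], goal_cases layer)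
  case (layer _ T)
  show ?case
    by (cases T)
      (auto intro!: mexp_layer.intros simp: list.rel_map list_all2_same rel_body_def)
qed

lemma mshift_mshift: "mshift d k (mshift d j T) = mshift d (k + j) T"
  unfolding mren_mren by (rule arg_cong[where f = "\<lambda>\<rho>. mren \<rho> T"]) (auto simp: shift_var_def)

lemma mshift_mshift_inner: "mshift (d + j) k (mshift d j T) = mshift d (k + j) T"
  unfolding mren_mren by (rule arg_cong[where f = "\<lambda>\<rho>. mren \<rho> T"]) (auto simp: shift_var_def)

lemma mshift_0 [simp]: "mshift d 0 T = T"
proof -
  have "shift_var d 0 = (\<lambda>x. x)" by (auto simp: shift_var_def)
  then show ?thesis by simp
qed

lemma mshiftp_0 [simp]: "mshiftp d 0 p = p"
  by (simp add: mshiftp_map_body map_body_def)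

lemma emb_nren: "emb (nren \<rho> e) = mren \<rho> (emb e)"
proof -
  let ?lhs = "map (\<lambda>q. map_body (\<lambda>_. emb) (map_body (\<lambda>_. nren \<rho>) q))"
  let ?rhs = "map (\<lambda>q. map_body (\<lambda>_. mren \<rho>) (map_body (\<lambda>_. emb) q))"
  let ?R = "\<lambda>a b. (\<exists>e. a = emb (nren \<rho> e) \<and> b = mren \<rho> (emb e))
    \<or> (\<exists>x qs. a = MVar x (?lhs qs) \<and> b = MVar x (?rhs qs))"
  show ?thesis
  proof (rule mexp_coinduct_layer[where R = ?R])
    fix a b assume "?R a b"
    then show "mexp_layer (\<lambda>a b. ?R a b \<or> a = b) a b"
    proof (elim disjE exE conjE)
      fix e assume ab: "a = emb (nren \<rho> e)" "b = mren \<rho> (emb e)"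
      show ?thesis
      proof (cases e)
        case (Case x qs es)
        show ?thesis unfolding ab Case by simp (rule mexp_layer.intros, auto simp: comp_def)
      qed (auto simp: ab intro: mexp_layer.intros)
    next
      fix x qs assume ab: "a = MVar x (?lhs qs)" "b = MVar x (?rhs qs)"
      show ?thesis unfolding ab by (auto intro!: mexp_layer.intros list_all2_map_same)
    qed
  qed blast
qed

lemma nren_nren: "nren \<rho> (nren \<rho>' e) = nren (\<lambda>x. \<rho> (\<rho>' x)) e"
proof (rule nexp_family_eqI[where F = "\<lambda>_::unit. \<lambda>e. nren \<rho> (nren \<rho>' e)"], goal_cases layer)
  case (layer _ e)
  show ?case by (cases e) (auto intro!: nexp_layer.intros list_all2_map_same)
qed

lemma nren_id [simp]: "nren (\<lambda>x. x) e = e"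
proof (rule nexp_family_eqI[where F = "\<lambda>_::unit. nren (\<lambda>x. x)" and G = "\<lambda>_ e. e"], goal_cases layer)
  case (layer _ e)
  show ?case
    by (cases e)
      (auto intro!: nexp_layer.intros list.rel_refl_strong simp: list.rel_map rel_body_def)
qed

lemma emb_nshift: "emb (nshift n k e) = mshift n k (emb e)"
proof -
  have "nshift n k = nren (shift_var n k)" by (simp add: nshift_def shift_var_def[abs_def])
  then show ?thesis by (simp add: emb_nren)
qed

lemma nshift_0 [simp]: "nshift n 0 e = e"
proof -
  have "(\<lambda>v. if v < n then v else v + 0) = (\<lambda>v. v)" by auto
  then show ?thesis by (simp add: nshift_def del: add_0_right)
qed

lemma nunshift_nshift: "nunshift n k (nshift n k e) = e"
proof -
  have "(\<lambda>x. (\<lambda>v. if v < n then v else v - k) (if x < n then x else x + k)) = (\<lambda>x. x)"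
    by auto
  then show ?thesis unfolding nunshift_def nshift_def nren_nren by simp
qed

section \<open>Simultaneous substitution\<close>

type_synonym entry = "nat + mproc"

definition lookup :: "nat \<Rightarrow> entry list \<Rightarrow> nat \<Rightarrow> entry" where
  "lookup d us x = (if x < length us then us ! x else Inl (x - length us + d))"

text \<open>The entry \<open>us ! x\<close> is either a variable or a procedure at depth \<open>d\<close>; the source depth is
  \<open>length us\<close>, and all larger levels are bound variables, of which \<open>k\<close> have been passed.\<close>
corec inst :: "nat \<Rightarrow> entry list \<Rightarrow> nat \<Rightarrow> mexp \<Rightarrow> mexp" where
  "inst d us k e = (case e of
       MBot \<Rightarrow> MBot
     | MNum n \<Rightarrow> MNum n
     | MCase g es \<Rightarrow> MCase (inst d us k g) (\<lambda>i. inst d us k (es i))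
     | MVar x qs \<Rightarrow> (case lookup d us x of
           Inl y \<Rightarrow> MVar y (map (\<lambda>(bs,b). (bs, inst d us (k + length bs) b)) qs)
         | Inr p \<Rightarrow> MApp (mshiftp d k p) (map (\<lambda>(bs,b). (bs, inst d us (k + length bs) b)) qs))
     | MApp (hs,h) qs \<Rightarrow> MApp (hs, inst d us (k + length hs) h)
           (map (\<lambda>(bs,b). (bs, inst d us (k + length bs) b)) qs))"

abbreviation instp :: "nat \<Rightarrow> entry list \<Rightarrow> nat \<Rightarrow> mproc \<Rightarrow> mproc" where
  "instp d us k \<equiv> map_body (\<lambda>n. inst d us (k + n))"

lemma inst_simps [simp]:
  "inst d us k MBot = MBot"
  "inst d us k (MNum n) = MNum n"
  "inst d us k (MCase g es) = MCase (inst d us k g) (\<lambda>i. inst d us k (es i))"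
  "inst d us k (MVar x qs) = (case lookup d us x of
       Inl y \<Rightarrow> MVar y (map (instp d us k) qs)
     | Inr p \<Rightarrow> MApp (mshiftp d k p) (map (instp d us k) qs))"
  "inst d us k (MApp p qs) = MApp (instp d us k p) (map (instp d us k) qs)"
  by (subst inst.code; simp add: case_prod_map_body(1)[where f = "\<lambda>n. inst d us (k + n)"]
      split: prod.split sum.split)+

lemma msub_simps [simp]:
  "msub lo r dec s \<theta> k MBot = MBot"
  "msub lo r dec s \<theta> k (MNum n) = MNum n"
  "msub lo r dec s \<theta> k (MCase g es) =
     MCase (msub lo r dec s \<theta> k g) (\<lambda>i. msub lo r dec s \<theta> k (es i))"
  "msub lo r dec s \<theta> k (MVar x qs) =
     (if x < lo then MVar x (map (map_body (\<lambda>n. msub lo r dec s \<theta> (k + n))) qs)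
      else if x < lo + r
      then MApp (mshiftp s k (\<theta> (x - lo))) (map (map_body (\<lambda>n. msub lo r dec s \<theta> (k + n))) qs)
      else MVar (x - dec) (map (map_body (\<lambda>n. msub lo r dec s \<theta> (k + n))) qs))"
  "msub lo r dec s \<theta> k (MApp p qs) =
     MApp (map_body (\<lambda>n. msub lo r dec s \<theta> (k + n)) p)
       (map (map_body (\<lambda>n. msub lo r dec s \<theta> (k + n))) qs)"
  by (subst msub.code; simp add: case_prod_map_body(1)[where f = "\<lambda>n. msub lo r dec s \<theta> (k + n)"]
      split: prod.split)+

definition scoped :: "nat \<Rightarrow> entry list \<Rightarrow> bool" where
  "scoped d us \<longleftrightarrow> (\<forall>y. Inl y \<in> set us \<longrightarrow> y < d)"

lemma scoped_simps [simp]: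
  "scoped d []"
  "scoped d (Inl y # us) \<longleftrightarrow> y < d \<and> scoped d us"
  "scoped d (Inr p # us) \<longleftrightarrow> scoped d us"
  "scoped d (us @ vs) \<longleftrightarrow> scoped d us \<and> scoped d vs"
  by (auto simp: scoped_def)

lemma scoped_maps [simp]:
  "scoped d (map (\<lambda>x. Inr (f x)) xs)"
  "scoped d (map Inr ps)"
  "scoped d (map (Inr \<circ> f) xs)"
  "scoped d (map (Inr \<circ> g \<circ> h) ys)"
  "scoped d (map Inl ns) \<longleftrightarrow> (\<forall>y\<in>set ns. y < d)"
  by (auto simp: scoped_def)

lemma scoped_nth: "scoped d us \<Longrightarrow> x < length us \<Longrightarrow> us ! x = Inl y \<Longrightarrow> y < d"
  unfolding scoped_def by (metis nth_mem)

lemma lookup_append_left: "y < length us \<Longrightarrow> lookup d (us @ vs) y = lookup d us y"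
  by (simp add: lookup_def nth_append)

lemma map_lookup_upt: "length us = n \<Longrightarrow> map (lookup d us) [0..<n] = us"
  by (rule nth_equalityI) (auto simp: lookup_def)

lemma lookup_shift_Inl:
  assumes "scoped d us" "lookup d us x = Inl y"
  shows "lookup d us (shift_var (length us) k x) = Inl (shift_var d k y)"
  using assms scoped_nth[OF assms(1), of x y]
  by (auto simp: lookup_def shift_var_def split: if_splits)

lemma lookup_shift_Inr:
  assumes "lookup d us x = Inr p"
  shows "lookup d us (shift_var (length us) k x) = Inr p"
  using assms by (auto simp: lookup_def shift_var_def split: if_splits)

lemma inst_mshift:
  assumes "scoped d us"
  shows "inst d us (k + j) (mshift (length us) k T) = mshift d k (inst d us j T)"
proof (rule mexp_family_eqI[where F = "\<lambda>j T. inst d us (k + j) (mshift (length us) k T)"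
     and G = "\<lambda>j T. mshift d k (inst d us j T)"], goal_cases layer)
  case (layer j T)
  show ?case
  proof (cases T)
    case (MVar x qs)
    show ?thesis
    proof (cases "lookup d us x")
      case (Inl y)
      show ?thesis
        unfolding MVar using lookup_shift_Inl[OF assms Inl, of k] Inl
        by simp (rule mexp_layer.intros, auto intro!: list_all2_map_same simp: add.assoc, blast)
    next
      case (Inr p)
      show ?thesis
        unfolding MVar using lookup_shift_Inr[OF Inr, of k] Inr
        by simp (rule mexp_layer.intros, auto intro!: list_all2_map_same
            simp: add.assoc mshiftp_map_body mshift_mshift, blast)
    qed
  qed (auto intro!: mexp_layer.intros list_all2_map_same simp: add.assoc, blast+)
qed

definition inst_entry :: "nat \<Rightarrow> entry list \<Rightarrow> entry \<Rightarrow> entry" where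
  "inst_entry d us u = (case u of Inl y \<Rightarrow> lookup d us y | Inr p \<Rightarrow> Inr (instp d us 0 p))"

lemma inst_entry_simps [simp]:
  "inst_entry d us (Inl y) = lookup d us y"
  "inst_entry d us (Inr p) = Inr (instp d us 0 p)"
  by (simp_all add: inst_entry_def)

lemma scoped_map_inst_entry:
  assumes "scoped d vs" "scoped (length vs) us"
  shows "scoped d (map (inst_entry d vs) us)"
proof -
  have "y < d" if u: "u \<in> set us" "inst_entry d vs u = Inl y" for u y
  proof (cases u)
    case (Inl x)
    then have x: "x < length vs" using assms(2) u(1) by (auto simp: scoped_def)
    then show ?thesis using scoped_nth[OF assms(1) x] u(2) Inl by (simp add: lookup_def)
  qed (use u in simp)
  then show ?thesis unfolding scoped_def by (metis (no_types, lifting) image_iff list.set_map)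
qed

lemma inst_inst:
  assumes "scoped d vs"
  shows "inst d vs k (inst (length vs) us k T) = inst d (map (inst_entry d vs) us) k T"
proof (rule mexp_family_eqI[where F = "\<lambda>k T. inst d vs k (inst (length vs) us k T)"
     and G = "\<lambda>k T. inst d (map (inst_entry d vs) us) k T"], goal_cases layer)
  case (layer k T)
  show ?case
  proof (cases T)
    case (MVar x qs)
    have lookup_map:
      "lookup d (map (inst_entry d vs) us) x = inst_entry d vs (lookup (length vs) us x)"
      by (auto simp: lookup_def)
    show ?thesis
    proof (cases "lookup (length vs) us x")
      case (Inl y)
      show ?thesis unfolding MVar
        by (cases "lookup d vs y")
          (auto simp: Inl lookup_map rel_body_def intro!: mexp_layer.intros list_all2_map_same,
            blast+)
    next
      case (Inr p)
      show ?thesis unfolding MVar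
        by (auto simp: Inr lookup_map mshiftp_map_body inst_mshift[OF assms] rel_body_def
            intro!: mexp_layer.intros list_all2_map_same, (blast+)?)
    qed
  qed (auto intro!: mexp_layer.intros list_all2_map_same, (blast+)?)
qed

definition lift_sub :: "nat \<Rightarrow> nat \<Rightarrow> entry list \<Rightarrow> entry list" where
  "lift_sub d n us = map (map_sum id (mshiftp d n)) us @ map Inl [d..<d+n]"

lemma length_lift_sub [simp]: "length (lift_sub d n us) = length us + n"
  by (simp add: lift_sub_def)

lemma scoped_lift_sub:
  assumes "scoped d us"
  shows "scoped (d + n) (lift_sub d n us)"
proof -
  have "y < d + n" if u: "u \<in> set us" "map_sum id (mshiftp d n) u = Inl y" for u y
    using u assms by (cases u rule: sum.exhaust) (auto simp: scoped_def)
  then have "scoped (d + n) (map (map_sum id (mshiftp d n)) us)"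
    unfolding scoped_def by (metis (no_types, lifting) image_iff list.set_map)
  then show ?thesis by (auto simp: lift_sub_def)
qed

lemma lookup_lift_sub:
  "lookup (d + n) (lift_sub d n us) x = map_sum id (mshiftp d n) (lookup d us x)"
  by (auto simp: lookup_def lift_sub_def nth_append)

lemma inst_lift_sub: "inst d us (n + k) T = inst (d + n) (lift_sub d n us) k T"
proof (rule mexp_family_eqI[where F = "\<lambda>k. inst d us (n + k)"
     and G = "\<lambda>k. inst (d + n) (lift_sub d n us) k"], goal_cases layer)
  case (layer k T)
  show ?case
  proof (cases T)
    case (MVar x qs)
    show ?thesis unfolding MVar
      by (cases "lookup d us x")
        (auto simp: lookup_lift_sub mshiftp_map_body mshift_mshift_inner rel_body_def
            add.assoc add.commute[of k n] intro!: mexp_layer.intros list_all2_map_same, metis+)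
  qed (auto simp: add.assoc intro!: mexp_layer.intros list_all2_map_same, (blast+)?)
qed

corollary inst_eq_inst_lift_sub: "inst d us n T = inst (d + n) (lift_sub d n us) 0 T"
  using inst_lift_sub[of d us n 0] by simp

abbreviation id_sub :: "nat \<Rightarrow> entry list" where
  "id_sub n \<equiv> map Inl [0..<n]"

lemma id_sub_add: "id_sub (d + n) = id_sub d @ map Inl [d..<d + n]"
  using upt_add_eq_append[of 0 d n] by simp

lemma lookup_id_sub: "lookup d (id_sub n) x = Inl (if x < n then x else x - n + d)"
  by (simp add: lookup_def)

lemma inst_eq_mren:
  assumes "\<And>x. lookup d us x = Inl (\<rho> x)"
  shows "inst d us k T = mren \<rho> T"
proof (rule mexp_family_eqI[where F = "inst d us" and G = "\<lambda>k. mren \<rho>"], goal_cases layer)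
  case (layer k T)
  show ?case
    by (cases T) (auto simp: assms intro!: mexp_layer.intros list_all2_map_same, blast+)
qed

lemma inst_id_sub_mshift: "inst (n + m) (id_sub n) k T = mshift n m T"
  by (rule inst_eq_mren) (auto simp: lookup_id_sub shift_var_def)

lemma inst_id_sub [simp]: "inst n (id_sub n) k T = T"
  using inst_eq_mren[of n "id_sub n" "\<lambda>x. x" k T] by (simp add: lookup_id_sub)

lemma msub_eq_inst:
  assumes "us = id_sub lo @ map (\<lambda>j. Inr (\<theta> j)) [0..<r]" "dec + s = lo + r"
  shows "msub lo r dec s \<theta> k T = inst s us k T"
proof (rule mexp_family_eqI[where F = "msub lo r dec s \<theta>" and G = "inst s us"], goal_cases layer)
  case (layer k T)
  have "lookup s us x =
      (if x < lo then Inl x else if x < lo + r then Inr (\<theta> (x - lo)) else Inl (x - dec))" for x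
    using assms(2) by (auto simp: lookup_def assms(1) nth_append)
  then show ?case
    by (cases T) (auto simp: mshiftp_map_body rel_body_def
        intro!: mexp_layer.intros list_all2_map_same, blast+)
qed

lemma map_inst_entry_id_sub [simp]: "length us = n \<Longrightarrow> map (inst_entry d us) (id_sub n) = us"
  using map_lookup_upt[of us n d] by (simp add: comp_def)

lemma map_inst_entry_id_sub_shift:
  assumes "scoped d us"
  shows "map (inst_entry (d + n) (id_sub d)) us = map (map_sum id (mshiftp d n)) us"
proof (rule map_cong[OF refl])
  fix u assume "u \<in> set us"
  then show "inst_entry (d + n) (id_sub d) u = map_sum id (mshiftp d n) u"
    using assms
    by (cases u rule: sum.exhaust)
      (auto simp: scoped_def lookup_id_sub mshiftp_map_body map_body_def inst_id_sub_mshift)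
qed

lemma map_inst_entry_id_sub_ident:
  assumes "scoped d us"
  shows "map (inst_entry d (id_sub d)) us = us"
proof -
  have "map_sum id (mshiftp d 0) u = u" for u :: entry
    by (cases u) simp_all
  then show ?thesis
    using map_inst_entry_id_sub_shift[OF assms, of 0] by (simp only: map_idI add_0_right)
qed

lemma inst_weaken_mid:
  assumes "scoped d (us @ ws @ vs)"
  shows "inst d (us @ ws @ vs) k (mshift (length us) (length ws) T) = inst d (us @ vs) k T"
proof -
  let ?a = "length us" and ?m = "length ws" and ?c = "length vs"
  let ?r = "map Inl ([0..<?a] @ [?a + ?m..<?a + ?m + ?c]) :: entry list"
  have "inst (length (us @ ws @ vs)) ?r k T = mshift ?a ?m T"
    by (rule inst_eq_mren) (auto simp: lookup_def shift_var_def nth_append)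
  moreover have "map (inst_entry d (us @ ws @ vs)) ?r = us @ vs"
    by (rule nth_equalityI) (auto simp: lookup_def nth_append)
  ultimately show ?thesis using inst_inst[OF assms, of k ?r T] by simp
qed

lemma inst_weaken:
  "scoped d (us @ vs) \<Longrightarrow> inst d (us @ vs) k (mshift (length us) (length vs) T) = inst d us k T"
  using inst_weaken_mid[of d us vs "[]" k T] by simp

lemma map_inst_entry_lift_sub:
  assumes "length us = d" "length vs = n" "scoped e (us @ vs)" "scoped d ws"
  shows "map (inst_entry e (us @ vs)) (lift_sub d n ws) = map (inst_entry e us) ws @ vs"
proof -
  have "inst_entry e (us @ vs) (map_sum id (mshiftp d n) u) = inst_entry e us u"
    if "u \<in> set ws" for u
  proof (cases u)
    case (Inl y)
    then have "y < d" using assms(4) that by (auto simp: scoped_def)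
    then show ?thesis using Inl assms by (simp add: lookup_append_left)
  next
    case (Inr p)
    then show ?thesis
      using inst_weaken[OF assms(3)] assms(1,2) by (auto simp: mshiftp_map_body map_body_def)
  qed
  moreover have "map (lookup e (us @ vs)) [d..<d+n] = vs"
    using assms by (intro nth_equalityI) (auto simp: lookup_def nth_append)
  ultimately show ?thesis by (simp add: lift_sub_def comp_def)
qed

lemma inst_inst_under:
  assumes "length us = d" "length vs = n" "scoped e (us @ vs)" "scoped d ws"
  shows "inst e (us @ vs) m (inst d ws (n + m) T) = inst e (map (inst_entry e us) ws @ vs) m T"
  using inst_inst[OF assms(3), of m "lift_sub d n ws" T] assms
  by (simp add: inst_lift_sub[of d ws n] map_inst_entry_lift_sub)

abbreviation beta :: "nat \<Rightarrow> mproc list \<Rightarrow> mexp \<Rightarrow> mexp" where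
  "beta D qs \<equiv> inst D (id_sub D @ map Inr qs) 0"

lemma msub_eq_beta:
  assumes "length hs = length qs"
  shows "msub D (length hs) (length hs) D (\<lambda>j. qs ! j) 0 h = beta D qs h"
proof -
  have "map (\<lambda>j. Inr (qs ! j)) [0..<length hs] = (map Inr qs :: entry list)"
    by (rule nth_equalityI) (simp_all add: assms)
  then show ?thesis by (intro msub_eq_inst) simp_all
qed

lemma inst_beta:
  assumes "scoped d us"
  shows "inst d us 0 (beta (length us) rs h)
    = beta d (map (instp d us 0) rs) (inst d us (length rs) h)"
proof -
  have "inst d us 0 (beta (length us) rs h)
      = inst d (us @ map (\<lambda>r. Inr (instp d us 0 r)) rs) 0 h"
    using inst_inst[OF assms, of 0 "id_sub (length us) @ map Inr rs" h]
      map_lookup_upt[of us "length us" d]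
    by (simp add: comp_def)
  also have "\<dots> = beta d (map (instp d us 0) rs) (inst d us (length rs) h)"
    using inst_inst_under[of "id_sub d" d "map Inr (map (instp d us 0) rs)" "length rs" d us 0]
    by (simp add: assms map_inst_entry_id_sub_ident comp_def)
  finally show ?thesis .
qed

section \<open>Head evaluation and normal forms\<close>

datatype (discs_sels) head = HNum nat | HCase nat "mproc list" "nat \<Rightarrow> mexp"

inductive head_eval :: "nat \<Rightarrow> nat \<Rightarrow> mexp \<Rightarrow> head \<Rightarrow> bool" for D where
  head_eval_MNum: "head_eval D 0 (MNum n) (HNum n)"
| head_eval_MVar: "head_eval D 0 (MVar x qs) (HCase x qs MNum)"
| head_eval_MApp:
    "length qs = length hs \<Longrightarrow> head_eval D n (beta D qs h) H
     \<Longrightarrow> head_eval D (Suc n) (MApp (hs, h) qs) H"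
| head_eval_MCase_HNum:
    "head_eval D n g (HNum j) \<Longrightarrow> head_eval D m (es j) H
     \<Longrightarrow> head_eval D (Suc (n + m)) (MCase g es) H"
| head_eval_MCase_HCase:
    "head_eval D n g (HCase x qs fs)
     \<Longrightarrow> head_eval D (Suc n) (MCase g es) (HCase x qs (\<lambda>i. MCase (fs i) es))"

inductive_cases head_eval_MBotE [elim!]: "head_eval D n MBot H"
inductive_cases head_eval_MNumE [elim!]: "head_eval D n (MNum m) H"
inductive_cases head_eval_MVarE [elim!]: "head_eval D n (MVar x qs) H"
inductive_cases head_eval_MAppE: "head_eval D n (MApp p qs) H"
inductive_cases head_eval_MCaseE: "head_eval D n (MCase g es) H"

lemma head_eval_det: "head_eval D n T H \<Longrightarrow> head_eval D n' T H' \<Longrightarrow> n' = n \<and> H' = H"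
proof (induction arbitrary: n' H' rule: head_eval.induct)
  case (head_eval_MApp qs hs n h H)
  from head_eval_MApp.prems show ?case
    by (rule head_eval_MAppE) (use head_eval_MApp.IH in auto)
next
  case (head_eval_MCase_HNum n g j m es H)
  from head_eval_MCase_HNum.prems show ?case
    by (rule head_eval_MCaseE) (fastforce dest: head_eval_MCase_HNum.IH)+
next
  case (head_eval_MCase_HCase n g x qs fs es)
  from head_eval_MCase_HCase.prems show ?case
    by (rule head_eval_MCaseE) (fastforce dest: head_eval_MCase_HCase.IH)+
qed auto

definition head_of :: "nat \<Rightarrow> mexp \<Rightarrow> head option" where
  "head_of D T =
     (if \<exists>n H. head_eval D n T H then Some (THE H. \<exists>n. head_eval D n T H) else None)"

lemma head_of_eq_Some: "head_of D T = Some H \<longleftrightarrow> (\<exists>n. head_eval D n T H)"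
proof -
  have "(THE H. \<exists>n. head_eval D n T H) = H'" if "head_eval D n T H'" for n H'
    using that head_eval_det by (intro the_equality) blast+
  then show ?thesis by (auto simp: head_of_def)
qed

lemma head_of_eq_None: "head_of D T = None \<longleftrightarrow> (\<forall>n H. \<not> head_eval D n T H)"
  by (auto simp: head_of_def)

text \<open>On an application or variable that is not scrutinised by a \<open>case\<close>, \<open>eval\<close> returns \<open>Bot\<close>, so
  it is not compositional on arbitrary meta-terms. The variant \<open>nf\<close> is, and it agrees with \<open>eval\<close>
  on meta-terms of sort \<open>Expr\<close>, where such ground terms occur only below a \<open>case\<close>.\<close>
corec nf :: "nat \<Rightarrow> mexp \<Rightarrow> nexp" where
  "nf D T = (case head_of D T of
       None \<Rightarrow> Bot
     | Some H \<Rightarrow> (case H of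
           HNum n \<Rightarrow> Num n
         | HCase x qs fs \<Rightarrow>
             Case x (map (\<lambda>(bs,b). (bs, nf (D + length bs) b)) qs) (\<lambda>i. nf D (fs i))))"

abbreviation nfp :: "nat \<Rightarrow> mproc \<Rightarrow> nsp" where
  "nfp D \<equiv> map_body (\<lambda>n. nf (D + n))"

lemma nf_HNum: "head_eval D n T (HNum m) \<Longrightarrow> nf D T = Num m"
  using head_of_eq_Some[of D T "HNum m"] by (subst nf.code) auto

lemma nf_HCase:
  "head_eval D n T (HCase x qs fs) \<Longrightarrow> nf D T = Case x (map (nfp D) qs) (\<lambda>i. nf D (fs i))"
  using head_of_eq_Some[of D T "HCase x qs fs"]
  by (subst nf.code) (auto simp: case_prod_map_body(1)[where f = "\<lambda>n. nf (D + n)"])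

lemma nf_no_head: "(\<And>n H. \<not> head_eval D n T H) \<Longrightarrow> nf D T = Bot"
  using head_of_eq_None[of D T] by (subst nf.code) auto

lemma nf_cases:
  obtains (no_head) "\<And>n H. \<not> head_eval D n T H" "nf D T = Bot"
  | (HNum) n m where "head_eval D n T (HNum m)" "nf D T = Num m"
  | (HCase) n x qs fs where "head_eval D n T (HCase x qs fs)"
      "nf D T = Case x (map (nfp D) qs) (\<lambda>i. nf D (fs i))"
proof (cases "\<exists>n H. head_eval D n T H")
  case True
  then obtain n H where "head_eval D n T H" by blast
  then show thesis by (cases H) (use nf_HNum nf_HCase HNum HCase in blast)+
next
  case False
  then show thesis using no_head nf_no_head by blast
qed

lemma nf_simps [simp]:
  "nf D MBot = Bot"
  "nf D (MNum n) = Num n"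
  "nf D (MVar x qs) = Case x (map (nfp D) qs) Num"
proof -
  show "nf D MBot = Bot" by (rule nf_no_head) auto
  show nf_MNum: "nf D (MNum n) = Num n" for n by (rule nf_HNum[OF head_eval_MNum])
  show "nf D (MVar x qs) = Case x (map (nfp D) qs) Num"
    using nf_HCase[OF head_eval_MVar, of D x qs] by (simp add: nf_MNum)
qed

lemma nf_eq_if_same_heads:
  assumes "\<And>H. (\<exists>n. head_eval D n T H) \<longleftrightarrow> (\<exists>n. head_eval D n T' H)"
  shows "nf D T = nf D T'"
proof -
  have "head_of D T = head_of D T'"
    using assms head_of_eq_Some by (metis option.exhaust)
  then show ?thesis by (subst (1 2) nf.code) simp
qed

lemma nf_MApp: "length qs = length hs \<Longrightarrow> nf D (MApp (hs, h) qs) = nf D (beta D qs h)"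
  by (rule nf_eq_if_same_heads) (auto elim!: head_eval_MAppE intro: head_eval_MApp)

lemma nf_MCase_HNum:
  assumes "head_eval D n g (HNum j)"
  shows "nf D (MCase g es) = nf D (es j)"
proof (rule nf_eq_if_same_heads)
  fix H
  show "(\<exists>n. head_eval D n (MCase g es) H) = (\<exists>n. head_eval D n (es j) H)"
  proof
    assume "\<exists>n. head_eval D n (MCase g es) H"
    then show "\<exists>n. head_eval D n (es j) H"
      using assms by (auto elim!: head_eval_MCaseE dest: head_eval_det)
  qed (use assms head_eval_MCase_HNum in blast)
qed

lemma nf_MCase: "nf D (MCase g es) = nrepl (\<lambda>i. nf D (es i)) (nf D g)"
proof (rule nexp_family_eqI[where F = "\<lambda>_::unit. \<lambda>g. nf D (MCase g es)"
      and G = "\<lambda>_ g. nrepl (\<lambda>i. nf D (es i)) (nf D g)"], goal_cases layer)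
  case (layer _ g)
  show ?case
  proof (cases D g rule: nf_cases)
    case no_head
    then have "nf D (MCase g es) = Bot" by (intro nf_no_head) (auto elim: head_eval_MCaseE)
    then show ?thesis using no_head by (auto intro: nexp_layer.intros)
  next
    case (HNum n m)
    then show ?thesis using nf_MCase_HNum[OF HNum(1), of es] by (simp add: nexp_layer_refl)
  next
    case (HCase n x qs fs)
    show ?thesis
      unfolding nf_HCase[OF head_eval_MCase_HCase[OF HCase(1)]] HCase(2) nrepl_simps
      by (rule nexp_layer.intros) (auto intro!: list.rel_refl simp: rel_body_def)
  qed
qed

lemma nrepl_nrepl: "nrepl f (nrepl g e) = nrepl (\<lambda>i. nrepl f (g i)) e"
proof (rule nexp_family_eqI[where F = "\<lambda>_::unit. \<lambda>e. nrepl f (nrepl g e)"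
      and G = "\<lambda>_. nrepl (\<lambda>i. nrepl f (g i))"], goal_cases layer)
  case (layer _ e)
  show ?case
    by (cases e)
      (auto intro!: nexp_layer_refl nexp_layer.intros list.rel_refl simp: rel_body_def)
qed

lemma nrepl_Num [simp]: "nrepl Num e = e"
proof (rule nexp_family_eqI[where F = "\<lambda>_::unit. nrepl Num" and G = "\<lambda>_ e. e"], goal_cases layer)
  case (layer _ e)
  show ?case
    by (cases e) (auto intro!: nexp_layer.intros list.rel_refl simp: rel_body_def)
qed

lemma nf_MCase_MNum [simp]: "nf D (MCase g MNum) = nf D g"
  by (simp add: nf_MCase)

lemma nf_emb [simp]: "nf D (emb e) = e"
proof (rule nexp_family_eqI[where F = "\<lambda>D e. nf D (emb e)" and G = "\<lambda>D e. e"], goal_cases layer)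
  case (layer D e)
  show ?case
    by (cases e) (auto intro!: nexp_layer.intros list.rel_refl_strong
        simp: rel_body_def nf_MCase list.rel_map, blast)
qed

datatype msort = Ground | Expr

coinductive well_sorted :: "msort \<Rightarrow> mexp \<Rightarrow> bool" where
  "well_sorted c MBot"
| "well_sorted c (MNum n)"
| "well_sorted Ground g \<Longrightarrow> \<forall>i. well_sorted Expr (es i) \<Longrightarrow> well_sorted c (MCase g es)"
| "\<forall>q\<in>set qs. well_sorted Expr (snd q) \<Longrightarrow> well_sorted Ground (MVar x qs)"
| "well_sorted Expr (snd p) \<Longrightarrow> \<forall>q\<in>set qs. well_sorted Expr (snd q)
   \<Longrightarrow> well_sorted Ground (MApp p qs)"

lemma well_sorted_simps [simp]:
  "well_sorted c MBot"
  "well_sorted c (MNum n)"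
  "well_sorted c (MCase g es) \<longleftrightarrow> well_sorted Ground g \<and> (\<forall>i. well_sorted Expr (es i))"
  "well_sorted c (MVar x qs) \<longleftrightarrow> c = Ground \<and> (\<forall>q\<in>set qs. well_sorted Expr (snd q))"
  "well_sorted c (MApp p qs) \<longleftrightarrow>
     c = Ground \<and> well_sorted Expr (snd p) \<and> (\<forall>q\<in>set qs. well_sorted Expr (snd q))"
  by (subst well_sorted.simps; auto)+

lemma well_sorted_Ground: "well_sorted Expr T \<Longrightarrow> well_sorted Ground T"
  by (cases T) auto

lemma well_sorted_emb [simp]: "well_sorted c (emb e)"
proof -
  have "\<exists>e. T = emb e \<or> (c = Ground \<and> (\<exists>x qs. T = MVar x (map (map_body (\<lambda>_. emb)) qs)))
      \<Longrightarrow> well_sorted c T" for T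
  proof (coinduction arbitrary: c T)
    case well_sorted
    then show ?case
    proof (elim exE disjE conjE)
      fix e assume "T = emb e"
      then show ?thesis by (cases e) auto
    qed auto
  qed
  then show ?thesis by blast
qed

lemma well_sorted_mren:
  assumes "well_sorted c T"
  shows "well_sorted c (mren \<rho> T)"
proof -
  have "\<exists>T. U = mren \<rho> T \<and> well_sorted c T \<Longrightarrow> well_sorted c U" for U
  proof (coinduction arbitrary: c U)
    case well_sorted
    then obtain T where "U = mren \<rho> T" "well_sorted c T" by blast
    then show ?case by (cases T) auto
  qed
  then show ?thesis using assms by blast
qed

lemma well_sorted_inst:
  assumes procs: "\<And>p. Inr p \<in> set us \<Longrightarrow> well_sorted Expr (snd p)" and "well_sorted c T"
  shows "well_sorted c (inst d us k T)"
proof -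
  have lookup_sorted: "well_sorted Expr (mren \<rho> (snd p))" if "lookup d us x = Inr p" for x p \<rho>
  proof -
    have "Inr p \<in> set us" using that by (auto simp: lookup_def split: if_splits) (metis nth_mem)
    then show ?thesis using procs well_sorted_mren by blast
  qed
  have "\<exists>k T. U = inst d us k T \<and> well_sorted c T \<Longrightarrow> well_sorted c U" for U
  proof (coinduction arbitrary: c U)
    case well_sorted
    then obtain k T where U: "U = inst d us k T" and T: "well_sorted c T" by blast
    show ?case
    proof (cases T)
      case (MVar x qs)
      then show ?thesis using U T
        by (cases "lookup d us x")
          (auto simp: mshiftp_map_body dest: lookup_sorted, (metis (no_types))?)
    qed (use U T in auto)
  qed
  then show ?thesis using assms(2) by blast
qed

lemma hstep_nf: "hstep D T = Some T' \<Longrightarrow> nf D T' = nf D T"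
  by (auto simp: hstep_def nf_MCase nrepl_nrepl msub_eq_beta nf_MApp
      split: mexp.splits prod.splits if_splits)

lemma hstep_well_sorted: "hstep D T = Some T' \<Longrightarrow> well_sorted Expr T \<Longrightarrow> well_sorted Expr T'"
  by (auto simp: hstep_def msub_eq_beta split: mexp.splits prod.splits if_splits
      intro!: well_sorted_Ground well_sorted_inst) (metis snd_conv)

lemma hiter_nf: "well_sorted Expr T \<Longrightarrow> nf D (hiter D m T) = nf D T"
  and hiter_well_sorted: "well_sorted Expr T \<Longrightarrow> well_sorted Expr (hiter D m T)"
  by (induction m) (auto split: option.splits dest: hstep_nf hstep_well_sorted)

abbreviation head_reduces :: "nat \<Rightarrow> mexp \<Rightarrow> mexp \<Rightarrow> bool" where
  "head_reduces D \<equiv> (\<lambda>a b. hstep D a = Some b)\<^sup>*\<^sup>*"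

lemma head_reduces_hiter: "head_reduces D T T' \<Longrightarrow> \<exists>m. hiter D m T = T'"
proof (induction rule: rtranclp_induct)
  case base
  show ?case by (rule exI[of _ 0]) simp
next
  case (step U V)
  then obtain m where "hiter D m T = U" by blast
  then have "hiter D (Suc m) T = V" using step by simp
  then show ?case by blast
qed

lemma head_eval_head_reduces:
  "head_eval D n g H \<Longrightarrow> (case H of
       HNum j \<Rightarrow> head_reduces D (MCase g es) (es j)
     | HCase x qs fs \<Rightarrow> \<exists>es'. head_reduces D (MCase g es) (MCase (MVar x qs) es'))"
proof (induction arbitrary: es rule: head_eval.induct)
  case (head_eval_MNum n)
  then show ?case by (auto simp: hstep_def)
next
  case (head_eval_MVar x qs)
  then show ?case by auto
next
  case (head_eval_MApp qs hs n h H)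
  have "hstep D (MCase (MApp (hs, h) qs) es) = Some (MCase (beta D qs h) es)"
    using head_eval_MApp.hyps by (simp add: hstep_def msub_eq_beta)
  then show ?case using head_eval_MApp.IH[of es]
    by (cases H) (auto intro: converse_rtranclp_into_rtranclp)
next
  case (head_eval_MCase_HNum n g j m fs H)
  have "hstep D (MCase (MCase g fs) es) = Some (MCase g (\<lambda>i. MCase (fs i) es))"
    by (simp add: hstep_def)
  then have "head_reduces D (MCase (MCase g fs) es) (MCase (fs j) es)"
    using head_eval_MCase_HNum.IH(1)[of "\<lambda>i. MCase (fs i) es"]
    by (auto intro: converse_rtranclp_into_rtranclp)
  then show ?case
    using head_eval_MCase_HNum.IH(2)[of es] by (cases H) (auto dest: rtranclp_trans)
next
  case (head_eval_MCase_HCase n g x qs gs fs)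
  have "hstep D (MCase (MCase g fs) es) = Some (MCase g (\<lambda>i. MCase (fs i) es))"
    by (simp add: hstep_def)
  then show ?case
    using head_eval_MCase_HCase.IH(1)[of "\<lambda>i. MCase (fs i) es"]
    by (auto intro: converse_rtranclp_into_rtranclp)
qed

lemma head_eval_reaches_hnf:
  "head_eval D n T H \<Longrightarrow> well_sorted Expr T \<Longrightarrow> \<exists>T'. head_reduces D T T' \<and> is_hnf T'"
proof (induction rule: head_eval.induct)
  case (head_eval_MNum n)
  then show ?case by (auto simp: is_hnf_def intro!: exI[of _ "MNum n"])
next
  case (head_eval_MCase_HNum n g j m es H)
  then obtain T' where "head_reduces D (es j) T'" "is_hnf T'" by auto
  then show ?case
    using head_eval_head_reduces[OF head_eval_MCase_HNum.hyps(1), of es]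
    by (auto dest: rtranclp_trans)
next
  case (head_eval_MCase_HCase n g x qs fs es)
  then obtain es' where "head_reduces D (MCase g es) (MCase (MVar x qs) es')"
    using head_eval_head_reduces[OF head_eval_MCase_HCase.hyps(1), of es] by auto
  moreover have "is_hnf (MCase (MVar x qs) es')" by (simp add: is_hnf_def)
  ultimately show ?case by blast
qed auto

lemma is_hnf_cases:
  assumes "is_hnf h"
  obtains (MBot) "h = MBot" | (MNum) n where "h = MNum n"
  | (MCase) x qs es where "h = MCase (MVar x qs) es"
  using assms by (auto simp: is_hnf_def split: mexp.splits)

lemma hnf_SomeD:
  assumes "hnf D T = Some h"
  obtains m where "h = hiter D m T" "is_hnf h"
  using assms by (metis (mono_tags, lifting) LeastI_ex hnf_def option.distinct(1) option.inject)

lemma eval_None: "hnf D T = None \<Longrightarrow> eval D T = Bot"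
  by (subst eval.code) simp

lemma eval_Some:
  "hnf D T = Some MBot \<Longrightarrow> eval D T = Bot"
  "hnf D T = Some (MNum n) \<Longrightarrow> eval D T = Num n"
  "hnf D T = Some (MCase (MVar x qs) es) \<Longrightarrow>
     eval D T = Case x (map (map_body (\<lambda>n. eval (D + n))) qs) (\<lambda>i. eval D (es i))"
  by (subst eval.code; simp add: case_prod_map_body(1)[where f = "\<lambda>n. eval (D + n)"])+

lemma eval_eq_nf:
  assumes "well_sorted Expr T"
  shows "eval D T = nf D T"
proof -
  let ?R = "\<lambda>a b. \<exists>D T. a = eval D T \<and> b = nf D T \<and> well_sorted Expr T"
  show ?thesis
  proof (rule nexp_coinduct_layer[where R = ?R])
    fix a b assume "?R a b"
    then obtain D T where ab: "a = eval D T" "b = nf D T" and T: "well_sorted Expr T" by blast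
    show "nexp_layer (\<lambda>a b. ?R a b \<or> a = b) a b"
    proof (cases "hnf D T")
      case None
      have "\<not> head_eval D n T H" for n H
        using head_eval_reaches_hnf[of D n T H] T None head_reduces_hiter
        by (fastforce simp: hnf_def split: if_splits)
      then show ?thesis by (simp add: ab nf_no_head eval_None[OF None] nexp_layer.intros)
    next
      case (Some h)
      then obtain m where m: "h = hiter D m T" and hnf: "is_hnf h" by (rule hnf_SomeD)
      have h: "well_sorted Expr h" "nf D T = nf D h"
        using hiter_nf[OF T] hiter_well_sorted[OF T] m by auto
      from hnf show ?thesis
      proof (cases rule: is_hnf_cases)
        case (MCase x qs es)
        have "nf D T = Case x (map (nfp D) qs) (\<lambda>i. nf D (es i))"
          by (simp add: h(2) MCase nf_MCase)
        then show ?thesis using h(1) MCase Some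
          by (auto simp: ab eval_Some intro!: nexp_layer.intros list_all2_map_same) (metis snd_conv)
      qed (use Some h ab in \<open>auto simp: eval_Some intro!: nexp_layer.intros\<close>)
    qed
  qed (use assms in blast)
qed

section \<open>Head evaluation of substitution instances\<close>

inductive head_eq :: "nat \<Rightarrow> head \<Rightarrow> head \<Rightarrow> bool" for d where
  head_eq_HNum: "head_eq d (HNum j) (HNum j)"
| head_eq_HCase:
    "(\<And>i. nf d (fs i) = nf d (fs' i)) \<Longrightarrow> head_eq d (HCase x qs fs) (HCase x qs fs')"

inductive_simps head_eq_simps [simp]:
  "head_eq d (HNum j) H"
  "head_eq d H (HNum j)"
  "head_eq d (HCase x qs fs) H"
  "head_eq d H (HCase x qs fs)"

lemma head_eq_refl [simp]: "head_eq d H H"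
  by (cases H) auto

lemma head_eq_sym: "head_eq d H H' \<Longrightarrow> head_eq d H' H"
  by (cases H) auto

lemma head_eq_trans: "head_eq d H H' \<Longrightarrow> head_eq d H' H'' \<Longrightarrow> head_eq d H H''"
  by (cases H) auto

primrec head_term :: "head \<Rightarrow> mexp" where
  "head_term (HNum j) = MNum j"
| "head_term (HCase x qs fs) = MCase (MVar x qs) fs"

lemma head_eval_MCaseD:
  "head_eval d n (MCase g es) H \<Longrightarrow> \<exists>m Hg. m < n \<and> head_eval d m g Hg"
  by (erule head_eval_MCaseE) (metis less_add_Suc1, metis lessI)

lemma head_eval_MCase_cong:
  assumes "head_eval d m g Hg" "head_eval d m' g' Hg'" "head_eq d Hg Hg'"
    and "head_eval d n (MCase g es) H"
  obtains n' H' where "head_eval d n' (MCase g' es) H'" "head_eq d H H'" "n' + m = n + m'"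
  using assms(4)
proof (rule head_eval_MCaseE)
  fix k j l
  assume n: "n = Suc (k + l)" and g: "head_eval d k g (HNum j)" and es: "head_eval d l (es j) H"
  have "k = m" "Hg' = HNum j" using head_eval_det[OF g assms(1)] assms(3) by auto
  then have "head_eval d (Suc (m' + l)) (MCase g' es) H"
    using assms(2) es by (auto intro: head_eval_MCase_HNum)
  then show thesis by (rule that) (simp_all add: n \<open>k = m\<close>)
next
  fix k x qs fs
  assume n: "n = Suc k" and g: "head_eval d k g (HCase x qs fs)"
    and H: "H = HCase x qs (\<lambda>i. MCase (fs i) es)"
  have k: "k = m" and Hg: "Hg = HCase x qs fs" using head_eval_det[OF g assms(1)] by auto
  then obtain fs' where Hg': "Hg' = HCase x qs fs'" "\<And>i. nf d (fs i) = nf d (fs' i)"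
    using assms(3) by auto
  have "head_eval d (Suc m') (MCase g' es) (HCase x qs (\<lambda>i. MCase (fs' i) es))"
    using assms(2) unfolding Hg' by (rule head_eval_MCase_HCase)
  then show thesis using n k H Hg' by (intro that) (auto simp: nf_MCase)
qed

lemma head_eval_MCase_MNumI:
  assumes "head_eval d n T H"
  obtains H' where "head_eval d (Suc n) (MCase T MNum) H'" "head_eq d H H'"
proof (cases H)
  case (HNum j)
  then show thesis
    using head_eval_MCase_HNum[of d n T j 0 MNum H] assms that[of H]
    by (auto intro: head_eval_MNum)
next
  case (HCase x qs fs)
  then show thesis using head_eval_MCase_HCase[of d n T x qs fs MNum] assms that by simp
qed

lemma head_eval_MCase_MNumD:
  assumes "head_eval d n (MCase T MNum) H"
  obtains n' H' where "n = Suc n'" "head_eval d n' T H'" "head_eq d H H'"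
  using assms by (rule head_eval_MCaseE) (auto intro: that)

lemma head_eval_case_of_case:
  assumes "head_eval d n (MCase (MCase X F) E) H"
  obtains n' H' where "n' \<le> n" "head_eval d n' (MCase X (\<lambda>i. MCase (F i) E)) H'" "head_eq d H H'"
  using assms
proof (rule head_eval_MCaseE)
  fix k j l
  assume n: "n = Suc (k + l)" and X: "head_eval d k (MCase X F) (HNum j)"
    and E: "head_eval d l (E j) H"
  from X obtain a i b where k: "k = Suc (a + b)" "head_eval d a X (HNum i)"
    "head_eval d b (F i) (HNum j)"
    by (rule head_eval_MCaseE) auto
  have "head_eval d (Suc (b + l)) (MCase (F i) E) H"
    using k(3) E by (rule head_eval_MCase_HNum)
  with k(2) have "head_eval d (Suc (a + Suc (b + l))) (MCase X (\<lambda>i. MCase (F i) E)) H"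
    by (rule head_eval_MCase_HNum)
  then show thesis using n k(1) by (intro that) (auto simp: add.assoc)
next
  fix k x qs fs
  assume n: "n = Suc k" and X: "head_eval d k (MCase X F) (HCase x qs fs)"
    and H: "H = HCase x qs (\<lambda>i. MCase (fs i) E)"
  from X show thesis
  proof (rule head_eval_MCaseE)
    fix a i b
    assume k: "k = Suc (a + b)" and "head_eval d a X (HNum i)"
      and F: "head_eval d b (F i) (HCase x qs fs)"
    then have "head_eval d (Suc (a + Suc b)) (MCase X (\<lambda>i. MCase (F i) E)) H"
      unfolding H by (intro head_eval_MCase_HNum head_eval_MCase_HCase)
    then show thesis using n k by (intro that) auto
  next
    fix a y rs ks
    assume k: "k = Suc a" and X: "head_eval d a X (HCase y rs ks)"
      and "HCase x qs fs = HCase y rs (\<lambda>i. MCase (ks i) F)"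
    then show thesis using that[OF _ head_eval_MCase_HCase[OF X, of "\<lambda>i. MCase (F i) E"]] n H
      by (simp add: nf_MCase nrepl_nrepl)
  qed
qed

lemma head_eval_case_of_case_conv:
  assumes "head_eval d n (MCase X (\<lambda>i. MCase (F i) E)) H"
  obtains n' H' where "head_eval d n' (MCase (MCase X F) E) H'" "head_eq d H H'"
  using assms
proof (rule head_eval_MCaseE)
  fix k j l
  assume X: "head_eval d k X (HNum j)" and F: "head_eval d l (MCase (F j) E) H"
  from F show thesis
  proof (rule head_eval_MCaseE)
    fix a i b
    assume "head_eval d a (F j) (HNum i)" "head_eval d b (E i) H"
    then have "head_eval d (Suc (Suc (k + a) + b)) (MCase (MCase X F) E) H"
      using X by (intro head_eval_MCase_HNum)
    then show thesis using that by simp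
  next
    fix a y rs ks
    assume "head_eval d a (F j) (HCase y rs ks)" and H: "H = HCase y rs (\<lambda>i. MCase (ks i) E)"
    then have "head_eval d (Suc (Suc (k + a))) (MCase (MCase X F) E) H"
      unfolding H using X by (intro head_eval_MCase_HNum head_eval_MCase_HCase)
    then show thesis using that by simp
  qed
next
  fix k x qs fs
  assume X: "head_eval d k X (HCase x qs fs)"
    and H: "H = HCase x qs (\<lambda>i. MCase (fs i) (\<lambda>i. MCase (F i) E))"
  show thesis
    using that[OF head_eval_MCase_HCase[OF head_eval_MCase_HCase[OF X, of F], of E]]
    by (simp add: H nf_MCase nrepl_nrepl)
qed

text \<open>In the bound \<open>Suc n\<close>, the extra step pays for the \<open>case\<close> that \<open>head_term\<close> puts around the head
  variable.\<close>
definition through_head :: "nat \<Rightarrow> entry list \<Rightarrow> nat \<Rightarrow> mexp \<Rightarrow> head \<Rightarrow> bool" where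
  "through_head d us n B H \<longleftrightarrow> (\<exists>m Hb n' H'. head_eval (length us) m B Hb \<and> n' \<le> Suc n \<and>
     head_eval d n' (inst d us 0 (head_term Hb)) H' \<and> head_eq d H H')"

lemma through_headI:
  "head_eval (length us) m B Hb \<Longrightarrow> head_eval d n' (inst d us 0 (head_term Hb)) H' \<Longrightarrow> n' \<le> Suc n
   \<Longrightarrow> head_eq d H H' \<Longrightarrow> through_head d us n B H"
  unfolding through_head_def by blast

lemma through_headE:
  assumes "through_head d us n B H"
  obtains m Hb n' H' where "head_eval (length us) m B Hb" "n' \<le> Suc n"
    "head_eval d n' (inst d us 0 (head_term Hb)) H'" "head_eq d H H'"
  using assms unfolding through_head_def by blast

lemma through_head_mono:
  "through_head d us n B H \<Longrightarrow> n \<le> k \<Longrightarrow> head_eq d H' H \<Longrightarrow> through_head d us k B H'"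
  unfolding through_head_def by (meson Suc_le_mono head_eq_trans order_trans)

lemma through_head_MVar:
  assumes "head_eval d n (inst d us 0 (MVar x qs)) H"
  shows "through_head d us n (MVar x qs) H"
proof -
  obtain H' where "head_eval d (Suc n) (MCase (inst d us 0 (MVar x qs)) MNum) H'"
    and H': "head_eq d H H'"
    using assms by (rule head_eval_MCase_MNumI)
  then have "head_eval d (Suc n) (inst d us 0 (head_term (HCase x qs MNum))) H'" by simp
  from through_headI[OF head_eval_MVar this _ H'] show ?thesis by simp
qed

lemma through_head_MApp:
  assumes "length rs = length hs" "through_head d us n (beta (length us) rs h) H"
  shows "through_head d us (Suc n) (MApp (hs, h) rs) H"
  using assms(2)
  by (rule through_headE) (meson assms(1) head_eval_MApp le_SucI through_headI)

lemma through_head_MCase_HNum: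
  assumes "head_eval (length us) m g (HNum j)" "through_head d us n (es j) H"
  shows "through_head d us n (MCase g es) H"
  using assms(2)
  by (rule through_headE) (meson assms(1) head_eval_MCase_HNum through_headI)

lemma through_head_MCase_HCase:
  assumes g: "head_eval (length us) m g (HCase x qs fs)" and n': "n' \<le> Suc n"
    and eval: "head_eval d n' (MCase (inst d us 0 (head_term (HCase x qs fs)))
      (\<lambda>i. inst d us 0 (es i))) H"
  shows "through_head d us n (MCase g es) H"
proof -
  obtain k H' where k: "k \<le> n'" and H': "head_eq d H H'"
    and "head_eval d k (MCase (inst d us 0 (MVar x qs))
      (\<lambda>i. MCase (inst d us 0 (fs i)) (\<lambda>i. inst d us 0 (es i)))) H'"
    using eval unfolding head_term.simps inst_simps(3) by (rule head_eval_case_of_case)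
  then have "head_eval d k (inst d us 0 (head_term (HCase x qs (\<lambda>i. MCase (fs i) es)))) H'"
    by (simp del: inst_simps(4))
  from through_headI[OF head_eval_MCase_HCase[OF g] this _ H'] show ?thesis using k n' by simp
qed

lemma through_head_MCase:
  assumes B: "head_eval d n (inst d us 0 (MCase g es)) H"
    and IH: "\<And>m B H. m < n \<Longrightarrow> head_eval d m (inst d us 0 B) H \<Longrightarrow> through_head d us m B H"
  shows "through_head d us n (MCase g es) H"
proof -
  let ?E = "\<lambda>i. inst d us 0 (es i)"
  have B: "head_eval d n (MCase (inst d us 0 g) ?E) H" using B by simp
  obtain k Hk where k: "k < n" and Hk: "head_eval d k (inst d us 0 g) Hk"
    using head_eval_MCaseD[OF B] by blast
  obtain m Hg l Hl where g: "head_eval (length us) m g Hg" and l: "l \<le> Suc k"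
    and Hl: "head_eval d l (inst d us 0 (head_term Hg)) Hl" "head_eq d Hk Hl"
    using IH[OF k Hk] by (rule through_headE)
  obtain n' H' where B': "head_eval d n' (MCase (inst d us 0 (head_term Hg)) ?E) H'"
    and H': "head_eq d H H'" and n': "n' + k = n + l"
    by (rule head_eval_MCase_cong[OF Hk Hl B])
  have "through_head d us n (MCase g es) H'"
  proof (cases Hg)
    case (HNum j)
    have "l = 0" using Hl(1) HNum by auto
    moreover obtain i where i: "n' = Suc i" "head_eval d i (inst d us 0 (es j)) H'"
      using B' HNum by (auto elim!: head_eval_MCaseE)
    ultimately have "i < n" using k n' by simp
    then have "through_head d us n (es j) H'"
      using IH[OF _ i(2)] by (auto intro: through_head_mono)
    then show ?thesis using g HNum by (auto intro: through_head_MCase_HNum)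
  next
    case (HCase x qs fs)
    have "n' \<le> Suc n" using n' l by simp
    then show ?thesis using g B' unfolding HCase by (intro through_head_MCase_HCase)
  qed
  then show ?thesis using H' by (auto intro: through_head_mono)
qed

lemma head_eval_inst_through_head:
  assumes "scoped d us"
  shows "head_eval d n (inst d us 0 B) H \<Longrightarrow> through_head d us n B H"
proof (induction n arbitrary: B H rule: less_induct)
  case (less n)
  show ?case
  proof (cases B)
    case MBot
    then show ?thesis using less.prems by auto
  next
    case (MNum j)
    then show ?thesis
      using less.prems by (auto intro!: through_headI[where Hb = "HNum j"] head_eval_MNum)
  next
    case (MVar x qs)
    then show ?thesis using less.prems by (simp only: through_head_MVar)
  next
    case (MApp p rs)
    obtain hs h where p: "p = (hs, h)" by force
    obtain m where m: "n = Suc m" "length rs = length hs"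
      "head_eval d m (beta d (map (instp d us 0) rs) (inst d us (length hs) h)) H"
      using less.prems by (auto simp: MApp p elim!: head_eval_MAppE)
    have "head_eval d m (inst d us 0 (beta (length us) rs h)) H"
      using m inst_beta[OF assms, of rs h] by simp
    then have "through_head d us m (beta (length us) rs h) H"
      by (rule less.IH[rotated]) (simp add: m(1))
    then show ?thesis unfolding MApp p m(1) by (rule through_head_MApp[OF m(2)])
  next
    case (MCase g es)
    then show ?thesis using less by (auto intro: through_head_MCase simp del: inst_simps)
  qed
qed

lemma head_eval_inst_MCase_HCase:
  assumes g: "\<And>n H. head_eval d n (inst d us 0 (head_term (HCase x qs fs))) H
      \<Longrightarrow> \<exists>n' H'. head_eval d n' (inst d us 0 g) H' \<and> head_eq d H H'"
    and eval: "head_eval d n (inst d us 0 (head_term (HCase x qs (\<lambda>i. MCase (fs i) es)))) H"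
  shows "\<exists>n' H'. head_eval d n' (inst d us 0 (MCase g es)) H' \<and> head_eq d H H'"
proof -
  let ?E = "\<lambda>i. inst d us 0 (es i)" and ?F = "\<lambda>i. inst d us 0 (fs i)"
  let ?X = "inst d us 0 (MVar x qs)"
  have "head_eval d n (MCase ?X (\<lambda>i. MCase (?F i) ?E)) H"
    using eval by (simp del: inst_simps(4))
  then obtain a H1 where H1: "head_eval d a (MCase (MCase ?X ?F) ?E) H1" "head_eq d H H1"
    by (rule head_eval_case_of_case_conv)
  obtain b Hg where Hg: "head_eval d b (MCase ?X ?F) Hg" using head_eval_MCaseD[OF H1(1)] by blast
  then have "head_eval d b (inst d us 0 (head_term (HCase x qs fs))) Hg"
    by (simp del: inst_simps(4))
  from g[OF this] obtain b' Hg'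
    where Hg': "head_eval d b' (inst d us 0 g) Hg'" "head_eq d Hg Hg'" by blast
  obtain c H2 where "head_eval d c (MCase (inst d us 0 g) ?E) H2" "head_eq d H1 H2"
    by (rule head_eval_MCase_cong[OF Hg Hg' H1(1)])
  then show ?thesis using H1(2) head_eq_trans unfolding inst_simps(3) by blast
qed

lemma head_eval_inst_conv:
  assumes "scoped d us"
  shows "head_eval (length us) m B Hb \<Longrightarrow> head_eval d n (inst d us 0 (head_term Hb)) H
    \<Longrightarrow> \<exists>n' H'. head_eval d n' (inst d us 0 B) H' \<and> head_eq d H H'"
proof (induction arbitrary: n H rule: head_eval.induct)
  case (head_eval_MNum j)
  then show ?case by (auto intro!: exI[of _ 0] head_eval.head_eval_MNum)
next
  case (head_eval_MVar x qs)
  then show ?case by (auto elim!: head_eval_MCase_MNumD simp del: inst_simps(4))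
next
  case (head_eval_MApp qs hs l h Hb)
  obtain n' H' where "head_eq d H H'" "head_eval d n' (inst d us 0 (beta (length us) qs h)) H'"
    using head_eval_MApp.IH[OF head_eval_MApp.prems] by blast
  moreover from this(2) have "head_eval d (Suc n') (inst d us 0 (MApp (hs, h) qs)) H'"
    using head_eval_MApp.hyps inst_beta[OF assms, of qs h]
    by (auto intro!: head_eval.head_eval_MApp)
  ultimately show ?case by blast
next
  case (head_eval_MCase_HNum l g j k es Hb)
  obtain a where "head_eval d a (inst d us 0 g) (HNum j)"
    using head_eval_MCase_HNum.IH(1)[of 0 "HNum j"] by (auto intro: head_eval_MNum)
  moreover obtain b H' where "head_eval d b (inst d us 0 (es j)) H'" "head_eq d H H'"
    using head_eval_MCase_HNum.IH(2)[OF head_eval_MCase_HNum.prems] by blast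
  ultimately show ?case unfolding inst_simps(3) by (blast intro: head_eval.head_eval_MCase_HNum)
next
  case (head_eval_MCase_HCase l g x qs fs es)
  show ?case
    using head_eval_MCase_HCase.IH head_eval_MCase_HCase.prems
    by (rule head_eval_inst_MCase_HCase)
qed

section \<open>Compositionality of evaluation\<close>

definition rel_proc :: "(nat \<Rightarrow> mexp \<Rightarrow> mexp \<Rightarrow> bool) \<Rightarrow> nat \<Rightarrow> mproc \<Rightarrow> mproc \<Rightarrow> bool" where
  "rel_proc R d p p' \<longleftrightarrow> fst p = fst p' \<and> R (d + length (fst p)) (snd p) (snd p')"

definition rel_entry :: "(nat \<Rightarrow> mexp \<Rightarrow> mexp \<Rightarrow> bool) \<Rightarrow> nat \<Rightarrow> entry \<Rightarrow> entry \<Rightarrow> bool" where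
  "rel_entry R d = rel_sum (=) (rel_proc R d)"

lemma rel_entry_simps [simp]:
  "rel_entry R d (Inl y) (Inl y') \<longleftrightarrow> y = y'"
  "rel_entry R d (Inr p) (Inr p') \<longleftrightarrow> rel_proc R d p p'"
  "\<not> rel_entry R d (Inl y) (Inr p)"
  "\<not> rel_entry R d (Inr p) (Inl y)"
  by (simp_all add: rel_entry_def)

lemma rel_entry_InlD: "rel_entry R d (Inl y) u \<Longrightarrow> u = Inl y"
  by (cases u) auto

lemma rel_entry_InrE:
  assumes "rel_entry R d (Inr p) u"
  obtains p' where "u = Inr p'" "rel_proc R d p p'"
  using assms by (cases u) auto

lemma rel_entry_mono:
  "(\<And>d T T'. R d T T' \<Longrightarrow> R' d T T') \<Longrightarrow> rel_entry R d u v \<Longrightarrow> rel_entry R' d u v"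
  unfolding rel_entry_def by (erule sum.rel_mono_strong) (auto simp: rel_proc_def)

lemma list_rel_entry_mono [mono]:
  "(\<And>d T T'. R d T T' \<longrightarrow> R' d T T')
   \<Longrightarrow> list_all2 (rel_entry R d) us vs \<longrightarrow> list_all2 (rel_entry R' d) us vs"
  by (auto elim!: list_all2_mono intro: rel_entry_mono)

lemma list_rel_entry_converse:
  "list_all2 (rel_entry (\<lambda>d T T'. R d T' T) d) us us' \<longleftrightarrow> list_all2 (rel_entry R d) us' us"
proof -
  have "rel_entry (\<lambda>d T T'. R d T' T) d u u' \<longleftrightarrow> rel_entry R d u' u" for u u'
    by (cases u; cases u') (auto simp: rel_proc_def)
  then show ?thesis by (auto simp: list_all2_conv_all_nth)
qed

lemma rel_entry_lookup:
  assumes "list_all2 (rel_entry R d) us us'"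
  shows "rel_entry R d (lookup d us x) (lookup d us' x)"
  using assms list_all2_nthD[OF assms] list_all2_lengthD[OF assms] by (simp add: lookup_def)

lemma list_rel_entry_inst:
  assumes "list_all2 (rel_entry R d) vs vs'" "list_all2 (rel_entry Q (length vs)) us us'"
    and R: "\<And>d T T'. R d T T' \<Longrightarrow> R' d T T'"
    and Q: "\<And>n T T'. Q (length vs + n) T T' \<Longrightarrow> R' (d + n) (inst d vs n T) (inst d vs' n T')"
  shows "list_all2 (rel_entry R' d) (map (inst_entry d vs) us) (map (inst_entry d vs') us')"
proof -
  have "rel_entry R' d (inst_entry d vs u) (inst_entry d vs' u')"
    if rel: "rel_entry Q (length vs) u u'" for u u'
  proof (cases u)
    case (Inl y)
    then have "u' = Inl y" using rel rel_entry_InlD by simp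
    then show ?thesis using Inl rel_entry_mono[OF R rel_entry_lookup[OF assms(1)]] by simp
  next
    case (Inr p)
    obtain p' where "u' = Inr p'" "rel_proc Q (length vs) p p'"
      using rel unfolding Inr by (rule rel_entry_InrE)
    then show ?thesis using Inr Q by (auto simp: rel_proc_def)
  qed
  then show ?thesis using assms(2) by (auto simp: list_all2_conv_all_nth)
qed

lemma list_rel_entry_lift_sub:
  assumes "list_all2 (rel_entry R d) us us'"
    and "\<And>m T T'. R (d + m) T T' \<Longrightarrow> R' (d + n + m) (mshift d n T) (mshift d n T')"
  shows "list_all2 (rel_entry R' (d + n)) (lift_sub d n us) (lift_sub d n us')"
proof -
  have "rel_entry R' (d + n) (map_sum id (mshiftp d n) u) (map_sum id (mshiftp d n) u')"
    if "rel_entry R d u u'" for u u'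
    using that assms(2) by (cases u; cases u') (auto simp: rel_proc_def mshiftp_map_body)
  then show ?thesis unfolding lift_sub_def using assms(1)
    by (intro list_all2_appendI) (auto simp: list_all2_conv_all_nth)
qed

inductive head_expansion :: "nat \<Rightarrow> mexp \<Rightarrow> mexp \<Rightarrow> bool" for d where
  head_expansion_refl: "head_expansion d T T"
| head_expansion_beta:
    "length qs = length hs
     \<Longrightarrow> head_expansion d (MCase (MApp (hs, h) qs) MNum) (beta d qs h)"

text \<open>The closure of \<open>nf\<close>-equality under substitution is taken coinductively, so that two procedures
  which unfold recursively into related bodies are related. The optional head redex in
  \<open>head_expansion\<close> is sound because each use of \<open>sim_sub\<close> can only skip one of them.\<close>
coinductive sim :: "nat \<Rightarrow> mexp \<Rightarrow> mexp \<Rightarrow> bool" where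
  sim_sub: "head_expansion d T (inst d us 0 B) \<Longrightarrow> head_expansion d T' (inst d us' 0 B')
    \<Longrightarrow> nf (length us) B = nf (length us) B' \<Longrightarrow> scoped d us \<Longrightarrow> scoped d us'
    \<Longrightarrow> list_all2 (rel_entry sim d) us us' \<Longrightarrow> sim d T T'"
| sim_case: "sim d g g' \<Longrightarrow> (\<And>i. sim d (es i) (es' i)) \<Longrightarrow> sim d (MCase g es) (MCase g' es')"

inductive sim_layer :: "(nat \<Rightarrow> mexp \<Rightarrow> mexp \<Rightarrow> bool) \<Rightarrow> nat \<Rightarrow> mexp \<Rightarrow> mexp \<Rightarrow> bool" for R where
  sim_layer_sub: "head_expansion d T (inst d us 0 B) \<Longrightarrow> head_expansion d T' (inst d us' 0 B')
    \<Longrightarrow> nf (length us) B = nf (length us) B' \<Longrightarrow> scoped d us \<Longrightarrow> scoped d us'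
    \<Longrightarrow> list_all2 (rel_entry R d) us us' \<Longrightarrow> sim_layer R d T T'"
| sim_layer_case:
    "R d g g' \<Longrightarrow> (\<And>i. R d (es i) (es' i)) \<Longrightarrow> sim_layer R d (MCase g es) (MCase g' es')"

lemma sim_coinduct_layer:
  assumes "X d T T'"
    and step: "\<And>d T T'. X d T T' \<Longrightarrow> sim_layer (\<lambda>d T T'. X d T T' \<or> sim d T T') d T T'"
  shows "sim d T T'"
  using assms(1) by (rule sim.coinduct) (drule step, simp only: sim_layer.simps)

lemma sim_imp_sim_layer: "sim d T T' \<Longrightarrow> sim_layer sim d T T'"
  by (subst (asm) sim.simps) (simp only: sim_layer.simps)

lemma sim_sym: "sim d T T' \<Longrightarrow> sim d T' T"
proof (rule sim_coinduct_layer[where X = "\<lambda>d T T'. sim d T' T"])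
  fix d T T' assume "sim d T' T"
  then have "sim_layer sim d T' T" by (rule sim_imp_sim_layer)
  then show "sim_layer (\<lambda>d T T'. sim d T' T \<or> sim d T T') d T T'"
  proof cases
    case (sim_layer_sub us B us' B')
    have "list_all2 (rel_entry (\<lambda>d T T'. sim d T' T) d) us' us"
      using sim_layer_sub(6) by (rule list_rel_entry_converse[THEN iffD2])
    then have "list_all2 (rel_entry (\<lambda>d T T'. sim d T' T \<or> sim d T T') d) us' us"
      by (rule list_all2_mono) (erule rel_entry_mono[rotated], blast)
    moreover have "length us' = length us" using list_all2_lengthD[OF sim_layer_sub(6)] by simp
    ultimately show ?thesis
      by (intro sim_layer.sim_layer_sub[OF sim_layer_sub(2,1) _ sim_layer_sub(5,4)])
        (simp_all add: sim_layer_sub(3))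
  next
    case (sim_layer_case g g' es es')
    then show ?thesis by (auto intro: sim_layer.sim_layer_case)
  qed
qed

lemma head_expansion_inst:
  assumes "scoped d us" "head_expansion (length us) T U"
  shows "head_expansion d (inst d us 0 T) (inst d us 0 U)"
  using assms(2)
proof cases
  case head_expansion_refl
  then show ?thesis by (simp add: head_expansion.head_expansion_refl)
next
  case (head_expansion_beta qs hs h)
  then show ?thesis
    using head_expansion.head_expansion_beta[of "map (instp d us 0) qs" hs d]
    by (simp add: inst_beta[OF assms(1)])
qed

lemma sim_layer_inst:
  assumes scoped: "scoped d vs" "scoped d vs'" and entries: "list_all2 (rel_entry sim d) vs vs'"
    and T: "sim (length vs) T T'"
    and R: "\<And>n T T'. sim (length vs + n) T T' \<Longrightarrow> R (d + n) (inst d vs n T) (inst d vs' n T')"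
  shows "sim_layer (\<lambda>d T T'. R d T T' \<or> sim d T T') d (inst d vs 0 T) (inst d vs' 0 T')"
proof -
  let ?R = "\<lambda>d T T'. R d T T' \<or> sim d T T'"
  have len: "length vs' = length vs" using entries list_all2_lengthD by force
  from T have "sim_layer sim (length vs) T T'" by (rule sim_imp_sim_layer)
  then show ?thesis
  proof cases
    case (sim_layer_sub us B us' B')
    show ?thesis
    proof (rule sim_layer.sim_layer_sub)
      show "head_expansion d (inst d vs 0 T) (inst d (map (inst_entry d vs) us) 0 B)"
        using head_expansion_inst[OF scoped(1) sim_layer_sub(1)] inst_inst[OF scoped(1)] by simp
      show "head_expansion d (inst d vs' 0 T') (inst d (map (inst_entry d vs') us') 0 B')"
        using head_expansion_inst[OF scoped(2), unfolded len, OF sim_layer_sub(2)]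
          inst_inst[OF scoped(2), unfolded len] by simp
      show "list_all2 (rel_entry ?R d) (map (inst_entry d vs) us) (map (inst_entry d vs') us')"
        using R by (intro list_rel_entry_inst[OF entries sim_layer_sub(6)]) auto
      show "scoped d (map (inst_entry d vs) us)" "scoped d (map (inst_entry d vs') us')"
        using scoped_map_inst_entry scoped sim_layer_sub len by auto
    qed (use sim_layer_sub(3) in simp)
  next
    case (sim_layer_case g g' es es')
    have "R d (inst d vs 0 U) (inst d vs' 0 U')" if "sim (length vs) U U'" for U U'
      using R[of 0] that by simp
    then show ?thesis
      unfolding sim_layer_case(1,2) inst_simps
      using sim_layer_case(3,4) by (intro sim_layer.sim_layer_case) blast+
  qed
qed

text \<open>Instances under a lifted substitution need \<open>sim\<close> to be stable under renaming, itself a case of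
  this lemma; hence the abstract family \<open>V\<close>, closed under lifting, of substitutions.\<close>
lemma sim_inst_family:
  fixes V :: "nat \<Rightarrow> entry list \<Rightarrow> entry list \<Rightarrow> bool"
  assumes V: "\<And>d vs vs'. V d vs vs' \<Longrightarrow>
      scoped d vs \<and> scoped d vs' \<and> list_all2 (rel_entry sim d) vs vs'"
    and V_lift: "\<And>d n vs vs'. V d vs vs' \<Longrightarrow> V (d + n) (lift_sub d n vs) (lift_sub d n vs')"
    and "V d vs vs'" "sim (length vs) T T'"
  shows "sim d (inst d vs 0 T) (inst d vs' 0 T')"
proof -
  let ?X = "\<lambda>d U U'. \<exists>vs vs' T T'. U = inst d vs 0 T \<and> U' = inst d vs' 0 T' \<and> V d vs vs' \<and>
    sim (length vs) T T'"
  show ?thesis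
  proof (rule sim_coinduct_layer[where X = ?X])
    fix d U U' assume "?X d U U'"
    then obtain vs vs' T T' where U: "U = inst d vs 0 T" "U' = inst d vs' 0 T'"
      and vs: "V d vs vs'" and T: "sim (length vs) T T'" by blast
    have "?X (d + n) (inst d vs n T) (inst d vs' n T')" if "sim (length vs + n) T T'" for n T T'
      using that V_lift[OF vs, of n] unfolding inst_eq_inst_lift_sub[of d _ n]
      by (intro exI[of _ "lift_sub d n vs"] exI[of _ "lift_sub d n vs'"] exI[of _ T] exI[of _ T'])
        simp
    then show "sim_layer (\<lambda>d U U'. ?X d U U' \<or> sim d U U') d U U'"
      unfolding U using V[OF vs] T by (intro sim_layer_inst[where R = ?X]) auto
  qed (use assms(3,4) in blast)
qed

lemma sim_mshift:
  assumes "sim (d + m) T T'"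
  shows "sim (d + n + m) (mshift d n T) (mshift d n T')"
proof -
  let ?V = "\<lambda>(d::nat) vs vs'. vs = vs' \<and>
    (\<exists>ys. (vs :: entry list) = map Inl ys \<and> (\<forall>y\<in>set ys. y < d))"
  let ?us = "lift_sub (d + n) m (id_sub d)"
  have "sim (d + n + m) (inst (d + n + m) ?us 0 T) (inst (d + n + m) ?us 0 T')"
  proof (rule sim_inst_family[where V = ?V])
    fix d vs vs' assume "?V d vs vs'"
    then show "scoped d vs \<and> scoped d vs' \<and> list_all2 (rel_entry sim d) vs vs'"
      by (auto simp: list_all2_conv_all_nth)
  next
    fix d n vs vs' assume "?V d vs vs'"
    then obtain ys where ys: "vs = map Inl ys" "vs' = map Inl ys" "\<forall>y\<in>set ys. y < d" by blast
    have "lift_sub d n vs = map Inl (ys @ [d..<d+n])" by (simp add: lift_sub_def ys)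
    then show "?V (d + n) (lift_sub d n vs) (lift_sub d n vs')" using ys
      by (intro conjI exI[of _ "ys @ [d..<d+n]"]) auto
  next
    show "?V (d + n + m) ?us ?us"
      by (intro conjI refl exI[of _ "[0..<d] @ [d + n..<d + n + m]"]) (auto simp: lift_sub_def)
  qed (use assms in \<open>simp add: lift_sub_def\<close>)
  then show ?thesis
    by (simp add: inst_eq_inst_lift_sub[symmetric] inst_id_sub_mshift)
qed

lemma list_sim_lift_sub:
  "list_all2 (rel_entry sim d) us us'
   \<Longrightarrow> list_all2 (rel_entry sim (d + n)) (lift_sub d n us) (lift_sub d n us')"
  by (erule list_rel_entry_lift_sub) (rule sim_mshift)

lemma sim_inst:
  assumes "scoped d vs" "scoped d vs'" "list_all2 (rel_entry sim d) vs vs'"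
    "sim (length vs + n) T T'"
  shows "sim (d + n) (inst d vs n T) (inst d vs' n T')"
  unfolding inst_eq_inst_lift_sub[of d _ n]
proof (rule sim_inst_family[where V = "\<lambda>d vs vs'. scoped d vs \<and> scoped d vs' \<and>
      list_all2 (rel_entry sim d) vs vs'"])
  fix d n vs vs'
  assume "scoped d vs \<and> scoped d vs' \<and> list_all2 (rel_entry sim d) vs vs'"
  then show "scoped (d + n) (lift_sub d n vs) \<and> scoped (d + n) (lift_sub d n vs') \<and>
      list_all2 (rel_entry sim (d + n)) (lift_sub d n vs) (lift_sub d n vs')"
    using scoped_lift_sub list_sim_lift_sub by blast
qed (use assms in \<open>auto intro: scoped_lift_sub list_sim_lift_sub\<close>)

lemma sim_inst_if_nf_eq:
  assumes "nf (length us) B = nf (length us) B'" "scoped d us" "scoped d us'"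
    "list_all2 (rel_entry sim d) us us'"
  shows "sim d (inst d us 0 B) (inst d us' 0 B')"
  by (rule sim_sub[OF head_expansion_refl head_expansion_refl assms])

lemma sim_if_nf_eq: "nf d T = nf d T' \<Longrightarrow> sim d T T'"
  using sim_inst_if_nf_eq[of "id_sub d" T T' d "id_sub d"] by (simp add: list_all2_conv_all_nth)

definition sim_upto_nf :: "nat \<Rightarrow> mexp \<Rightarrow> mexp \<Rightarrow> bool" where
  "sim_upto_nf d T T' \<longleftrightarrow> (\<exists>U U'. nf d T = nf d U \<and> sim d U U' \<and> nf d U' = nf d T')"

lemma sim_upto_nf_if_sim: "sim d T T' \<Longrightarrow> sim_upto_nf d T T'"
  by (auto simp: sim_upto_nf_def)

lemma sim_upto_nf_MCase:
  assumes "sim_upto_nf d g g'" "\<And>i. sim d (es i) (es' i)"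
  shows "sim_upto_nf d (MCase g es) (MCase g' es')"
proof -
  obtain U U' where U: "nf d g = nf d U" "sim d U U'" "nf d U' = nf d g'"
    using assms(1) by (auto simp: sim_upto_nf_def)
  then have "sim d (MCase U es) (MCase U' es')" using assms(2) by (intro sim_case)
  then show ?thesis using U unfolding sim_upto_nf_def
    by (intro exI[of _ "MCase U es"] exI[of _ "MCase U' es'"]) (simp add: nf_MCase)
qed

inductive head_sim :: "nat \<Rightarrow> head \<Rightarrow> head \<Rightarrow> bool" for d where
  head_sim_HNum: "head_sim d (HNum j) (HNum j)"
| head_sim_HCase:
    "list_all2 (rel_proc sim d) qs qs' \<Longrightarrow> (\<And>i. sim_upto_nf d (fs i) (fs' i))
     \<Longrightarrow> head_sim d (HCase x qs fs) (HCase x qs' fs')"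

inductive_simps head_sim_simps [simp]:
  "head_sim d (HNum j) H"
  "head_sim d (HCase x qs fs) H"

lemma head_sim_head_eq:
  "head_sim d H H' \<Longrightarrow> head_eq d H U \<Longrightarrow> head_eq d H' U' \<Longrightarrow> head_sim d U U'"
  by (cases H; cases U) (auto simp: sim_upto_nf_def)

definition simulates :: "nat \<Rightarrow> mexp \<Rightarrow> head \<Rightarrow> bool" where
  "simulates d T H \<longleftrightarrow> (\<exists>n H'. head_eval d n T H' \<and> head_sim d H H')"

lemma simulates_head_eq:
  assumes "simulates d T H" "head_eq d H H'"
    and "\<And>n U. head_eval d n T U \<Longrightarrow> \<exists>n' U'. head_eval d n' T' U' \<and> head_eq d U U'"
  shows "simulates d T' H'"
  using assms head_sim_head_eq unfolding simulates_def by blast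

lemma simulates_MCase:
  assumes eval: "head_eval d n (MCase g es) H"
    and g: "\<And>m Hg. m < n \<Longrightarrow> head_eval d m g Hg \<Longrightarrow> simulates d g' Hg"
    and es_num: "\<And>k l j. n = Suc (k + l) \<Longrightarrow> head_eval d k g (HNum j) \<Longrightarrow> head_eval d l (es j) H
      \<Longrightarrow> simulates d (es' j) H"
    and es: "\<And>i. sim d (es i) (es' i)"
  shows "simulates d (MCase g' es') H"
  using eval
proof (rule head_eval_MCaseE)
  fix k j l
  assume n: "n = Suc (k + l)" and gj: "head_eval d k g (HNum j)" and ej: "head_eval d l (es j) H"
  obtain k' where "head_eval d k' g' (HNum j)"
    using g[OF _ gj] n by (auto simp: simulates_def)
  moreover obtain l' H' where "head_eval d l' (es' j) H'" "head_sim d H H'"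
    using es_num[OF n gj ej] by (auto simp: simulates_def)
  ultimately show ?thesis unfolding simulates_def by (blast intro: head_eval_MCase_HNum)
next
  fix k x qs fs
  assume n: "n = Suc k" and gx: "head_eval d k g (HCase x qs fs)"
    and H: "H = HCase x qs (\<lambda>i. MCase (fs i) es)"
  obtain k' qs' fs' where "head_eval d k' g' (HCase x qs' fs')"
    and sim: "list_all2 (rel_proc sim d) qs qs'" "\<And>i. sim_upto_nf d (fs i) (fs' i)"
    using g[OF _ gx] n by (auto simp: simulates_def)
  then have "head_eval d (Suc k') (MCase g' es') (HCase x qs' (\<lambda>i. MCase (fs' i) es'))"
    by (intro head_eval_MCase_HCase)
  moreover have "head_sim d H (HCase x qs' (\<lambda>i. MCase (fs' i) es'))"
    unfolding H using sim es by (auto intro: sim_upto_nf_MCase)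
  ultimately show ?thesis unfolding simulates_def by blast
qed

lemma nf_head_term: "head_eval D m B H \<Longrightarrow> nf D (head_term H) = nf D B"
  by (cases H) (auto simp: nf_HNum nf_HCase nf_MCase)

lemma nf_eq_imp_head_eval:
  assumes "nf D B = nf D B'" "head_eval D m B H"
  obtains m' H' where "head_eval D m' B' H'" "nf D (head_term H) = nf D (head_term H')"
proof (cases D B' rule: nf_cases)
  case no_head
  then show thesis using assms nf_head_term[OF assms(2)] by (cases H) (auto simp: nf_MCase)
next
  case (HNum n m)
  then show thesis using that assms nf_head_term by metis
next
  case (HCase n x qs fs)
  then show thesis using that assms nf_head_term by metis
qed

context
  fixes d :: nat and us us' :: "entry list"
  assumes scoped: "scoped d us" "scoped d us'"
    and entries: "list_all2 (rel_entry sim d) us us'"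
begin

lemma rel_instp_if_nfp_eq:
  assumes nfp_eq: "map (nfp (length us)) qs = map (nfp (length us)) qs'"
  shows "list_all2 (rel_proc sim d) (map (instp d us 0) qs) (map (instp d us' 0) qs')"
proof -
  have "rel_proc sim d (instp d us 0 q) (instp d us' 0 q')"
    if q: "nfp (length us) q = nfp (length us) q'" for q q'
  proof -
    have fst: "fst q = fst q'" using q by (metis map_body_simps(2))
    have "sim (length us + length (fst q)) (snd q) (snd q')"
      by (rule sim_if_nf_eq) (use q fst in \<open>simp add: map_body_def\<close>)
    from sim_inst[OF scoped entries this] show ?thesis by (simp add: rel_proc_def fst)
  qed
  moreover have "list_all2 (\<lambda>q q'. nfp (length us) q = nfp (length us) q') qs qs'"
    using nfp_eq by (simp add: list_eq_iff_nth_eq list_all2_conv_all_nth)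
  ultimately show ?thesis by (auto simp: list.rel_map elim: list_all2_mono)
qed

lemma simulates_inst_MVar:
  assumes qs: "map (nfp (length us)) qs = map (nfp (length us)) qs'"
    and IH: "\<And>m T T' H. Suc m = n \<Longrightarrow> sim d T T' \<Longrightarrow> head_eval d m T H \<Longrightarrow> simulates d T' H"
    and eval: "head_eval d n (inst d us 0 (MVar x qs)) H"
  shows "simulates d (inst d us' 0 (MVar x qs')) H"
proof (cases "lookup d us x")
  case (Inl y)
  then have "lookup d us' x = Inl y" using rel_entry_lookup[OF entries, of x] rel_entry_InlD by simp
  then have "head_eval d 0 (inst d us' 0 (MVar x qs')) (HCase y (map (instp d us' 0) qs') MNum)"
    by (simp add: head_eval_MVar)
  moreover have "H = HCase y (map (instp d us 0) qs) MNum" using eval Inl by auto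
  moreover have "head_sim d \<dots> (HCase y (map (instp d us' 0) qs') MNum)"
    by (intro head_sim_HCase rel_instp_if_nfp_eq[OF qs] sim_upto_nf_if_sim sim_if_nf_eq refl)
  ultimately show ?thesis unfolding simulates_def by blast
next
  case (Inr p)
  then obtain p' where p': "lookup d us' x = Inr p'" "rel_proc sim d p p'"
    using rel_entry_lookup[OF entries, of x] by (auto elim: rel_entry_InrE)
  obtain bs C C' where C: "p = (bs, C)" "p' = (bs, C')" "sim (d + length bs) C C'"
    using p'(2) by (cases p; cases p') (auto simp: rel_proc_def)
  let ?qs = "map (instp d us 0) qs" and ?qs' = "map (instp d us' 0) qs'"
  obtain m where m: "n = Suc m" "length qs = length bs" "head_eval d m (beta d ?qs C) H"
    using eval Inr unfolding C by (auto elim!: head_eval_MAppE)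
  have "list_all2 (rel_entry sim d) (id_sub d @ map Inr ?qs) (id_sub d @ map Inr ?qs')"
    using rel_instp_if_nfp_eq[OF qs]
    by (intro list_all2_appendI) (auto simp: list_all2_conv_all_nth)
  from sim_inst[OF _ _ this, of 0 C C'] have "sim d (beta d ?qs C) (beta d ?qs' C')"
    using C(3) m(2) by auto
  from IH[OF m(1)[symmetric] this m(3)]
  obtain m' H' where "head_eval d m' (beta d ?qs' C') H'" "head_sim d H H'"
    by (auto simp: simulates_def)
  moreover have "length qs' = length bs" using m(2) map_eq_imp_length_eq[OF qs] by simp
  ultimately have "head_eval d (Suc m') (inst d us' 0 (MVar x qs')) H'"
    using p'(1) C(2) by (auto intro: head_eval_MApp)
  then show ?thesis using \<open>head_sim d H H'\<close> by (auto simp: simulates_def)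
qed

lemma simulates_inst_head_term:
  assumes nf_eq: "nf (length us) (head_term Hb) = nf (length us) (head_term Hb')"
    and IH: "\<And>m T T' H. m < n \<Longrightarrow> sim d T T' \<Longrightarrow> head_eval d m T H \<Longrightarrow> simulates d T' H"
    and eval: "head_eval d k (inst d us 0 (head_term Hb)) H" and "k \<le> Suc n"
  shows "simulates d (inst d us' 0 (head_term Hb')) H"
proof (cases Hb)
  case (HNum j)
  then have "Hb' = HNum j" using nf_eq by (cases Hb') (auto simp: nf_MCase)
  then show ?thesis
    using eval HNum by (auto simp: simulates_def intro!: exI[of _ 0] head_eval_MNum)
next
  case (HCase x qs fs)
  then obtain qs' fs' where Hb': "Hb' = HCase x qs' fs'"
    and qs: "map (nfp (length us)) qs = map (nfp (length us)) qs'"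
    and fs: "\<And>i. nf (length us) (fs i) = nf (length us) (fs' i)"
    using nf_eq by (cases Hb') (auto simp: nf_MCase fun_eq_iff)
  have sim_fs: "sim d (inst d us 0 (fs i)) (inst d us' 0 (fs' i))" for i
    using fs scoped entries by (rule sim_inst_if_nf_eq)
  show ?thesis
    unfolding Hb' head_term.simps inst_simps(3)
  proof (rule simulates_MCase[OF _ _ _ sim_fs])
    show "head_eval d k (MCase (inst d us 0 (MVar x qs)) (\<lambda>i. inst d us 0 (fs i))) H"
      using eval HCase by simp
  next
    fix m Hg assume "m < k" and x: "head_eval d m (inst d us 0 (MVar x qs)) Hg"
    then have "l < n" if "Suc l = m" for l using that assms(4) by simp
    with IH have "simulates d T' H" if "Suc l = m" "sim d T T'" "head_eval d l T H" for l T T' H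
      using that by blast
    then show "simulates d (inst d us' 0 (MVar x qs')) Hg"
      using x by (rule simulates_inst_MVar[OF qs])
  next
    fix a b j
    assume "k = Suc (a + b)" and x: "head_eval d a (inst d us 0 (MVar x qs)) (HNum j)"
      and fj: "head_eval d b (inst d us 0 (fs j)) H"
    moreover have "a \<noteq> 0" using x by (cases "lookup d us x") (auto elim: head_eval_MAppE)
    ultimately have "b < n" using assms(4) by simp
    from IH[OF this sim_fs fj] show "simulates d (inst d us' 0 (fs' j)) H" .
  qed
qed

end

lemma head_eval_head_expansion:
  assumes "head_expansion d T U" "head_eval d n T H"
  shows "\<exists>m\<le>n. \<exists>H'. head_eval d m U H' \<and> head_eq d H' H"
  using assms(1)
proof cases
  case (head_expansion_beta qs hs h)
  obtain n' H' where n': "n = Suc n'" "head_eval d n' (MApp (hs, h) qs) H'" "head_eq d H H'"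
    using assms(2) unfolding head_expansion_beta by (rule head_eval_MCase_MNumD)
  from n'(2) obtain m where "n' = Suc m" "head_eval d m U H'"
    by (rule head_eval_MAppE) (simp add: head_expansion_beta)
  then show ?thesis using n' by (intro exI[of _ m]) (auto intro: head_eq_sym)
qed (use assms(2) head_eq_refl in blast)

lemma head_eval_head_expansion_conv:
  assumes "head_expansion d T U" "head_eval d n U H"
  shows "\<exists>m H'. head_eval d m T H' \<and> head_eq d H H'"
  using assms(1)
proof cases
  case (head_expansion_beta qs hs h)
  have "head_eval d (Suc n) (MApp (hs, h) qs) H"
    using assms(2) head_expansion_beta by (simp add: head_eval_MApp)
  then show ?thesis unfolding head_expansion_beta by (rule head_eval_MCase_MNumI) blast
qed (use assms(2) head_eq_refl in blast)

lemma sim_simulates: "sim d T T' \<Longrightarrow> head_eval d n T H \<Longrightarrow> simulates d T' H"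
proof (induction n arbitrary: T T' H rule: less_induct)
  case (less n)
  from less.prems(1) have "sim_layer sim d T T'" by (rule sim_imp_sim_layer)
  then show ?case
  proof cases
    case (sim_layer_sub us B us' B')
    have len: "length us' = length us" using list_all2_lengthD[OF sim_layer_sub(6)] by simp
    obtain n0 H0 where n0: "n0 \<le> n" "head_eval d n0 (inst d us 0 B) H0" "head_eq d H0 H"
      using head_eval_head_expansion[OF sim_layer_sub(1) less.prems(2)] by blast
    obtain m Hb k H1 where Hb: "head_eval (length us) m B Hb" and k: "k \<le> Suc n0"
      and H1: "head_eval d k (inst d us 0 (head_term Hb)) H1" "head_eq d H0 H1"
      using head_eval_inst_through_head[OF sim_layer_sub(4) n0(2)] by (rule through_headE)
    obtain m' Hb' where Hb': "head_eval (length us') m' B' Hb'"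
      and nf_eq: "nf (length us) (head_term Hb) = nf (length us) (head_term Hb')"
      using nf_eq_imp_head_eval[OF sim_layer_sub(3) Hb] len by metis
    have IH: "simulates d U' K" if "l < n0" "sim d U U'" "head_eval d l U K" for l U U' K
      using less.IH[of l U U' K] that n0(1) by simp
    have "simulates d (inst d us' 0 (head_term Hb')) H1"
      by (rule simulates_inst_head_term[OF sim_layer_sub(4-6) nf_eq IH H1(1) k])
    moreover have "head_eq d H1 H" using n0(3) H1(2) head_eq_sym head_eq_trans by blast
    ultimately have "simulates d (inst d us' 0 B') H"
      using head_eval_inst_conv[OF sim_layer_sub(5) Hb'] by (rule simulates_head_eq)
    then show ?thesis
      using head_eq_refl head_eval_head_expansion_conv[OF sim_layer_sub(2)]
      by (rule simulates_head_eq)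
  next
    case (sim_layer_case g g' es es')
    show ?thesis
      using less.prems(2) unfolding sim_layer_case(1,2)
    proof (rule simulates_MCase[OF _ _ _ sim_layer_case(4)])
      show "simulates d g' Hg" if "m < n" "head_eval d m g Hg" for m Hg
        using that(1) sim_layer_case(3) that(2) by (rule less.IH)
      show "simulates d (es' j) H"
        if n: "n = Suc (k + l)" and j: "head_eval d l (es j) H" for k l j
        by (rule less.IH[OF _ sim_layer_case(4) j]) (simp add: n)
    qed
  qed
qed

theorem sim_imp_nf_eq: "sim d T T' \<Longrightarrow> nf d T = nf d T'"
proof (rule nexp_coinduct_layer[where R = "\<lambda>a b. \<exists>d T T'. a = nf d T \<and> b = nf d T' \<and> sim d T T'"])
  let ?R = "\<lambda>a b. (\<exists>d T T'. a = nf d T \<and> b = nf d T' \<and> sim d T T') \<or> a = b"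
  fix a b assume "\<exists>d T T'. a = nf d T \<and> b = nf d T' \<and> sim d T T'"
  then obtain d T T' where ab: "a = nf d T" "b = nf d T'" and sim: "sim d T T'" by blast
  show "nexp_layer ?R a b"
  proof (cases d T rule: nf_cases)
    case no_head
    then have "\<not> head_eval d n T' H" for n H
      using sim_simulates[OF sim_sym[OF sim]] by (auto simp: simulates_def)
    then show ?thesis using no_head(2) nf_no_head by (simp add: ab nexp_layer.intros)
  next
    case (HNum n m)
    then obtain n' where "head_eval d n' T' (HNum m)"
      using sim_simulates[OF sim] by (fastforce simp: simulates_def)
    then show ?thesis using HNum(2) nf_HNum by (simp add: ab nexp_layer.intros)
  next
    case (HCase n x qs fs)
    then obtain n' qs' fs' where T': "head_eval d n' T' (HCase x qs' fs')"
      and qs: "list_all2 (rel_proc sim d) qs qs'" and fs: "\<And>i. sim_upto_nf d (fs i) (fs' i)"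
      using sim_simulates[OF sim HCase(1)] by (auto simp: simulates_def)
    have "list_all2 (rel_body ?R) (map (nfp d) qs) (map (nfp d) qs')"
      unfolding list.rel_map using qs
      by (rule list_all2_mono) (auto simp: rel_proc_def, blast)
    moreover have "?R (nf d (fs i)) (nf d (fs' i))" for i
    proof -
      obtain U U' where "nf d (fs i) = nf d U" "nf d (fs' i) = nf d U'" "sim d U U'"
        using fs[of i] by (metis sim_upto_nf_def)
      then show ?thesis by (intro disjI1 exI[of _ d] exI[of _ U] exI[of _ U']) simp
    qed
    ultimately show ?thesis unfolding ab HCase(2) nf_HCase[OF T'] by (rule nexp_layer.intros)
  qed
qed blast

abbreviation nf_eq_entry :: "nat \<Rightarrow> entry \<Rightarrow> entry \<Rightarrow> bool" where
  "nf_eq_entry \<equiv> rel_entry (\<lambda>d T T'. nf d T = nf d T')"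

lemma nf_eq_entry_refl [simp]: "nf_eq_entry d u u"
  by (cases u) (auto simp: rel_proc_def)

lemma list_nf_eq_entry_refl [simp]: "list_all2 (nf_eq_entry d) us us"
  by (simp add: list_all2_conv_all_nth)

theorem nf_inst_cong:
  assumes "nf (length us + n) B = nf (length us + n) B'" "scoped d us" "scoped d us'"
    "list_all2 (nf_eq_entry d) us us'"
  shows "nf (d + n) (inst d us n B) = nf (d + n) (inst d us' n B')"
proof (rule sim_imp_nf_eq, rule sim_inst)
  show "list_all2 (rel_entry sim d) us us'"
    using assms(4) by (rule list_all2_mono) (erule rel_entry_mono[rotated], erule sim_if_nf_eq)
qed (use assms sim_if_nf_eq in auto)

lemma nf_inst_emb_nf:
  assumes "scoped d us" "D = length us + n"
  shows "nf (d + n) (inst d us n (emb (nf D T))) = nf (d + n) (inst d us n T)"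
  by (rule nf_inst_cong) (use assms in auto)

lemma nf_mshift: "nf (d + k + n) (mshift d k T) = nshift d k (nf (d + n) T)"
proof -
  have "nf (d + k + n) (mshift d k T) = nf (d + k + n) (inst (d + k) (id_sub d) n T)"
    by (simp add: inst_id_sub_mshift)
  also have "\<dots> = nf (d + k + n) (inst (d + k) (id_sub d) n (emb (nf (d + n) T)))"
    by (rule nf_inst_emb_nf[symmetric]) auto
  also have "\<dots> = nshift d k (nf (d + n) T)"
    by (simp add: inst_id_sub_mshift flip: emb_nshift)
  finally show ?thesis .
qed

lemma nf_MApp_shifted_proc:
  assumes "length qs = length bs"
  shows "nf (d + n) (MApp (mshiftp d n (bs, C)) qs) =
    nf (d + n) (inst (d + n) (id_sub d @ map Inr qs) 0 C)"
  using assms inst_weaken_mid[of "d + n" "id_sub d" "map Inl [d..<d + n]" "map Inr qs" 0 C]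
  by (simp add: mshiftp_map_body nf_MApp id_sub_add)

section \<open>Plugging\<close>

inductive mle_layer :: "(mexp \<Rightarrow> mexp \<Rightarrow> bool) \<Rightarrow> mexp \<Rightarrow> mexp \<Rightarrow> bool" for R where
  mle_layer_MBot: "mle_layer R MBot T"
| mle_layer_MNum: "mle_layer R (MNum n) (MNum n)"
| mle_layer_MCase:
    "R g g' \<Longrightarrow> (\<And>i. R (es i) (es' i)) \<Longrightarrow> mle_layer R (MCase g es) (MCase g' es')"
| mle_layer_MVar: "list_all2 (rel_body R) qs qs' \<Longrightarrow> mle_layer R (MVar x qs) (MVar x qs')"
| mle_layer_MApp:
    "rel_body R p p' \<Longrightarrow> list_all2 (rel_body R) qs qs' \<Longrightarrow> mle_layer R (MApp p qs) (MApp p' qs')"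

lemma mle_coinduct_layer:
  assumes "X T U" and step: "\<And>T U. X T U \<Longrightarrow> mle_layer X T U"
  shows "mle T U"
  using assms(1)
proof (coinduction arbitrary: T U rule: mle.coinduct)
  case (mle T U)
  have weaken: "list_all2 (rel_prod (=) (\<lambda>T U. X T U \<or> mle T U)) qs qs'"
    if "list_all2 (rel_body X) qs qs'" for qs qs'
    using that by (rule list_all2_mono) (auto simp: rel_body_def rel_prod_sel)
  from step[OF mle] show ?case
  proof cases
    case (mle_layer_MVar qs qs' x)
    then show ?thesis using weaken[OF mle_layer_MVar(3)] by simp
  next
    case (mle_layer_MApp p p' qs qs')
    obtain hs h h' where "p = (hs, h)" "p' = (hs, h')" "X h h'"
      using mle_layer_MApp(3) by (cases p; cases p') (auto simp: rel_body_def)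
    then show ?thesis using mle_layer_MApp weaken[OF mle_layer_MApp(4)] by simp
  qed simp_all
qed

lemma mle_iffs:
  "mle T MBot \<longleftrightarrow> T = MBot"
  "mle (MNum n) U \<longleftrightarrow> U = MNum n"
  "mle (MCase g es) U \<longleftrightarrow> (\<exists>g' es'. U = MCase g' es' \<and> mle g g' \<and> (\<forall>i. mle (es i) (es' i)))"
  "mle (MVar x qs) U \<longleftrightarrow> (\<exists>qs'. U = MVar x qs' \<and> list_all2 (rel_body mle) qs qs')"
  "mle (MApp p qs) U \<longleftrightarrow>
     (\<exists>p' qs'. U = MApp p' qs' \<and> rel_body mle p p' \<and> list_all2 (rel_body mle) qs qs')"
proof -
  show "mle (MApp p qs) U \<longleftrightarrow>
      (\<exists>p' qs'. U = MApp p' qs' \<and> rel_body mle p p' \<and> list_all2 (rel_body mle) qs qs')"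
    by (cases p) (subst mle.simps, auto simp: rel_body_eq_rel_prod)
qed (subst mle.simps; auto simp: rel_body_eq_rel_prod)+

lemma mle_antisym: "mle T U \<Longrightarrow> mle U T \<Longrightarrow> T = U"
proof (rule mexp_coinduct_layer[where R = "\<lambda>T U. mle T U \<and> mle U T"])
  let ?R = "\<lambda>T U. mle T U \<and> mle U T \<or> T = U"
  fix T U assume mle: "mle T U \<and> mle U T"
  have rel_body: "rel_body ?R q q'" if "rel_body mle q q'" "rel_body mle q' q" for q q'
    using that by (simp add: rel_body_def)
  have list: "list_all2 (rel_body ?R) qs qs'"
    if "list_all2 (rel_body mle) qs qs'" "list_all2 (rel_body mle) qs' qs" for qs qs'
    using that rel_body by (simp add: list_all2_conv_all_nth)
  show "mexp_layer ?R T U"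
    using mle by (cases T) (auto simp: mle_iffs intro!: mexp_layer.intros rel_body list)
qed blast

text \<open>The lub in the definition of plugging is the term obtained by substituting corecursively for
  all variables of \<open>Z\<close>.\<close>
corec plugged :: "nat \<Rightarrow> nat \<Rightarrow> (nat \<Rightarrow> nsp) \<Rightarrow> nat \<Rightarrow> mexp \<Rightarrow> mexp" where
  "plugged D r xi k e = (case e of
       MBot \<Rightarrow> MBot
     | MNum n \<Rightarrow> MNum n
     | MCase g es \<Rightarrow> MCase (plugged D r xi k g) (\<lambda>i. plugged D r xi k (es i))
     | MVar x qs \<Rightarrow>
         (if D \<le> x \<and> x < D + r
          then MApp (fst (xi (x - D)), plugged D r xi (k + length (fst (xi (x - D))))
                 (mshift (D + r) k (emb (snd (xi (x - D))))))
               (map (\<lambda>(bs,b). (bs, plugged D r xi (k + length bs) b)) qs)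
          else MVar x (map (\<lambda>(bs,b). (bs, plugged D r xi (k + length bs) b)) qs))
     | MApp (hs,h) qs \<Rightarrow> MApp (hs, plugged D r xi (k + length hs) h)
           (map (\<lambda>(bs,b). (bs, plugged D r xi (k + length bs) b)) qs))"

abbreviation pluggedp :: "nat \<Rightarrow> nat \<Rightarrow> (nat \<Rightarrow> nsp) \<Rightarrow> nat \<Rightarrow> mproc \<Rightarrow> mproc" where
  "pluggedp D r xi k \<equiv> map_body (\<lambda>n. plugged D r xi (k + n))"

lemma plugged_simps [simp]:
  "plugged D r xi k MBot = MBot"
  "plugged D r xi k (MNum n) = MNum n"
  "plugged D r xi k (MCase g es) = MCase (plugged D r xi k g) (\<lambda>i. plugged D r xi k (es i))"
  "plugged D r xi k (MVar x qs) =
     (if D \<le> x \<and> x < D + r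
      then MApp (pluggedp D r xi k (mshiftp (D + r) k (embp (xi (x - D)))))
        (map (pluggedp D r xi k) qs)
      else MVar x (map (pluggedp D r xi k) qs))"
  "plugged D r xi k (MApp p qs) = MApp (pluggedp D r xi k p) (map (pluggedp D r xi k) qs)"
  by (subst plugged.code;
      simp add: case_prod_map_body(1)[where f = "\<lambda>n. plugged D r xi (k + n)"]
        mshiftp_map_body embp_map_body map_body_def split: prod.split)+

context
  fixes D r :: nat and xi :: "nat \<Rightarrow> nsp"
begin

abbreviation plug_step :: "nat \<Rightarrow> mexp \<Rightarrow> mexp" where
  "plug_step \<equiv> msub D r 0 (D + r) (\<lambda>j. embp (xi j))"

lemma plug_step_iterate:
  "(plug_step k ^^ m) MBot = MBot"
  "(plug_step k ^^ m) (MNum n) = MNum n"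
  "(plug_step k ^^ m) (MCase g es) =
     MCase ((plug_step k ^^ m) g) (\<lambda>i. (plug_step k ^^ m) (es i))"
  "\<not> (D \<le> x \<and> x < D + r) \<Longrightarrow> (plug_step k ^^ m) (MVar x qs) =
     MVar x (map (map_body (\<lambda>n. plug_step (k + n) ^^ m)) qs)"
  "(plug_step k ^^ m) (MApp p qs) =
     MApp (map_body (\<lambda>n. plug_step (k + n) ^^ m) p)
       (map (map_body (\<lambda>n. plug_step (k + n) ^^ m)) qs)"
  by (induction m) (auto simp: map_body_ident comp_def intro!: map_idI[symmetric])

definition approx :: "nat \<Rightarrow> nat \<Rightarrow> mexp \<Rightarrow> mexp" where
  "approx k m T = mcirc D r ((plug_step k ^^ m) T)"

abbreviation approxp :: "nat \<Rightarrow> nat \<Rightarrow> mproc \<Rightarrow> mproc" where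
  "approxp k m \<equiv> map_body (\<lambda>n. approx (k + n) m)"

lemma approx_simps:
  "approx k m MBot = MBot"
  "approx k m (MNum n) = MNum n"
  "approx k m (MCase g es) = MCase (approx k m g) (\<lambda>i. approx k m (es i))"
  "\<not> (D \<le> x \<and> x < D + r) \<Longrightarrow> approx k m (MVar x qs) = MVar x (map (approxp k m) qs)"
  "approx k m (MApp p qs) = MApp (approxp k m p) (map (approxp k m) qs)"
  unfolding approx_def plug_step_iterate by simp_all

lemma approx_MVar_plugged:
  assumes "D \<le> x" "x < D + r"
  shows "approx k 0 (MVar x qs) = MBot"
    and "approx k (Suc m) (MVar x qs) =
      MApp (approxp k m (mshiftp (D + r) k (embp (xi (x - D))))) (map (approxp k (Suc m)) qs)"
proof -
  show "approx k 0 (MVar x qs) = MBot" using assms by (simp add: approx_def)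
  have "approx k (Suc m) (MVar x qs) = approx k m (plug_step k (MVar x qs))"
    by (simp only: approx_def funpow_Suc_right comp_apply)
  also have "plug_step k (MVar x qs) =
      MApp (mshiftp (D + r) k (embp (xi (x - D)))) (map (map_body (\<lambda>n. plug_step (k + n))) qs)"
    using assms by simp
  also have "approx k m \<dots> = MApp (approxp k m (mshiftp (D + r) k (embp (xi (x - D)))))
      (map (approxp k (Suc m)) qs)"
    by (simp add: approx_simps)
      (simp add: map_body_def approx_def funpow_Suc_right del: funpow.simps)
  finally show "approx k (Suc m) (MVar x qs) = \<dots>" .
qed

lemma approx_mle_plugged: "mle (approx k m T) (plugged D r xi k T)"
proof -
  let ?X = "\<lambda>T U. \<exists>k m V. T = approx k m V \<and> U = plugged D r xi k V"
  show ?thesis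
  proof (rule mle_coinduct_layer[where X = ?X])
    fix T U assume "?X T U"
    then obtain k m V where TU: "T = approx k m V" "U = plugged D r xi k V" by blast
    show "mle_layer ?X T U"
    proof (cases "\<exists>x qs. V = MVar x qs \<and> D \<le> x \<and> x < D + r")
      case True
      then obtain x qs where V: "V = MVar x qs" and x: "D \<le> x" "x < D + r" by blast
      show ?thesis
        using x unfolding TU V
        by (cases m) (auto simp: approx_MVar_plugged[OF x]
            intro!: mle_layer.intros list_all2_map_same, blast+)
    next
      case False
      then show ?thesis
        unfolding TU
        by (cases V) (auto simp: approx_simps intro!: mle_layer.intros list_all2_map_same, blast+)
    qed
  qed blast
qed

definition plugged_bound :: "mexp \<Rightarrow> mexp \<Rightarrow> bool" where
  "plugged_bound T U \<longleftrightarrow>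
     (\<exists>k V. T = plugged D r xi k V \<and> (\<forall>\<^sub>F m in sequentially. mle (approx k m V) U))"

lemma plugged_boundI:
  "\<forall>\<^sub>F m in sequentially. mle (approx k m V) U \<Longrightarrow> plugged_bound (plugged D r xi k V) U"
  by (auto simp: plugged_bound_def)

lemma rel_body_plugged_bound:
  assumes "\<forall>\<^sub>F m in sequentially. rel_body mle (approxp k m p) p'"
  shows "rel_body plugged_bound (pluggedp D r xi k p) p'"
  using assms by (auto simp: rel_body_def eventually_conj_iff intro: plugged_boundI)

lemma list_rel_body_plugged_bound:
  assumes "\<forall>\<^sub>F m in sequentially. list_all2 (rel_body mle) (map (approxp k m) qs) qs'"
  shows "list_all2 (rel_body plugged_bound) (map (pluggedp D r xi k) qs) qs'"
proof -
  have "length qs = length qs'"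
    using eventually_happens'[OF sequentially_bot assms] by (auto dest: list_all2_lengthD)
  moreover have "rel_body plugged_bound (pluggedp D r xi k (qs ! i)) (qs' ! i)"
    if "i < length qs" for i
    using assms that
    by (intro rel_body_plugged_bound) (auto elim!: eventually_mono dest: list_all2_nthD)
  ultimately show ?thesis by (simp add: list_all2_conv_all_nth)
qed

lemma plugged_bound_MVar_plugged:
  assumes x: "D \<le> x" "x < D + r"
    and bound: "\<forall>\<^sub>F m in sequentially. mle (approx k m (MVar x qs)) U"
  shows "mle_layer plugged_bound (plugged D r xi k (MVar x qs)) U"
proof -
  let ?p = "mshiftp (D + r) k (embp (xi (x - D)))"
  have bound_Suc: "\<forall>\<^sub>F m in sequentially.
      mle (MApp (approxp k m ?p) (map (approxp k (Suc m)) qs)) U"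
    using eventually_sequentially_Suc[THEN iffD2, OF bound]
    by (simp only: approx_MVar_plugged(2)[OF x])
  obtain p' qs' where U: "U = MApp p' qs'"
    using eventually_happens'[OF sequentially_bot bound_Suc] by (auto simp: mle_iffs)
  have "\<forall>\<^sub>F m in sequentially. rel_body mle (approxp k m ?p) p'"
    using bound_Suc by (rule eventually_mono) (simp add: mle_iffs U)
  moreover have "\<forall>\<^sub>F m in sequentially. list_all2 (rel_body mle) (map (approxp k (Suc m)) qs) qs'"
    using bound_Suc by (rule eventually_mono) (simp add: mle_iffs U)
  then have "\<forall>\<^sub>F m in sequentially. list_all2 (rel_body mle) (map (approxp k m) qs) qs'"
    by (rule eventually_sequentially_Suc[THEN iffD1])
  ultimately show ?thesis
    using x unfolding U
    by (simp add: mle_layer.intros(5) rel_body_plugged_bound list_rel_body_plugged_bound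
        del: map_body_simps map_body_map_body)
qed

lemma plugged_bound_MVar_free:
  assumes x: "\<not> (D \<le> x \<and> x < D + r)"
    and bound: "\<forall>\<^sub>F m in sequentially. mle (approx k m (MVar x qs)) U"
  shows "mle_layer plugged_bound (plugged D r xi k (MVar x qs)) U"
proof -
  obtain qs' where U: "U = MVar x qs'"
    using eventually_happens'[OF sequentially_bot bound]
    by (auto simp: approx_simps(4)[OF x] mle_iffs)
  have "\<forall>\<^sub>F m in sequentially. list_all2 (rel_body mle) (map (approxp k m) qs) qs'"
    using bound by (auto simp: U approx_simps(4)[OF x] mle_iffs elim: eventually_mono)
  then show ?thesis
    unfolding U plugged_simps if_not_P[OF x]
    by (intro mle_layer.intros list_rel_body_plugged_bound)
qed

lemma plugged_bound_MApp:
  assumes bound: "\<forall>\<^sub>F m in sequentially. mle (approx k m (MApp p qs)) U"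
  shows "mle_layer plugged_bound (plugged D r xi k (MApp p qs)) U"
proof -
  obtain p' qs' where U: "U = MApp p' qs'"
    using eventually_happens'[OF sequentially_bot bound] by (auto simp: approx_simps mle_iffs)
  have "\<forall>\<^sub>F m in sequentially. rel_body mle (approxp k m p) p'"
    and "\<forall>\<^sub>F m in sequentially. list_all2 (rel_body mle) (map (approxp k m) qs) qs'"
    using bound by (auto simp: U approx_simps mle_iffs elim: eventually_mono)
  then show ?thesis
    unfolding U plugged_simps
    by (intro mle_layer.intros rel_body_plugged_bound list_rel_body_plugged_bound)
qed

lemma plugged_bound_MCase:
  assumes bound: "\<forall>\<^sub>F m in sequentially. mle (approx k m (MCase g es)) U"
  shows "mle_layer plugged_bound (plugged D r xi k (MCase g es)) U"
proof -
  obtain g' es' where U: "U = MCase g' es'"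
    using eventually_happens'[OF sequentially_bot bound] by (auto simp: approx_simps mle_iffs)
  have "\<forall>\<^sub>F m in sequentially. mle (approx k m g) g'"
    and "\<forall>\<^sub>F m in sequentially. mle (approx k m (es i)) (es' i)" for i
    using bound by (auto simp: U approx_simps mle_iffs elim: eventually_mono)
  then show ?thesis by (simp add: U mle_layer.intros plugged_boundI)
qed

lemma plugged_bound_layer:
  assumes "plugged_bound T U"
  shows "mle_layer plugged_bound T U"
proof -
  obtain k V where T: "T = plugged D r xi k V"
    and bound: "\<forall>\<^sub>F m in sequentially. mle (approx k m V) U"
    using assms by (auto simp: plugged_bound_def)
  show ?thesis
  proof (cases V)
    case (MNum n)
    then have "U = MNum n"
      using eventually_happens'[OF sequentially_bot bound] by (auto simp: approx_simps mle_iffs)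
    then show ?thesis by (simp add: T MNum mle_layer.intros)
  next
    case (MVar x qs)
    show ?thesis
    proof (cases "D \<le> x \<and> x < D + r")
      case True
      then show ?thesis using plugged_bound_MVar_plugged bound unfolding T MVar by blast
    next
      case False
      then show ?thesis using bound unfolding T MVar by (rule plugged_bound_MVar_free)
    qed
  next
    case (MApp p qs)
    then show ?thesis using bound unfolding T MApp by (intro plugged_bound_MApp)
  next
    case (MCase g es)
    then show ?thesis using bound unfolding T MCase by (intro plugged_bound_MCase)
  qed (simp add: T mle_layer.intros)
qed

lemma plugged_least:
  assumes "\<And>m. mle (approx k m T) U"
  shows "mle (plugged D r xi k T) U"
  using plugged_boundI[OF always_eventually] assms
  by (auto intro!: mle_coinduct_layer[where X = plugged_bound] plugged_bound_layer)

lemma plug_eq_plugged: "plug D r e xi = plugged D r xi 0 (emb e)"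
proof -
  let ?lub = "\<lambda>T. (\<forall>m. mle (approx 0 m (emb e)) T) \<and>
    (\<forall>U. (\<forall>m. mle (approx 0 m (emb e)) U) \<longrightarrow> mle T U)"
  have "?lub (plugged D r xi 0 (emb e))"
    using approx_mle_plugged plugged_least by blast
  moreover from this have "T = plugged D r xi 0 (emb e)" if "?lub T" for T
    using that by (blast intro: mle_antisym)
  ultimately have "(THE T. ?lub T) = plugged D r xi 0 (emb e)" by (rule the_equality)
  then show ?thesis unfolding plug_def plug_approx_def approx_def .
qed

lemma plugged_mshift:
  "plugged D r xi (k + j) (mshift (D + r) k T) = mshift (D + r) k (plugged D r xi j T)"
proof (rule mexp_family_eqI[where F = "\<lambda>j T. plugged D r xi (k + j) (mshift (D + r) k T)"
     and G = "\<lambda>j T. mshift (D + r) k (plugged D r xi j T)"], goal_cases layer)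
  case (layer j T)
  show ?case
  proof (cases T)
    case (MVar x qs)
    show ?thesis
    proof (cases "D \<le> x \<and> x < D + r")
      case True
      then have "shift_var (D + r) k x = x" by (simp add: shift_var_def)
      then show ?thesis unfolding MVar using True
        by (auto intro!: mexp_layer.intros list_all2_map_same
            simp: mshiftp_map_body mshift_mshift[symmetric] add.assoc, blast+)
    next
      case False
      then have "\<not> (D \<le> shift_var (D + r) k x \<and> shift_var (D + r) k x < D + r)"
        by (auto simp: shift_var_def)
      then show ?thesis unfolding MVar using False
        by (simp del: de_Morgan_conj)
          (rule mexp_layer.intros, auto intro!: list_all2_map_same simp: add.assoc, blast+)
    qed
  qed (auto intro!: mexp_layer.intros list_all2_map_same simp: add.assoc, blast+)
qed

definition plug_sub :: "entry list" where
  "plug_sub = id_sub D @ map (\<lambda>j. Inr (pluggedp D r xi 0 (embp (xi j)))) [0..<r]"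

lemma plugged_eq_inst: "plugged D r xi k T = inst (D + r) plug_sub k T"
proof (rule mexp_family_eqI[where F = "plugged D r xi" and G = "inst (D + r) plug_sub"],
    goal_cases layer)
  case (layer k T)
  have lookup_plug_sub: "lookup (D + r) plug_sub x =
      (if D \<le> x \<and> x < D + r then Inr (pluggedp D r xi 0 (embp (xi (x - D)))) else Inl x)" for x
    by (auto simp: lookup_def plug_sub_def nth_append)
  show ?case
    by (cases T) (auto simp: lookup_plug_sub mshiftp_map_body plugged_mshift
        intro!: mexp_layer.intros list_all2_map_same, blast+)
qed

lemma well_sorted_plugged:
  assumes "well_sorted c T"
  shows "well_sorted c (plugged D r xi k T)"
proof -
  let ?X = "\<lambda>c U. \<exists>k T. U = plugged D r xi k T \<and> well_sorted c T"
  have "?X c U \<Longrightarrow> well_sorted c U" for U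
  proof (coinduction arbitrary: c U)
    case well_sorted
    then obtain k T where U: "U = plugged D r xi k T" and T: "well_sorted c T" by blast
    show ?case
    proof (cases "\<exists>x qs. T = MVar x qs \<and> D \<le> x \<and> x < D + r")
      case True
      then obtain x qs where V: "T = MVar x qs" and x: "D \<le> x" "x < D + r" by blast
      let ?p = "pluggedp D r xi k (mshiftp (D + r) k (embp (xi (x - D))))"
      let ?qs = "map (pluggedp D r xi k) qs"
      have "?X Expr (snd ?p)"
        by (simp add: mshiftp_map_body embp_map_body)
          (blast intro: well_sorted_mren well_sorted_emb)
      moreover have "\<forall>q\<in>set ?qs. ?X Expr (snd q)" using T V by auto
      moreover have "U = MApp ?p ?qs" "c = Ground" using U T V x by auto
      ultimately show ?thesis by (intro disjI2 exI[of _ ?p] exI[of _ ?qs]) simp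
    next
      case False
      then show ?thesis using U T by (cases T) auto
    qed
  qed
  then show ?thesis using assms by blast
qed

end

section \<open>Eta-expansion\<close>

declare eta.simps [simp del]

definition etas :: "ty list \<Rightarrow> nat \<Rightarrow> nsp list" where
  "etas ss D = map (\<lambda>j. eta (ss ! j) (D + j) (D + length ss)) [0..<length ss]"

lemma length_etas [simp]: "length (etas ss D) = length ss"
  by (simp add: etas_def)

lemma nth_etas [simp]: "j < length ss \<Longrightarrow> etas ss D ! j = eta (ss ! j) (D + j) (D + length ss)"
  by (simp add: etas_def)

lemma eta_eq_Case: "eta s v D = (args s, Case v (etas (args s) D) Num)"
  by (subst eta.simps) (simp add: etas_def)

lemma etas_Nil [simp]: "etas [] D = []"
  by (simp add: etas_def)

lemma eta_N: "eta N v D = ([], Case v [] Num)"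
  by (simp add: eta_eq_Case)

lemma fst_eta [simp]: "fst (eta s v D) = args s"
  by (simp add: eta_eq_Case)

lemma emb_eta: "emb (snd (eta s v D)) = MCase (MVar v (map embp (etas (args s) D))) MNum"
  by (simp add: eta_eq_Case embp_map_body)

lemma map_fst_etas [simp]: "map fst (etas ss D) = map args ss"
  by (rule nth_equalityI) simp_all

lemma instp_eta_Inl:
  "lookup d us v = Inl w
   \<Longrightarrow> instp d us k (embp (eta s v (length us + k))) = embp (eta s w (d + k))"
proof (induction s arbitrary: v w k rule: measure_induct_rule[of size])
  case (less s)
  let ?n = "length (args s)"
  have "instp d us (k + ?n) (embp (etas (args s) (length us + k) ! j)) =
      embp (etas (args s) (d + k) ! j)" if j: "j < ?n" for j
  proof -
    have "lookup d us (length us + k + j) = Inl (d + k + j)" by (simp add: lookup_def)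
    from less.IH[OF size_args_nth[OF j] this, of "k + ?n"] show ?thesis
      using j by (simp add: add.assoc del: map_body_simps)
  qed
  then have "map (instp d us (k + ?n)) (map embp (etas (args s) (length us + k))) =
      map embp (etas (args s) (d + k))"
    by (intro nth_equalityI) (simp_all del: map_body_simps)
  then show ?case
    using less.prems by (simp add: prod_eq_iff emb_eta del: map_map)
qed

lemma map_instp_etas:
  "map (instp d us (k + length ss)) (map embp (etas ss (length us + k))) =
     map embp (etas ss (d + k))"
proof (rule nth_equalityI)
  fix j assume "j < length (map (instp d us (k + length ss)) (map embp (etas ss (length us + k))))"
  moreover have "lookup d us (length us + k + j) = Inl (d + k + j)" by (simp add: lookup_def)
  ultimately show "map (instp d us (k + length ss)) (map embp (etas ss (length us + k))) ! j =
      map embp (etas ss (d + k)) ! j"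
    using instp_eta_Inl[of d us "length us + k + j" "d + k + j" "k + length ss" "ss ! j"]
    by (simp add: add.assoc del: map_body_simps)
qed simp

lemma mshiftp_eta: "x < d \<Longrightarrow> mshiftp d n (embp (eta s x d)) = embp (eta s x (d + n))"
  using instp_eta_Inl[of "d + n" "id_sub d" x x 0 s]
  by (simp add: lookup_id_sub mshiftp_map_body map_body_def inst_id_sub_mshift)

abbreviation procs :: "nsp list \<Rightarrow> entry list" where
  "procs \<equiv> map (Inr \<circ> embp)"

abbreviation nf_inst :: "nat \<Rightarrow> entry list \<Rightarrow> nexp \<Rightarrow> nexp" where
  "nf_inst d us e \<equiv> nf d (inst d us 0 (emb e))"

abbreviation nf_inst_under :: "nat \<Rightarrow> entry list \<Rightarrow> nat \<Rightarrow> nexp \<Rightarrow> nexp" where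
  "nf_inst_under d us n e \<equiv> nf (d + n) (inst d us n (emb e))"

lemma nf_inst_nf_inst:
  assumes "scoped d vs"
  shows "nf_inst d vs (nf_inst (length vs) us e) = nf_inst d (map (inst_entry d vs) us) e"
  using nf_inst_emb_nf[OF assms, of "length vs" 0 "inst (length vs) us 0 (emb e)"]
    inst_inst[OF assms, of 0 us "emb e"]
  by simp

definition nf_instp :: "nat \<Rightarrow> entry list \<Rightarrow> nsp \<Rightarrow> nsp" where
  "nf_instp d us p = (fst p, nf_inst_under d us (length (fst p)) (snd p))"

lemma nf_instp_simps [simp]:
  "fst (nf_instp d us p) = fst p"
  "snd (nf_instp d us p) = nf_inst_under d us (length (fst p)) (snd p)"
  by (simp_all add: nf_instp_def)

lemma nfp_instp_embp: "nfp d (map_body (inst d us) (embp p)) = nf_instp d us p"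
  by (simp add: nf_instp_def prod_eq_iff)

lemma nf_inst_under_lift_sub: "nf_inst_under d us n e = nf_inst (d + n) (lift_sub d n us) e"
  by (simp add: inst_eq_inst_lift_sub[of d us n])

text \<open>The normal form of \<open>\<lambda>x. Q x\<^sup>\<eta>\<close>.\<close>
definition eta_nf :: "nat \<Rightarrow> mproc \<Rightarrow> nsp" where
  "eta_nf d Q =
     (fst Q, nf (d + length (fst Q))
       (inst (d + length (fst Q)) (id_sub d @ procs (etas (fst Q) d)) 0 (snd Q)))"

lemma nf_instp_eta_Inr:
  assumes "lookup d us v = Inr Q" "fst Q = args s" "D = length us"
  shows "nf_instp d us (eta s v D) = eta_nf d Q"
proof -
  let ?n = "length (args s)"
  obtain C where Q: "Q = (args s, C)" using assms(2) by (cases Q) simp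
  have "nf_inst_under d us ?n (snd (eta s v D)) =
      nf (d + ?n) (MApp (mshiftp d ?n Q) (map embp (etas (args s) d)))"
    using map_instp_etas[of d us 0 "args s"] assms(1,3) by (simp add: emb_eta del: map_map)
  also have "\<dots> = nf (d + ?n) (inst (d + ?n) (id_sub d @ procs (etas (args s) d)) 0 C)"
    using nf_MApp_shifted_proc[of "map embp (etas (args s) d)" "args s"] by (simp add: Q)
  finally show ?thesis by (simp add: nf_instp_def eta_nf_def Q)
qed

lemma nf_inst_eta_saturated:
  assumes "lookup d us v = Inl w" "v < length us" "D = length us" "map fst Qs = map args (args s)"
  shows "nf d (inst d (us @ map Inr Qs) 0 (emb (snd (eta s v D)))) =
    Case w (map (eta_nf d) Qs) Num"
proof -
  let ?us = "us @ map Inr Qs"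
  have len: "length Qs = length (args s)" using assms(4) map_eq_imp_length_eq by metis
  have "nf_instp d ?us (etas (args s) D ! j) = eta_nf d (Qs ! j)" if j: "j < length Qs" for j
  proof -
    have "fst (Qs ! j) = args (args s ! j)" using assms(4) j len by (metis nth_map)
    then show ?thesis
      using j len nf_instp_eta_Inr[of d ?us "D + j" "Qs ! j" "args s ! j" "D + length (args s)"]
      by (simp add: lookup_def nth_append assms(3))
  qed
  then have "map (nf_instp d ?us) (etas (args s) D) = map (eta_nf d) Qs"
    by (intro nth_equalityI) (simp_all add: len)
  then show ?thesis
    using assms(1,2)
    by (simp add: emb_eta lookup_append_left nf_MCase comp_def nfp_instp_embp
        del: map_body_simps map_body_map_body)
qed

section \<open>Invariance under eta-expansion of variables\<close>

definition eta_sub :: "ty list \<Rightarrow> nat set \<Rightarrow> entry list" where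
  "eta_sub G B =
     map (\<lambda>x. if x \<in> B then Inr (embp (eta (G ! x) x (length G))) else Inl x) [0..<length G]"

definition eta_stable_exp :: "ty list \<Rightarrow> nexp \<Rightarrow> bool" where
  "eta_stable_exp G e \<longleftrightarrow> (\<forall>B. nf_inst (length G) (eta_sub G B) e = e)"

text \<open>This invariance is all that is needed of well-typedness.\<close>
definition eta_stable :: "ty list \<Rightarrow> nsp \<Rightarrow> bool" where
  "eta_stable G p \<longleftrightarrow> eta_stable_exp (G @ fst p) (snd p)"

lemma length_eta_sub [simp]: "length (eta_sub G B) = length G"
  by (simp add: eta_sub_def)

lemma scoped_eta_sub [simp]: "scoped (length G) (eta_sub G B)"
  by (auto simp: eta_sub_def scoped_def split: if_splits)

lemma nth_eta_sub:
  "x < length G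
   \<Longrightarrow> eta_sub G B ! x = (if x \<in> B then Inr (embp (eta (G ! x) x (length G))) else Inl x)"
  by (simp add: eta_sub_def)

lemma eta_sub_empty [simp]: "eta_sub G {} = id_sub (length G)"
  by (simp add: eta_sub_def)

lemma eta_sub_append:
  "eta_sub (G @ bs) B = map (map_sum id (mshiftp (length G) (length bs))) (eta_sub G B)
     @ map (\<lambda>j. if length G + j \<in> B
                then Inr (embp (eta (bs ! j) (length G + j) (length G + length bs)))
                else Inl (length G + j)) [0..<length bs]"
  by (rule nth_equalityI) (auto simp: nth_eta_sub nth_append mshiftp_eta)

lemma lift_sub_eta_sub:
  "lift_sub (length G) (length bs) (eta_sub G B) = eta_sub (G @ bs) (B \<inter> {..<length G})"
  unfolding lift_sub_def eta_sub_append
  by (rule arg_cong2[where f = append])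
    (auto intro!: nth_equalityI simp: nth_eta_sub eta_sub_def)

lemma eta_sub_append_etas:
  "eta_sub (G @ bs) (B \<inter> {..<length G} \<union> {length G..}) =
     map (map_sum id (mshiftp (length G) (length bs))) (eta_sub G B) @ procs (etas bs (length G))"
  unfolding eta_sub_append
  by (rule arg_cong2[where f = append]) (auto intro!: nth_equalityI simp: nth_eta_sub)

lemma eta_stableD:
  "eta_stable G p \<Longrightarrow> nf_inst (length G + length (fst p)) (eta_sub (G @ fst p) B) (snd p) = snd p"
  by (simp add: eta_stable_def eta_stable_exp_def)

lemma nf_instp_eta_sub:
  assumes "eta_stable G p"
  shows "nf_instp (length G) (eta_sub G B) p = p"
  using eta_stableD[OF assms]
  by (simp add: nf_instp_def nf_inst_under_lift_sub lift_sub_eta_sub)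

lemma eta_nf_embp:
  assumes "eta_stable G q"
  shows "eta_nf (length G) (embp q) = q"
proof -
  have "eta_sub (G @ fst q) ({} \<inter> {..<length G} \<union> {length G..}) =
      id_sub (length G) @ procs (etas (fst q) (length G))"
    unfolding eta_sub_append_etas by simp
  then show ?thesis
    using eta_stableD[OF assms, of "{} \<inter> {..<length G} \<union> {length G..}"]
    by (simp only: eta_nf_def embp_simps prod.collapse)
qed

lemma eta_nf_instp_eta_sub:
  "eta_nf (length G) (map_body (inst (length G) (eta_sub G B)) (embp q)) =
     (fst q, nf_inst (length (G @ fst q))
       (eta_sub (G @ fst q) (B \<inter> {..<length G} \<union> {length G..})) (snd q))"
  using inst_inst_under[of "id_sub (length G)" "length G" "procs (etas (fst q) (length G))"
      "length (fst q)" "length G + length (fst q)" "eta_sub G B" 0]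
  by (simp add: eta_nf_def eta_sub_append_etas map_inst_entry_id_sub_shift)

lemma nf_inst_eta_sub_Case:
  assumes "x < length G" "map fst qs = map args (args (G ! x))"
  obtains F where "nf_inst (length G) (eta_sub G B) (Case x qs es) =
    Case x (map (\<lambda>q. (fst q, nf_inst (length (G @ fst q)) (eta_sub (G @ fst q) F) (snd q))) qs)
      (\<lambda>i. nf_inst (length G) (eta_sub G B) (es i))"
proof (cases "x \<in> B")
  case False
  have "nf_instp (length G) (eta_sub G B) q = (fst q, nf_inst (length (G @ fst q))
      (eta_sub (G @ fst q) (B \<inter> {..<length G})) (snd q))" for q
    by (simp add: nf_instp_def nf_inst_under_lift_sub lift_sub_eta_sub)
  moreover have "lookup (length G) (eta_sub G B) x = Inl x"
    using assms(1) False by (simp add: lookup_def nth_eta_sub)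
  ultimately show thesis
    by (intro that[of "B \<inter> {..<length G}"]) (simp add: nf_MCase comp_def nfp_instp_embp
        embp_map_body[symmetric] del: map_body_simps map_body_map_body)
next
  case True
  let ?d = "length G" and ?s = "G ! x"
  let ?Qs = "map (instp (length G) (eta_sub G B) 0) (map embp qs)"
  have len: "length qs = length (args ?s)" using assms(2) map_eq_imp_length_eq by metis
  have fst: "map fst ?Qs = map args (args ?s)" using assms(2) by (simp add: comp_def)
  have "lookup ?d (eta_sub G B) x = Inr (embp (eta ?s x ?d))"
    using assms(1) True by (simp add: lookup_def nth_eta_sub)
  then have "nf_inst ?d (eta_sub G B) (Case x qs es) =
      nrepl (\<lambda>i. nf_inst ?d (eta_sub G B) (es i)) (nf ?d (MApp (embp (eta ?s x ?d)) ?Qs))"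
    by (simp add: nf_MCase embp_map_body comp_def)
  also have "nf ?d (MApp (embp (eta ?s x ?d)) ?Qs) = nf ?d (beta ?d ?Qs (emb (snd (eta ?s x ?d))))"
    unfolding embp_def by (rule nf_MApp) (simp add: len)
  also have "\<dots> = Case x (map (eta_nf ?d) ?Qs) Num"
    by (rule nf_inst_eta_saturated[OF _ _ _ fst]) (use assms(1) in \<open>auto simp: lookup_id_sub\<close>)
  finally show thesis
    by (intro that[of "B \<inter> {..<?d} \<union> {?d..}"])
      (simp add: comp_def eta_nf_instp_eta_sub del: map_body_simps)
qed

lemma map_nf_inst_eta_sub:
  assumes "\<And>q. q \<in> set qs \<Longrightarrow> eta_stable G q"
  shows "map (\<lambda>q. (fst q, nf_inst (length (G @ fst q)) (eta_sub (G @ fst q) F) (snd q))) qs = qs"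
  by (rule map_idI) (simp add: eta_stableD[OF assms])

lemma eta_stable_exp_Case:
  assumes "x < length G" "map fst qs = map args (args (G ! x))"
    and "\<And>q. q \<in> set qs \<Longrightarrow> eta_stable G q" "\<And>i. eta_stable_exp G (es i)"
  shows "eta_stable_exp G (Case x qs es)"
  unfolding eta_stable_exp_def
proof
  fix B
  obtain F where F: "nf_inst (length G) (eta_sub G B) (Case x qs es) =
    Case x (map (\<lambda>q. (fst q, nf_inst (length (G @ fst q)) (eta_sub (G @ fst q) F) (snd q))) qs)
      (\<lambda>i. nf_inst (length G) (eta_sub G B) (es i))"
    using nf_inst_eta_sub_Case[OF assms(1,2)] by blast
  have "map (\<lambda>q. (fst q, nf_inst (length (G @ fst q)) (eta_sub (G @ fst q) F) (snd q))) qs = qs"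
    by (rule map_nf_inst_eta_sub) (rule assms(3))
  then show "nf_inst (length G) (eta_sub G B) (Case x qs es) = Case x qs es"
    unfolding F using assms(4) by (simp add: eta_stable_exp_def)
qed

lemma eta_stable_exp_Num [simp]: "eta_stable_exp G (Num n)"
  and eta_stable_exp_Bot [simp]: "eta_stable_exp G Bot"
  by (simp_all add: eta_stable_exp_def)

lemma eta_stable_exp_Case_N:
  "x < length G \<Longrightarrow> G ! x = N \<Longrightarrow> (\<And>i. eta_stable_exp G (es i)) \<Longrightarrow> eta_stable_exp G (Case x [] es)"
  by (rule eta_stable_exp_Case) auto

lemma eta_stable_eta: "x < length G \<Longrightarrow> eta_stable G (eta (G ! x) x (length G))"
proof (induction "G ! x" arbitrary: G x rule: measure_induct_rule[of size])
  case less
  let ?ss = "args (G ! x)"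
  have "eta_stable (G @ ?ss) (eta (?ss ! j) (length G + j) (length G + length ?ss))"
    if j: "j < length ?ss" for j
    using less.hyps[of "G @ ?ss" "length G + j"] size_args_nth[OF j] j by (simp add: nth_append)
  then have "eta_stable (G @ ?ss) q" if "q \<in> set (etas ?ss (length G))" for q
    using that by (auto simp: etas_def)
  then have "eta_stable_exp (G @ ?ss) (Case x (etas ?ss (length G)) Num)"
    using less.prems by (intro eta_stable_exp_Case) (simp_all add: nth_append)
  then show ?case by (simp add: eta_stable_def eta_eq_Case)
qed

lemma eta_stable_etas:
  assumes "q \<in> set (etas bs (length G))"
  shows "eta_stable (G @ bs) q"
proof -
  obtain j where "j < length bs" "q = eta (bs ! j) (length G + j) (length G + length bs)"
    using assms by (auto simp: etas_def)
  then show ?thesis using eta_stable_eta[of "length G + j" "G @ bs"] by (simp add: nth_append)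
qed

lemma nf_instp_eta_stable:
  assumes "lookup (length G) us v = Inr (embp p)" "fst p = args s" "eta_stable G p" "D = length us"
  shows "nf_instp (length G) us (eta s v D) = p"
  using nf_instp_eta_Inr[OF assms(1) _ assms(4)] assms(2) eta_nf_embp[OF assms(3)] by simp

lemma nf_inst_eta_saturated_stable:
  assumes "lookup (length G) us v = Inl w" "v < length us" "D = length us"
    and "map fst qs = map args (args s)" "\<And>q. q \<in> set qs \<Longrightarrow> eta_stable G q"
  shows "nf_inst (length G) (us @ procs qs) (snd (eta s v D)) = Case w qs Num"
proof -
  have "map (eta_nf (length G)) (map embp qs) = qs"
    unfolding map_map by (rule map_idI) (simp add: eta_nf_embp assms(5))
  then show ?thesis
    using nf_inst_eta_saturated[OF assms(1-3), of "map embp qs" s] assms(4)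
    by (simp add: comp_def)
qed

lemma nf_inst_eta_applied:
  assumes v: "lookup (length G) us v = Inr (embp p)" "v < length us" "D = length us"
    and p: "fst p = args s"
    and qs: "map fst qs = map args (args s)" "\<And>q. q \<in> set qs \<Longrightarrow> eta_stable G q"
  shows "nf_inst (length G) (us @ procs qs) (snd (eta s v D)) =
    nf_inst (length G) (id_sub (length G) @ procs qs) (snd p)"
proof -
  let ?d = "length G" and ?us = "us @ procs qs"
  let ?Qs = "map (instp ?d ?us 0) (map embp (etas (args s) D))"
  have len: "length qs = length (args s)" using qs(1) map_eq_imp_length_eq by metis
  have "inst ?d ?us 0 (emb (snd (eta s v D))) = MCase (MApp (embp p) ?Qs) MNum"
    unfolding emb_eta using v by (simp add: lookup_append_left del: map_map)
  then have "nf_inst ?d ?us (snd (eta s v D)) = nf ?d (beta ?d ?Qs (emb (snd p)))"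
    using nf_MApp[of ?Qs "fst p" ?d "emb (snd p)"] p len by (simp add: embp_def)
  moreover have "nf_eq_entry ?d (Inr (?Qs ! j)) (Inr (embp (qs ! j)))" if j: "j < length qs" for j
  proof -
    have "fst (qs ! j) = args (args s ! j)" using qs(1) j len by (metis nth_map)
    then have "nf_instp ?d ?us (etas (args s) D ! j) = qs ! j"
      using j len nf_instp_eta_stable[of G ?us "D + j" "qs ! j" "args s ! j" "D + length (args s)"]
        qs(2) by (simp add: lookup_def nth_append v(3))
    then show ?thesis using j len by (auto simp: rel_proc_def nf_instp_def prod_eq_iff)
  qed
  then have "list_all2 (nf_eq_entry ?d) (id_sub ?d @ map Inr ?Qs) (id_sub ?d @ procs qs)"
    by (intro list_all2_appendI list_nf_eq_entry_refl) (simp add: list_all2_conv_all_nth len)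
  from nf_inst_cong[OF _ _ _ this, of 0]
  have "nf ?d (beta ?d ?Qs (emb (snd p))) = nf_inst ?d (id_sub ?d @ procs qs) (snd p)" by simp
  ultimately show ?thesis by simp
qed

section \<open>Substitution of eta-stable procedures\<close>

definition weaken :: "nat \<Rightarrow> nat \<Rightarrow> nsp \<Rightarrow> nsp" where
  "weaken d h q = (fst q, nshift d h (snd q))"

lemma fst_weaken [simp]: "fst (weaken d h q) = fst q"
  by (simp add: weaken_def)

lemma mshiftp_embp: "mshiftp d h (embp q) = embp (weaken d h q)"
  by (simp add: weaken_def mshiftp_map_body embp_def emb_nshift)

definition stable_entry :: "ty list \<Rightarrow> entry \<Rightarrow> ty \<Rightarrow> bool" where
  "stable_entry G u s \<longleftrightarrow>
     (case u of Inl y \<Rightarrow> y < length G \<and> G ! y = s | Inr P \<Rightarrow> \<exists>p. P = embp p \<and> eta_stable G p)"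

lemma stable_entry_simps [simp]:
  "stable_entry G (Inl y) s \<longleftrightarrow> y < length G \<and> G ! y = s"
  "eta_stable G p \<Longrightarrow> stable_entry G (Inr (embp p)) s"
  by (auto simp: stable_entry_def simp del: split_paired_Ex)

lemma stable_entry_cases:
  assumes "stable_entry G u s"
  obtains (variable) y where "u = Inl y" "y < length G" "G ! y = s"
  | (procedure) p where "u = Inr (embp p)" "eta_stable G p"
  using assms by (auto simp: stable_entry_def split: sum.splits)

lemma scoped_stable_entries: "list_all2 (stable_entry G) us ss \<Longrightarrow> scoped (length G) us"
  by (fastforce simp: scoped_def in_set_conv_nth list_all2_conv_all_nth)

lemma stable_entries_id_sub: "list_all2 (stable_entry G) (id_sub (length G)) G"
  by (simp add: list_all2_conv_all_nth)

lemma nf_eq_entry_eta_sub: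
  assumes us: "list_all2 (stable_entry G) us G'" and x: "x < length G'"
  shows "nf_eq_entry (length G) (inst_entry (length G) (eta_sub G B) (us ! x))
    (inst_entry (length G) us (eta_sub G' {x. \<exists>y\<in>B. us ! x = Inl y} ! x))"
proof -
  let ?d = "length G" and ?vs' = "eta_sub G' {x. \<exists>y\<in>B. us ! x = Inl y}"
  have len: "length us = length G'" using us by (rule list_all2_lengthD)
  have "stable_entry G (us ! x) (G' ! x)" using list_all2_nthD2[OF us x] .
  then show ?thesis
  proof (cases rule: stable_entry_cases)
    case (variable y)
    then have lookup_x: "lookup ?d us x = Inl y" using x len by (simp add: lookup_def)
    have "instp ?d us 0 (embp (eta (G' ! x) x (length G'))) = embp (eta (G' ! x) y ?d)"
      using instp_eta_Inl[OF lookup_x, of 0] len by simp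
    then show ?thesis
      using variable x lookup_x by (simp add: nth_eta_sub lookup_def del: map_body_simps)
  next
    case (procedure p)
    then have "?vs' ! x = Inl x" using x by (simp add: nth_eta_sub)
    then show ?thesis
      using procedure x len nf_instp_eta_sub[OF procedure(2), of B]
      by (simp add: lookup_def rel_proc_def nf_instp_def prod_eq_iff)
  qed
qed

lemma eta_stable_exp_inst:
  assumes e: "eta_stable_exp G' e" and us: "list_all2 (stable_entry G) us G'"
  shows "eta_stable_exp G (nf_inst (length G) us e)"
  unfolding eta_stable_exp_def
proof
  fix B
  let ?d = "length G" and ?vs = "eta_sub G B" and ?vs' = "eta_sub G' {x. \<exists>y\<in>B. us ! x = Inl y}"
  have len: "length us = length G'" using us by (rule list_all2_lengthD)
  have scoped: "scoped ?d us" using us by (rule scoped_stable_entries)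
  have "nf_inst ?d ?vs (nf_inst ?d us e) = nf_inst ?d (map (inst_entry ?d ?vs) us) e"
    using nf_inst_nf_inst[of ?d ?vs us e] by simp
  also have "\<dots> = nf_inst ?d (map (inst_entry ?d us) ?vs') e"
  proof -
    have entries:
      "list_all2 (nf_eq_entry ?d) (map (inst_entry ?d ?vs) us) (map (inst_entry ?d us) ?vs')"
      using nf_eq_entry_eta_sub[OF us] by (simp add: list_all2_conv_all_nth len)
    have "scoped ?d (map (inst_entry ?d ?vs) us)"
      by (rule scoped_map_inst_entry) (simp_all add: scoped)
    moreover have "scoped ?d (map (inst_entry ?d us) ?vs')"
      by (rule scoped_map_inst_entry[OF scoped]) (simp add: len)
    ultimately show ?thesis using nf_inst_cong[OF refl _ _ entries, of 0] by simp
  qed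
  also have "\<dots> = nf_inst ?d us (nf_inst (length G') ?vs' e)"
    using nf_inst_nf_inst[OF scoped, of ?vs' e] len by simp
  also have "nf_inst (length G') ?vs' e = e" using e by (simp add: eta_stable_exp_def)
  finally show "nf_inst ?d ?vs (nf_inst ?d us e) = nf_inst ?d us e" .
qed

lemma eta_stable_weaken:
  assumes "eta_stable G q"
  shows "eta_stable (G @ H) (weaken (length G) (length H) q)"
proof -
  let ?d = "length G" and ?h = "length H" and ?n = "length (fst q)"
  let ?us = "id_sub ?d @ map Inl [?d + ?h..<?d + ?h + ?n]"
  have "list_all2 (stable_entry (G @ H @ fst q)) ?us (G @ fst q)"
    by (rule list_all2_appendI) (auto simp: list_all2_conv_all_nth nth_append)
  then have "eta_stable_exp (G @ H @ fst q) (nf_inst (length (G @ H @ fst q)) ?us (snd q))"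
    using assms by (intro eta_stable_exp_inst[of "G @ fst q"]) (simp_all add: eta_stable_def)
  also have "inst (length (G @ H @ fst q)) ?us 0 (emb (snd q)) = mshift ?d ?h (emb (snd q))"
    by (rule inst_eq_mren) (auto simp: lookup_def shift_var_def nth_append)
  finally show ?thesis by (simp add: eta_stable_def weaken_def flip: emb_nshift)
qed

lemma stable_entries_lift_sub:
  assumes "list_all2 (stable_entry G) us G'"
  shows "list_all2 (stable_entry (G @ bs)) (lift_sub (length G) (length bs) us) (G' @ bs)"
  unfolding lift_sub_def
proof (rule list_all2_appendI)
  have "stable_entry (G @ bs) (map_sum id (mshiftp (length G) (length bs)) u) s"
    if "stable_entry G u s" for u s
    using that
    by (cases rule: stable_entry_cases)
      (simp_all add: nth_append mshiftp_embp eta_stable_weaken)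
  then show "list_all2 (stable_entry (G @ bs))
      (map (map_sum id (mshiftp (length G) (length bs))) us) G'"
    using assms by (simp add: list_all2_conv_all_nth)
qed (simp add: list_all2_conv_all_nth)

lemma eta_stable_inst:
  assumes "eta_stable G' p" "list_all2 (stable_entry G) us G'"
  shows "eta_stable G (nf_instp (length G) us p)"
  using eta_stable_exp_inst[OF _ stable_entries_lift_sub[OF assms(2), of "fst p"]] assms(1)
  by (simp add: eta_stable_def nf_inst_under_lift_sub)

section \<open>Denotations are eta-stable\<close>

lemma app_eq_nf_instp:
  assumes "fst p = t # ts"
  shows "app D p q = nf_instp D (id_sub D @ [Inr (embp q)]) (ts, snd p)"
proof -
  have "msub D 1 1 D (\<lambda>_. embp q) (length ts) (emb (snd p)) =
      inst D (id_sub D @ [Inr (embp q)]) (length ts) (emb (snd p))"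
    by (rule msub_eq_inst) simp_all
  moreover have "well_sorted Expr (inst D (id_sub D @ [Inr (embp q)]) (length ts) (emb (snd p)))"
    by (rule well_sorted_inst) auto
  ultimately show ?thesis using assms by (simp add: app_def eval_eq_nf nf_instp_def)
qed

lemma Fb_unfold: "Fb ss g D = Case g ((ss, Fb ss g (D + length ss)) # etas ss D) Num"
  by (subst Fb.code) (simp add: etas_def)

lemma emb_Fb:
  "emb (Fb ss g D) =
     MCase (MVar g ((ss, emb (Fb ss g (D + length ss))) # map embp (etas ss D))) MNum"
  by (subst Fb_unfold) (simp add: embp_map_body)

lemma inst_Fb_Inl:
  assumes "lookup d us v = Inl w"
  shows "inst d us (k + length ss) (emb (Fb ss v (length us + k))) = emb (Fb ss w (d + k))"
proof -
  let ?n = "length ss"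
  let ?F = "\<lambda>k. inst d us (k + ?n) (emb (Fb ss v (length us + k)))"
  let ?G = "\<lambda>k. emb (Fb ss w (d + k))"
  let ?args = "\<lambda>T k. (ss, T) # map embp (etas ss (d + k))"
  let ?R = "\<lambda>a b. (\<exists>k. a = ?F k \<and> b = ?G k) \<or>
    (\<exists>k. a = MVar w (?args (?F (k + ?n)) k) \<and> b = MVar w (?args (?G (k + ?n)) k))"
  have F: "?F k = MCase (MVar w (?args (?F (k + ?n)) k)) MNum" for k
    using map_instp_etas[of d us k ss] assms by (subst emb_Fb) (simp add: add.assoc del: map_map)
  have G: "?G k = MCase (MVar w (?args (?G (k + ?n)) k)) MNum" for k
    by (subst emb_Fb) (simp add: add.assoc)
  show ?thesis
  proof (rule mexp_coinduct_layer[where R = ?R])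
    fix a b assume "?R a b"
    then show "mexp_layer (\<lambda>a b. ?R a b \<or> a = b) a b"
    proof (elim disjE exE conjE)
      fix k assume ab: "a = ?F k" "b = ?G k"
      show ?thesis unfolding ab F[of k] G[of k] by (rule mexp_layer.intros) blast+
    next
      fix k
      assume ab: "a = MVar w (?args (?F (k + ?n)) k)" "b = MVar w (?args (?G (k + ?n)) k)"
      have "?R (?F (k + ?n)) (?G (k + ?n))" by blast
      then show ?thesis unfolding ab
        by (intro mexp_layer.intros list.rel_intros)
          (auto simp: rel_body_def intro!: list.rel_refl_strong)
    qed
  qed blast
qed

lemma inst_Fb_Inr:
  assumes "lookup d us v = Inr p" "v < length us" "scoped d us" "D = length us"
  shows "inst d us (length ss) (emb (Fb ss v D)) = inst d [Inr p] (length ss) (emb (Fb ss 0 1))"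
proof -
  have "emb (Fb ss v D) = inst D [Inl v] (length ss) (emb (Fb ss 0 1))"
    using inst_Fb_Inl[of D "[Inl v]" 0 v 0 ss] by (simp add: lookup_def)
  then show ?thesis
    using inst_inst[OF assms(3), of "length ss" "[Inl v]" "emb (Fb ss 0 1)"] assms by simp
qed

lemma eta_stable_exp_Fb:
  assumes "g < length G" "G ! g = Arr s s"
  shows "eta_stable_exp (G @ args s) (Fb (args s) g (length G))"
  unfolding eta_stable_exp_def
proof
  fix B
  let ?ss = "args s"
  let ?nf = "\<lambda>G B. nf_inst (length (G @ ?ss)) (eta_sub (G @ ?ss) B) (Fb ?ss g (length G))"
  let ?R = "\<lambda>a b. \<exists>G B. a = ?nf G B \<and> b = Fb ?ss g (length G) \<and> g < length G \<and> G ! g = Arr s s"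
  show "?nf G B = Fb ?ss g (length G)"
  proof (rule nexp_coinduct_layer[where R = ?R])
    fix a b assume "?R a b"
    then obtain G B where ab: "a = ?nf G B" "b = Fb ?ss g (length G)"
      and g: "g < length G" "G ! g = Arr s s" by blast
    let ?H = "G @ ?ss"
    let ?qs = "(?ss, Fb ?ss g (length ?H)) # etas ?ss (length G)"
    have fst: "map fst ?qs = map args (args (?H ! g))" using g by (simp add: nth_append)
    obtain F where F: "nf_inst (length ?H) (eta_sub ?H B) (Case g ?qs Num) =
      Case g (map (\<lambda>q. (fst q, nf_inst (length (?H @ fst q)) (eta_sub (?H @ fst q) F) (snd q))) ?qs)
        (\<lambda>i. nf_inst (length ?H) (eta_sub ?H B) (Num i))"
      using nf_inst_eta_sub_Case[OF _ fst, of B Num] g by auto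
    have etas: "map (\<lambda>q. (fst q, nf_inst (length (?H @ fst q)) (eta_sub (?H @ fst q) F) (snd q)))
        (etas ?ss (length G)) = etas ?ss (length G)"
      by (rule map_nf_inst_eta_sub) (rule eta_stable_etas)
    have "?R (?nf ?H F) (Fb ?ss g (length ?H))"
      using g by (intro exI[of _ ?H] exI[of _ F]) (simp add: nth_append)
    moreover have "list_all2 (rel_body (\<lambda>a b. ?R a b \<or> a = b)) qs qs" for qs
      by (rule list.rel_refl_strong) (simp add: rel_body_def)
    moreover have "Fb ?ss g (length G) = Case g ?qs Num"
      using Fb_unfold[of ?ss g "length G"] by simp
    ultimately show "nexp_layer (\<lambda>a b. ?R a b \<or> a = b) a b"
      unfolding ab by (simp only: F list.map etas)
        (intro nexp_layer.intros list.rel_intros, simp_all add: rel_body_def)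
  qed (use assms in blast)
qed

lemmas ptyped_induct = ptyped.induct
  [consumes 1, case_names PVar PNum PSuc PPre PIfz PY PC PLam PApp]

lemmas ptyped_PVar = ptyped.intros(1)
  and ptyped_PY = ptyped.intros(6)

theorem interp_eta_stable:
  "ptyped k G M s \<Longrightarrow> fst (interp G M) = args s \<and> eta_stable G (interp G M)"
proof (induction rule: ptyped_induct)
  case (PVar x G k)
  then show ?case using eta_stable_eta[of x G] by simp
next
  case (PY s k G)
  have "eta_stable_exp ((G @ [Arr s s]) @ args s) (Fb (args s) (length G) (length (G @ [Arr s s])))"
    by (rule eta_stable_exp_Fb) simp_all
  then show ?case by (simp add: eta_stable_def)
next
  case (PLam k G s M t)
  then show ?case by (auto simp: lam1_def eta_stable_def)
next
  case (PApp k G M s t M')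
  have fst_M: "fst (interp G M) = s # args t" using PApp by simp
  have "eta_stable G (interp G M)" using PApp by blast
  then have "eta_stable (G @ [s]) (args t, snd (interp G M))"
    by (simp add: eta_stable_def fst_M)
  then have "eta_stable G (nf_instp (length G) (id_sub (length G) @ [Inr (embp (interp G M'))])
      (args t, snd (interp G M)))"
    by (rule eta_stable_inst)
      (use PApp in \<open>simp add: list_all2_appendI[OF stable_entries_id_sub]\<close>)
  then show ?case using PApp by (simp add: app_eq_nf_instp[OF fst_M])
qed (auto simp: eta_stable_def nth_append intro!: eta_stable_exp_Case_N split: option.split)

section \<open>Recursion as plugging\<close>

definition fix_sub :: "nat \<Rightarrow> ty list \<Rightarrow> nexp \<Rightarrow> nsp list \<Rightarrow> nat \<Rightarrow> nsp" where
  "fix_sub d ss e qs =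
     (\<lambda>j. if j = 0 then (ss, nshift (d + 1) (length ss) e)
          else weaken d (length ss + 1) (qs ! (j - 1)))"

definition fix_plug :: "nat \<Rightarrow> ty list \<Rightarrow> nexp \<Rightarrow> nsp list \<Rightarrow> nexp" where
  "fix_plug d ss e qs =
     nunshift d (length ss + 1)
       (eval (d + length ss + 1) (plug d (length ss + 1) e (fix_sub d ss e qs)))"

locale fixpoint_unfolding =
  fixes G ss :: "ty list" and e :: nexp and qs :: "nsp list"
  assumes eta_stable_e: "eta_stable G (arrs ss # ss, e)"
    and fst_qs: "map fst qs = map args ss"
    and eta_stable_qs: "\<And>q. q \<in> set qs \<Longrightarrow> eta_stable G q"
begin

abbreviation d :: nat where
  "d \<equiv> length G"

abbreviation n :: nat where
  "n \<equiv> length ss"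

definition r :: nat where
  "r = n + 1"

abbreviation \<delta> :: nat where
  "\<delta> \<equiv> d + r"

lemma length_qs: "length qs = n"
  using fst_qs map_eq_imp_length_eq by metis

text \<open>The functional \<open>\<lambda>z x. e\<close> and the fixed point \<open>F\<close> of it that interprets \<open>Y\<close>, both at depth
  \<open>\<Delta>\<close>.\<close>
definition functional :: "nat \<Rightarrow> mproc" where
  "functional \<Delta> = mshiftp d (\<Delta> - d) (embp (arrs ss # ss, e))"

definition Y_body :: "nat \<Rightarrow> mexp" where
  "Y_body \<Delta> = inst \<Delta> [Inr (functional \<Delta>)] n (emb (Fb ss 0 1))"

lemma functional_eq: "functional \<Delta> = (arrs ss # ss, mshift d (\<Delta> - d) (emb e))"
  by (simp add: functional_def mshiftp_map_body embp_def)

lemma mshiftp_functional: "d \<le> \<Delta> \<Longrightarrow> mshiftp \<Delta> m (functional \<Delta>) = functional (\<Delta> + m)"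
  using mshift_mshift_inner[of d "\<Delta> - d" m "emb e"]
  by (simp add: functional_eq mshiftp_map_body add.commute)

lemma Y_body_unfold:
  assumes "d \<le> \<Delta>"
  shows "Y_body \<Delta> =
    MCase (MApp (functional (\<Delta> + n)) ((ss, Y_body (\<Delta> + n)) # map embp (etas ss \<Delta>))) MNum"
proof -
  let ?us = "[Inr (functional \<Delta>)]"
  have "inst \<Delta> ?us (n + n) (emb (Fb ss 0 (1 + n))) =
      inst (\<Delta> + n) (lift_sub \<Delta> n ?us) n (emb (Fb ss 0 (1 + n)))"
    by (rule inst_lift_sub)
  also have "\<dots> = Y_body (\<Delta> + n)"
  proof -
    have "lookup (\<Delta> + n) (lift_sub \<Delta> n ?us) 0 = Inr (functional (\<Delta> + n))"
      unfolding lookup_lift_sub by (simp add: lookup_def mshiftp_functional[OF assms])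
    then show ?thesis
      unfolding Y_body_def using scoped_lift_sub[of \<Delta> ?us n] by (intro inst_Fb_Inr) simp_all
  qed
  finally show ?thesis
    unfolding Y_body_def[of \<Delta>]
    using map_instp_etas[of \<Delta> ?us 0 ss] mshiftp_functional[OF assms]
    by (subst emb_Fb) (simp add: lookup_def del: map_map)
qed

lemma beta_functional:
  assumes "d \<le> \<Delta>"
  shows "beta \<Delta> Qs (snd (functional \<Delta>)) = inst \<Delta> (id_sub d @ map Inr Qs) 0 (emb e)"
proof -
  have "id_sub \<Delta> = id_sub d @ map Inl [d..<\<Delta>]" using id_sub_add[of d "\<Delta> - d"] assms by simp
  then show ?thesis
    using inst_weaken_mid[of \<Delta> "id_sub d" "map Inl [d..<\<Delta>]" "map Inr Qs" 0 "emb e"] assms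
    by (simp add: functional_eq)
qed

definition eta_body :: mexp where
  "eta_body = inst (d + 1 + n) (id_sub (d + 1) @ procs (etas ss (d + 1))) 0 (emb e)"

lemma nf_eta_body: "nf (d + 1 + n) eta_body = e"
proof -
  have "eta_stable (G @ [arrs ss]) (ss, e)" using eta_stable_e by (simp add: eta_stable_def)
  from eta_nf_embp[OF this] show ?thesis by (simp add: eta_nf_def eta_body_def)
qed

lemma head_expansion_Y_body:
  assumes "d \<le> \<Delta>"
  shows "head_expansion (\<Delta> + n) (Y_body \<Delta>)
    (inst (\<Delta> + n) (id_sub d @ Inr (ss, Y_body (\<Delta> + n)) # map Inl [\<Delta>..<\<Delta> + n]) 0 eta_body)"
proof -
  let ?Qs = "(ss, Y_body (\<Delta> + n)) # map embp (etas ss \<Delta>)"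
  let ?vs = "id_sub d @ Inr (ss, Y_body (\<Delta> + n)) # map Inl [\<Delta>..<\<Delta> + n]"
  have "head_expansion (\<Delta> + n) (Y_body \<Delta>) (beta (\<Delta> + n) ?Qs (snd (functional (\<Delta> + n))))"
    unfolding Y_body_unfold[OF assms] functional_eq snd_conv
    by (rule head_expansion_beta) simp
  also have "beta (\<Delta> + n) ?Qs (snd (functional (\<Delta> + n))) =
      inst (\<Delta> + n) (id_sub d @ map Inr ?Qs) 0 (emb e)"
    by (rule beta_functional) (use assms in auto)
  also have "\<dots> = inst (\<Delta> + n) ?vs 0 eta_body"
  proof -
    have scoped: "scoped (\<Delta> + n) ?vs" using assms by auto
    have "map (inst_entry (\<Delta> + n) ?vs) (id_sub (d + 1)) = id_sub d @ [Inr (ss, Y_body (\<Delta> + n))]"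
      by (rule nth_equalityI) (auto simp: lookup_def nth_append less_Suc_eq)
    moreover have "map (inst_entry (\<Delta> + n) ?vs) (procs (etas ss (d + 1))) = procs (etas ss \<Delta>)"
    proof (rule nth_equalityI)
      fix j assume "j < length (map (inst_entry (\<Delta> + n) ?vs) (procs (etas ss (d + 1))))"
      then have j: "j < n" by simp
      then have "lookup (\<Delta> + n) ?vs (d + 1 + j) = Inl (\<Delta> + j)"
        by (simp add: lookup_def nth_append)
      from instp_eta_Inl[OF this, of 0 "ss ! j"] j
      show "map (inst_entry (\<Delta> + n) ?vs) (procs (etas ss (d + 1))) ! j = procs (etas ss \<Delta>) ! j"
        by (simp del: map_body_simps)
    qed simp
    ultimately show ?thesis
      using inst_inst[OF scoped, of 0 "id_sub (d + 1) @ procs (etas ss (d + 1))" "emb e"]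
      by (simp add: eta_body_def del: upt_Suc)
  qed
  finally show ?thesis .
qed

abbreviation xi :: "nat \<Rightarrow> nsp" where
  "xi \<equiv> fix_sub d ss e qs"

lemma xi_simps:
  "xi 0 = (ss, nshift (d + 1) n e)"
  "xi (Suc j) = weaken d r (qs ! j)"
  by (simp_all add: fix_sub_def r_def)

text \<open>The body of \<open>W = \<lambda>x. e[z := W]\<close>, the procedure that plugging substitutes for \<open>z\<close>, at the
  initial depth \<open>\<delta>\<close> and at an arbitrary one.\<close>
definition W_base :: mexp where
  "W_base = plugged d r xi n (emb (nshift (d + 1) n e))"

definition W :: "nat \<Rightarrow> mexp" where
  "W \<Delta> = mshift \<delta> (\<Delta> - \<delta>) W_base"

definition shifted_qs :: "nsp list" where
  "shifted_qs = map (weaken d r) qs"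

lemma length_shifted_qs: "length shifted_qs = n"
  by (simp add: shifted_qs_def length_qs)

lemma plug_sub_eq: "plug_sub d r xi = id_sub d @ Inr (ss, W_base) # procs shifted_qs"
proof -
  let ?f = "\<lambda>j. Inr (pluggedp d r xi 0 (embp (xi j))) :: entry"
  have U: "plug_sub d r xi = id_sub d @ ?f 0 # map (\<lambda>j. ?f (Suc j)) [0..<n]"
    unfolding plug_sub_def r_def
    by (simp add: upt_conv_Cons map_Suc_upt[symmetric] comp_def del: upt_Suc)
  have plugged_weaken: "plugged d r xi m (mshift d r T) = mshift d r T" for m T
  proof -
    let ?vs = "?f 0 # map (\<lambda>j. ?f (Suc j)) [0..<n]"
    have "plugged d r xi m (mshift d r T) = inst \<delta> (id_sub d @ ?vs) m (mshift d r T)"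
      by (subst plugged_eq_inst) (simp only: U)
    also have "\<dots> = inst \<delta> (id_sub d) m T"
      using inst_weaken[of \<delta> "id_sub d" ?vs m T] by (simp add: r_def)
    finally show ?thesis by (simp only: inst_id_sub_mshift)
  qed
  have "?f 0 = Inr (ss, W_base)" by (simp add: W_base_def xi_simps embp_def)
  moreover have "map (\<lambda>j. ?f (Suc j)) [0..<n] = procs shifted_qs"
  proof (rule nth_equalityI)
    fix j assume "j < length (map (\<lambda>j. ?f (Suc j)) [0..<n])"
    then show "map (\<lambda>j. ?f (Suc j)) [0..<n] ! j = procs shifted_qs ! j"
      using length_qs plugged_weaken
      by (simp add: xi_simps shifted_qs_def weaken_def embp_def emb_nshift)
  qed (simp add: length_shifted_qs)
  ultimately show ?thesis unfolding U by simp
qed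

lemma W_base_unfold:
  "W_base =
     inst (\<delta> + n) (id_sub d @ Inr (ss, mshift \<delta> n W_base) # map Inl [\<delta>..<\<delta> + n]) 0 (emb e)"
proof -
  let ?us = "id_sub d @ Inr (ss, W_base) # procs shifted_qs"
  let ?ws = "id_sub d @ [Inr (ss, mshift \<delta> n W_base)]"
  let ?Qs = "map (\<lambda>q. Inr (mshiftp \<delta> n (embp q))) shifted_qs"
  have "W_base = inst \<delta> ?us n (mshift (d + 1) n (emb e))"
    by (subst W_base_def) (simp only: plugged_eq_inst plug_sub_eq emb_nshift)
  also have "\<dots> = inst (\<delta> + n) (?ws @ ?Qs @ map Inl [\<delta>..<\<delta> + n]) 0 (mshift (d + 1) n (emb e))"
    unfolding inst_eq_inst_lift_sub[of \<delta> ?us n] lift_sub_def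
    by (simp add: comp_def mshiftp_map_body)
  also have "\<dots> = inst (\<delta> + n) (?ws @ map Inl [\<delta>..<\<delta> + n]) 0 (emb e)"
    using inst_weaken_mid[of "\<delta> + n" ?ws ?Qs "map Inl [\<delta>..<\<delta> + n]" 0 "emb e"]
    by (simp add: length_shifted_qs)
  finally show ?thesis by simp
qed

lemma W_unfold:
  assumes "\<delta> \<le> \<Delta>"
  shows "W \<Delta> = inst (\<Delta> + n) (id_sub d @ Inr (ss, W (\<Delta> + n)) # map Inl [\<Delta>..<\<Delta> + n]) 0 (emb e)"
proof -
  let ?us = "lift_sub \<Delta> n (id_sub \<delta>)"
  let ?vs = "id_sub d @ Inr (ss, mshift \<delta> n W_base) # map Inl [\<delta>..<\<delta> + n]"
  have inst_us: "inst (\<Delta> + n) ?us m T = mshift \<delta> (\<Delta> - \<delta>) T" for m T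
    using inst_lift_sub[of \<Delta> "id_sub \<delta>" n m T] inst_id_sub_mshift[of \<delta> "\<Delta> - \<delta>" "n + m" T] assms
    by simp
  have scoped: "scoped (\<Delta> + n) ?us" using assms by (intro scoped_lift_sub) auto
  have us: "?us = id_sub \<delta> @ map Inl [\<Delta>..<\<Delta> + n]" by (simp add: lift_sub_def)
  have "W \<Delta> = inst (\<Delta> + n) ?us 0 (inst (\<delta> + n) ?vs 0 (emb e))"
    unfolding inst_us W_def using W_base_unfold by simp
  also have "\<dots> = inst (\<Delta> + n) (map (inst_entry (\<Delta> + n) ?us) ?vs) 0 (emb e)"
    using inst_inst[OF scoped, of 0 ?vs "emb e"] by simp
  also have "map (inst_entry (\<Delta> + n) ?us) ?vs =
      id_sub d @ Inr (ss, W (\<Delta> + n)) # map Inl [\<Delta>..<\<Delta> + n]"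
  proof -
    have "map (inst_entry (\<Delta> + n) ?us) (id_sub d) = id_sub d"
      unfolding us by (rule nth_equalityI) (auto simp: lookup_def nth_append)
    moreover have "inst_entry (\<Delta> + n) ?us (Inr (ss, mshift \<delta> n W_base)) = Inr (ss, W (\<Delta> + n))"
      using assms by (simp add: inst_us mshift_mshift W_def)
    moreover have
      "map (inst_entry (\<Delta> + n) ?us) (map Inl [\<delta>..<\<delta> + n]) = map Inl [\<Delta>..<\<Delta> + n]"
      unfolding us by (rule nth_equalityI) (auto simp: lookup_def nth_append)
    ultimately show ?thesis by simp
  qed
  finally show ?thesis .
qed

lemma sim_Y_body_W: "\<delta> \<le> \<Delta> \<Longrightarrow> sim (\<Delta> + n) (Y_body \<Delta>) (W \<Delta>)"
proof -
  let ?X = "\<lambda>D T T'. \<exists>\<Delta>\<ge>\<delta>. D = \<Delta> + n \<and> T = Y_body \<Delta> \<and> T' = W \<Delta>"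
  let ?Y = "\<lambda>D T T'. ?X D T T' \<or> sim D T T'"
  assume "\<delta> \<le> \<Delta>"
  then show ?thesis
  proof (intro sim_coinduct_layer[where X = ?X])
    fix D T T' assume "?X D T T'"
    then obtain \<Delta> where \<Delta>: "\<delta> \<le> \<Delta>" and eq: "D = \<Delta> + n" "T = Y_body \<Delta>" "T' = W \<Delta>" by blast
    let ?us = "\<lambda>T. id_sub d @ Inr (ss, T) # map Inl [\<Delta>..<\<Delta> + n] :: entry list"
    have "?Y (\<Delta> + n + n) (Y_body (\<Delta> + n)) (W (\<Delta> + n))"
      using \<Delta> by (intro disjI1 exI[of _ "\<Delta> + n"]) simp
    then have "list_all2 (rel_entry ?Y (\<Delta> + n)) (?us (Y_body (\<Delta> + n))) (?us (W (\<Delta> + n)))"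
      by (intro list_all2_appendI list.rel_intros)
        (simp_all add: list_all2_conv_all_nth rel_proc_def)
    moreover have "head_expansion (\<Delta> + n) (W \<Delta>) (inst (\<Delta> + n) (?us (W (\<Delta> + n))) 0 (emb e))"
      using W_unfold[OF \<Delta>] by (simp add: head_expansion_refl)
    moreover have
      "head_expansion (\<Delta> + n) (Y_body \<Delta>) (inst (\<Delta> + n) (?us (Y_body (\<Delta> + n))) 0 eta_body)"
      using \<Delta> by (intro head_expansion_Y_body) simp
    moreover have "nf (length (?us U)) eta_body = nf (length (?us U)) (emb e)" for U
      using nf_eta_body by simp
    moreover have "scoped (\<Delta> + n) (?us U)" for U using \<Delta> by auto
    ultimately show "sim_layer ?Y D T T'" unfolding eq by (intro sim_layer_sub)
  qed blast
qed

context
  fixes us :: "entry list"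
  assumes scoped_us: "scoped d us"
begin

abbreviation (input) unfold_sub :: "entry list" where
  "unfold_sub \<equiv> us @ Inr (embp (arrs ss # ss, e)) # procs qs"

abbreviation (input) shifted_sub :: "entry list" where
  "shifted_sub \<equiv>
     map (map_sum id (mshiftp d r)) us @ Inr (functional \<delta>) # procs shifted_qs"

abbreviation (input) arguments :: "mproc list" where
  "arguments \<equiv>
     (ss, Y_body \<delta>) # map (instp \<delta> shifted_sub 0) (map embp (etas ss (length us + 1)))"

lemma map_inst_entry_unfold_sub: "map (inst_entry \<delta> (id_sub d)) unfold_sub = shifted_sub"
  using map_inst_entry_id_sub_shift[of d unfold_sub r] scoped_us
  by (simp add: functional_def shifted_qs_def mshiftp_embp comp_def)

lemma inst_Fb_shifted_sub:
  "inst \<delta> shifted_sub 0 (emb (Fb ss (length us) (length us + 1))) =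
     MCase (MApp (functional \<delta>) arguments) MNum"
proof -
  have "scoped \<delta> (map (inst_entry \<delta> (id_sub d)) unfold_sub)"
    using scoped_us by (intro scoped_map_inst_entry) auto
  then have scoped: "scoped \<delta> shifted_sub" unfolding map_inst_entry_unfold_sub .
  have lookup: "lookup \<delta> shifted_sub (length us) = Inr (functional \<delta>)"
    by (simp add: lookup_def nth_append)
  have "inst \<delta> shifted_sub n (emb (Fb ss (length us) (length us + 1 + n))) = Y_body \<delta>"
    unfolding Y_body_def
    by (rule inst_Fb_Inr[OF lookup _ scoped]) (simp_all add: length_shifted_qs)
  then show ?thesis by (subst emb_Fb) (simp add: lookup)
qed

lemma arguments_nf_eq_plug_sub:
  "list_all2 (nf_eq_entry \<delta>) (id_sub d @ map Inr arguments) (plug_sub d r xi)"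
proof -
  have "nf_eq_entry \<delta> (Inr (ss, Y_body \<delta>)) (Inr (ss, W_base))"
    using sim_imp_nf_eq[OF sim_Y_body_W[of \<delta>]] by (simp add: rel_proc_def W_def)
  moreover have "nf_eq_entry \<delta> (Inr (instp \<delta> shifted_sub 0 (embp (etas ss (length us + 1) ! j))))
      (Inr (embp (shifted_qs ! j)))" if j: "j < n" for j
  proof -
    let ?H = "G @ arrs ss # ss"
    have len: "length ?H = \<delta>" by (simp add: r_def)
    have q: "shifted_qs ! j = weaken d r (qs ! j)" using j length_qs by (simp add: shifted_qs_def)
    have "fst (qs ! j) = args (ss ! j)" using fst_qs j length_qs by (metis nth_map)
    moreover have "eta_stable ?H (weaken d (length (arrs ss # ss)) (qs ! j))"
      using eta_stable_qs j length_qs by (intro eta_stable_weaken) simp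
    moreover have "lookup \<delta> shifted_sub (length us + 1 + j) = Inr (embp (shifted_qs ! j))"
      using j by (simp add: lookup_def nth_append length_shifted_qs)
    ultimately have
      "nf_instp \<delta> shifted_sub (eta (ss ! j) (length us + 1 + j) (length us + 1 + n)) =
        shifted_qs ! j"
      using nf_instp_eta_stable[of ?H shifted_sub "length us + 1 + j" "shifted_qs ! j" "ss ! j"]
      unfolding len q by (simp add: r_def length_shifted_qs)
    then show ?thesis using j by (auto simp: rel_proc_def nf_instp_def prod_eq_iff)
  qed
  ultimately show ?thesis
    unfolding plug_sub_eq list.map
    by (intro list_all2_appendI list.rel_intros)
      (simp_all add: list_all2_conv_all_nth length_shifted_qs del: map_body_simps)
qed

theorem nf_inst_Fb_eq_fix_plug:
  "nf_inst d unfold_sub (Fb ss (length us) (length us + 1)) = fix_plug d ss e qs"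
proof -
  let ?F = "emb (Fb ss (length us) (length us + 1))"
  have "nshift d r (nf d (inst d unfold_sub 0 ?F)) = nf \<delta> (mshift d r (inst d unfold_sub 0 ?F))"
    using nf_mshift[of d r 0] by simp
  also have "mshift d r (inst d unfold_sub 0 ?F) = inst \<delta> shifted_sub 0 ?F"
    using inst_inst[of \<delta> "id_sub d" 0 unfold_sub ?F]
    unfolding map_inst_entry_unfold_sub by (simp add: inst_id_sub_mshift)
  also have "\<dots> = MCase (MApp (functional \<delta>) arguments) MNum"
    by (rule inst_Fb_shifted_sub)
  also have "nf \<delta> \<dots> = nf \<delta> (beta \<delta> arguments (snd (functional \<delta>)))"
    unfolding functional_eq nf_MCase_MNum snd_conv by (rule nf_MApp) simp
  also have "\<dots> = nf_inst \<delta> (id_sub d @ map Inr arguments) e"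
    by (subst beta_functional) simp_all
  also have "\<dots> = nf_inst \<delta> (plug_sub d r xi) e"
    using nf_inst_cong[OF refl _ _ arguments_nf_eq_plug_sub, of 0 "emb e"]
    by (simp add: plug_sub_eq)
  also have "\<dots> = eval \<delta> (plug d r e xi)"
    using eval_eq_nf[OF well_sorted_plugged[OF well_sorted_emb], of \<delta> d r xi 0 e]
    by (simp only: plug_eq_plugged plugged_eq_inst)
  finally have "nf_inst d unfold_sub (Fb ss (length us) (length us + 1)) =
      nunshift d r (eval \<delta> (plug d r e xi))"
    by (metis nunshift_nshift)
  then show ?thesis by (simp add: fix_plug_def r_def add.assoc)
qed

end

end

section \<open>Generated procedures are denotable\<close>

lemma args_foldr_Arr [simp]: "args (foldr Arr ss t) = ss @ args t"
  by (induction ss) auto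

lemma args_arrs [simp]: "args (arrs ss) = ss"
  by (simp add: arrs_def)

lemma arrs_args [simp]: "arrs (args s) = s"
  by (induction s) (auto simp: arrs_def)

lemma foldr_Arr_args: "foldr Arr (args s) N = s"
  using arrs_args[of s] by (simp only: arrs_def)

lemma ptyped_apps:
  "list_all2 (ptyped k G) Ms ss \<Longrightarrow> ptyped k G M (foldr Arr ss t) \<Longrightarrow> ptyped k G (foldl PApp M Ms) t"
  by (induction arbitrary: M rule: list_all2_induct) (auto intro: ptyped.intros)

lemma ptyped_lams: "ptyped k (G @ ss) M t \<Longrightarrow> ptyped k G (foldr PLam ss M) (foldr Arr ss t)"
  by (induction ss arbitrary: G) (auto intro!: ptyped.intros)

lemma interp_lams:
  "interp G (foldr PLam ss M) = (ss @ fst (interp (G @ ss) M), snd (interp (G @ ss) M))"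
  by (induction ss arbitrary: G) (auto simp: lam1_def)

lemma nf_inst_under_nf_inst_under:
  assumes "length us = d'" "length vs = n" "scoped d (us @ vs)" "scoped d' ws"
  shows "nf_inst_under d (us @ vs) m (nf_inst_under d' ws (n + m) x) =
    nf_inst_under d (map (inst_entry d us) ws @ vs) m x"
proof -
  have "nf_inst_under d (us @ vs) m (nf_inst_under d' ws (n + m) x) =
      nf (d + m) (inst d (us @ vs) m (inst d' ws (n + m) (emb x)))"
    by (rule nf_inst_emb_nf) (use assms in simp_all)
  then show ?thesis using inst_inst_under[OF assms, of m "emb x"] by simp
qed

lemma interp_apps:
  "fst (interp G M) = bs @ cs \<Longrightarrow> length Ms = length bs \<Longrightarrow> interp G (foldl PApp M Ms) =
     nf_instp (length G) (id_sub (length G) @ procs (map (interp G) Ms)) (cs, snd (interp G M))"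
proof (induction Ms arbitrary: M bs)
  case Nil
  then show ?case by (simp add: prod_eq_iff)
next
  case (Cons P Ms)
  let ?d = "length G" and ?m = "length cs" and ?e = "snd (interp G M)"
  let ?P = "[Inr (embp (interp G P))]" and ?Ms = "procs (map (interp G) Ms)"
  obtain b bs' where bs: "bs = b # bs'" and len: "length Ms = length bs'"
    using Cons.prems by (cases bs) auto
  have PApp: "interp G (PApp M P) = nf_instp ?d (id_sub ?d @ ?P) (bs' @ cs, ?e)"
    using Cons.prems bs by (simp add: app_eq_nf_instp)
  have "fst (interp G (PApp M P)) = bs' @ cs" unfolding PApp by simp
  then have "interp G (foldl PApp (PApp M P) Ms) =
      nf_instp ?d (id_sub ?d @ ?Ms) (cs, snd (interp G (PApp M P)))"
    using len by (rule Cons.IH)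
  also have "nf_inst_under ?d (id_sub ?d @ ?Ms) ?m (snd (interp G (PApp M P))) =
      nf_inst_under ?d (map (inst_entry ?d (id_sub ?d)) (id_sub ?d @ ?P) @ ?Ms) ?m ?e"
    unfolding PApp nf_instp_simps fst_conv snd_conv length_append
    by (rule nf_inst_under_nf_inst_under) (simp_all add: len)
  then have "nf_instp ?d (id_sub ?d @ ?Ms) (cs, snd (interp G (PApp M P))) =
      nf_instp ?d (id_sub ?d @ procs (map (interp G) (P # Ms))) (cs, ?e)"
    using map_inst_entry_id_sub_ident[of ?d "id_sub ?d @ ?P"]
    by (simp add: nf_instp_def del: map_append)
  finally show ?case by (simp add: comp_def)
qed

lemma eta_stable_list:
  assumes "list_all2 (\<lambda>s q. fst q = args s \<and> eta_stable G q) ss qs"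
  shows "map fst qs = map args ss" "q \<in> set qs \<Longrightarrow> eta_stable G q"
  using assms by (induction rule: list_all2_induct) auto

lemma denotable_eta_stable: "denotable k G s p \<Longrightarrow> fst p = args s \<and> eta_stable G p"
  unfolding denotable_def using interp_eta_stable by blast

lemma denotable_list:
  assumes "list_all2 (denotable k G) ss qs"
  shows "map fst qs = map args ss" "q \<in> set qs \<Longrightarrow> eta_stable G q"
proof -
  have "list_all2 (\<lambda>s q. fst q = args s \<and> eta_stable G q) ss qs"
    using assms by (rule list_all2_mono) (rule denotable_eta_stable)
  note eta_stable_list[OF this]
  then show "map fst qs = map args ss" "q \<in> set qs \<Longrightarrow> eta_stable G q" by blast+
qed

lemma denotable_terms:
  "list_all2 (denotable k G) ss qs
   \<Longrightarrow> \<exists>Ms. list_all2 (ptyped k G) Ms ss \<and> map (interp G) Ms = qs"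
proof (induction rule: list_all2_induct)
  case (Cons s ss q qs)
  then obtain M Ms where "ptyped k G M s" "interp G M = q"
    "list_all2 (ptyped k G) Ms ss" "map (interp G) Ms = qs"
    by (auto simp: denotable_def)
  then show ?case by (intro exI[of _ "M # Ms"]) simp
qed simp

lemma denotable_apps:
  assumes p: "denotable k G (foldr Arr ts t) p" and qs: "list_all2 (denotable k G) ts qs"
  shows "denotable k G t (nf_instp (length G) (id_sub (length G) @ procs qs) (args t, snd p))"
proof -
  obtain M where M: "ptyped k G M (foldr Arr ts t)" "interp G M = p"
    using p by (auto simp: denotable_def)
  obtain Ms where Ms: "list_all2 (ptyped k G) Ms ts" "map (interp G) Ms = qs"
    using denotable_terms[OF qs] by blast
  have "fst (interp G M) = ts @ args t" using denotable_eta_stable[OF p] M(2) by simp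
  from interp_apps[OF this, of Ms] list_all2_lengthD[OF Ms(1)]
  have "interp G (foldl PApp M Ms) =
      nf_instp (length G) (id_sub (length G) @ procs qs) (args t, snd p)"
    unfolding Ms(2) M(2) by simp
  then show ?thesis using ptyped_apps[OF Ms(1) M(1)] unfolding denotable_def by blast
qed

lemma nf_inst_under_ground:
  assumes "lookup d us x = Inr (embp q)" "fst q = []"
  shows "nf_inst_under d us n (Case x [] es) =
    nrepl (\<lambda>i. nf_inst_under d us n (es i)) (nshift d n (snd q))"
proof -
  have "mshiftp d n (embp q) = ([], mshift d n (emb (snd q)))"
    using assms(2) by (simp add: mshiftp_map_body map_body_def)
  then show ?thesis
    using assms nf_mshift[of d n 0 "emb (snd q)"] nf_MApp[of "[]" "[]" "d + n"]
    by (simp add: nf_MCase)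
qed

lemma nf_inst_ground:
  assumes "lookup d us x = Inr (embp q)" "fst q = []"
  shows "nf_inst d us (Case x [] es) = nrepl (\<lambda>i. nf_inst d us (es i)) (snd q)"
  using nf_inst_under_ground[OF assms, of 0 es] by simp

lemma nf_inst_under_ground_var:
  assumes "lookup d us x = Inr (embp q)" "fst q = []"
  shows "nf_inst_under d us n (Case x [] Num) = nshift d n (snd q)"
  using nf_inst_under_ground[OF assms, of n Num] by simp

lemma nf_inst_ifzero:
  assumes "lookup d us D = Inr (embp q)" "fst q = []"
    and "lookup d us (D + 1) = Inr (embp a)" "fst a = []"
    and "lookup d us (D + 2) = Inr (embp b)" "fst b = []"
  shows "nf_inst d us
      (Case D [] (\<lambda>i. if i = 0 then Case (D + 1) [] Num else Case (D + 2) [] Num)) =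
    nrepl (\<lambda>i. if i = 0 then snd a else snd b) (snd q)"
proof -
  have "nf_inst d us (if i = 0 then Case (D + 1) [] Num else Case (D + 2) [] Num) =
      (if i = 0 then snd a else snd b)" for i :: nat
    using nf_inst_under_ground_var[OF assms(3,4), of 0]
      nf_inst_under_ground_var[OF assms(5,6), of 0]
    by (simp del: emb_simps)
  then show ?thesis unfolding nf_inst_ground[OF assms(1,2)] by simp
qed

lemma fnum_Some [simp]: "fnum (\<lambda>i. Some (g i)) = (\<lambda>i. Num (g i))"
  by (simp add: fnum_def fun_eq_iff)

lemma nf_inst_under_fnum [simp]: "nf_inst_under d us n (fnum f i) = fnum f i"
  by (simp add: fnum_def split: option.split)

lemma nshift_fnum [simp]: "nshift d n (fnum f i) = fnum f i"
  by (simp add: fnum_def nshift_def split: option.split)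

lemma interp_PC_app:
  assumes "interp G X = ([], x)"
  shows "interp G (PApp (PC f) X) = ([], nrepl (fnum f) x)"
proof -
  let ?D = "length G" and ?us = "id_sub (length G) @ [Inr (embp ([], x))]"
  have "interp G (PApp (PC f) X) = ([], nf_inst ?D ?us (Case ?D [] (fnum f)))"
    using assms by (simp add: app_eq_nf_instp nf_instp_def fnum_def[abs_def])
  also have "nf_inst ?D ?us (Case ?D [] (fnum f)) = nrepl (fnum f) x"
    using nf_inst_ground[of ?D ?us ?D "([], x)" "fnum f"]
    by (simp add: lookup_def nth_append nf_inst_under_fnum[where n = 0, unfolded add_0_right])
  finally show ?thesis .
qed

lemma interp_PIfz_app:
  assumes "interp G X = ([], x)" "interp G A = ([], a)" "interp G B = ([], b)"
  shows "interp G (foldl PApp PIfz [X, A, B]) = ([], nrepl (\<lambda>i. if i = 0 then a else b) x)"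
proof -
  let ?us = "id_sub (length G) @ procs [([], x), ([], a), ([], b)]"
  have "fst (interp G PIfz) = [N, N, N] @ []" by simp
  from interp_apps[OF this, of "[X, A, B]"] assms
  have "interp G (foldl PApp PIfz [X, A, B]) = ([], nf_inst (length G) ?us (snd (interp G PIfz)))"
    by (simp add: nf_instp_def del: foldl_Cons)
  also have "nf_inst (length G) ?us (snd (interp G PIfz)) = nrepl (\<lambda>i. if i = 0 then a else b) x"
    using nf_inst_ifzero[of "length G" ?us "length G" "([], x)" "([], a)" "([], b)"]
    by (simp add: lookup_def nth_append del: emb_simps cong: if_cong)
  finally show ?thesis .
qed

definition eta_app :: "ty list \<Rightarrow> nat \<Rightarrow> pcf" where
  "eta_app G v = foldl PApp (PVar v) (map PVar [length G..<length G + length (args (G ! v))])"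

lemma ptyped_eta_app:
  assumes "v < length G"
  shows "ptyped k (G @ args (G ! v)) (eta_app G v) N"
  unfolding eta_app_def
proof (rule ptyped_apps)
  let ?G = "G @ args (G ! v)"
  show "ptyped k ?G (PVar v) (foldr Arr (args (G ! v)) N)"
    using ptyped_PVar[of v ?G k] assms by (simp add: foldr_Arr_args nth_append)
  have "ptyped k ?G (PVar (length G + j)) (args (G ! v) ! j)" if "j < length (args (G ! v))" for j
    using ptyped_PVar[of "length G + j" ?G k] that by simp
  then show "list_all2 (ptyped k ?G)
      (map PVar [length G..<length G + length (args (G ! v))]) (args (G ! v))"
    by (auto simp: list_all2_conv_all_nth)
qed

lemma interp_eta_app:
  assumes "v < length G"
  shows "interp (G @ args (G ! v)) (eta_app G v) = ([], snd (eta (G ! v) v (length G)))"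
proof -
  let ?s = "G ! v" and ?n = "length (args (G ! v))" and ?G = "G @ args (G ! v)"
  let ?etas = "etas (args ?s) (length G)"
  have etas: "map (interp ?G) (map PVar [length G..<length G + ?n]) = ?etas"
    by (rule nth_equalityI) simp_all
  have "interp ?G (eta_app G v) =
      ([], nf_inst (length ?G) (id_sub (length ?G) @ procs ?etas) (snd (eta ?s v (length ?G))))"
    using interp_apps[of ?G "PVar v" "args ?s" "[]" "map PVar [length G..<length G + ?n]"] assms
    unfolding etas eta_app_def by (simp add: nf_instp_def nth_append)
  also have "nf_inst (length ?G) (id_sub (length ?G) @ procs ?etas) (snd (eta ?s v (length ?G))) =
      Case v ?etas Num"
    by (rule nf_inst_eta_saturated_stable)
      (use assms in \<open>simp_all add: lookup_id_sub eta_stable_etas\<close>)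
  also have "\<dots> = snd (eta ?s v (length G))" by (simp add: eta_eq_Case)
  finally show ?thesis .
qed

lemma nf_inst_under_nrepl:
  assumes "scoped d us" "D = length us + n"
  shows "nf_inst_under d us n (nrepl g x) =
    nrepl (\<lambda>i. nf_inst_under d us n (g i)) (nf_inst_under d us n x)"
proof -
  have "nrepl g x = nf D (MCase (emb x) (\<lambda>i. emb (g i)))" by (simp add: nf_MCase)
  then have "nf_inst_under d us n (nrepl g x) =
      nf (d + n) (inst d us n (MCase (emb x) (\<lambda>i. emb (g i))))"
    using nf_inst_emb_nf[OF assms] by simp
  then show ?thesis by (simp add: nf_MCase)
qed

lemma denotable_rule1:
  assumes "x < length G" "G ! x = arrs ss" "list_all2 (denotable k G) ss qs"
  shows "denotable k G N ([], Case x qs Num)"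
proof -
  have "denotable k G (foldr Arr ss N) (eta (arrs ss) x (length G))"
    using ptyped_PVar[OF assms(1), of k] assms(2) unfolding denotable_def
    by (intro exI[of _ "PVar x"]) (simp add: arrs_def)
  from denotable_apps[OF this assms(3)]
  have "denotable k G N ([], nf_inst (length G) (id_sub (length G) @ procs qs)
      (snd (eta (arrs ss) x (length G))))"
    by (simp add: nf_instp_def)
  also have "nf_inst (length G) (id_sub (length G) @ procs qs)
      (snd (eta (arrs ss) x (length G))) = Case x qs Num"
    by (rule nf_inst_eta_saturated_stable)
      (use assms(1) denotable_list[OF assms(3)] in \<open>auto simp: lookup_id_sub\<close>)
  finally show ?thesis .
qed

text \<open>The program behind rules 4 and 5 is \<open>\<lambda>z y x. F (z x)\<close> applied to \<open>p\<close> and \<open>qs\<close>, where \<open>F\<close>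
  performs the replacement and may use the parameters \<open>y\<close>.\<close>
lemma denotable_rsub:
  assumes p: "denotable k G s p" and qs: "list_all2 (denotable k G) ts qs"
    and F: "\<And>X x. ptyped k (G @ s # ts @ args s) X N \<Longrightarrow> interp (G @ s # ts @ args s) X = ([], x) \<Longrightarrow>
      ptyped k (G @ s # ts @ args s) (F X) N \<and>
      interp (G @ s # ts @ args s) (F X) = ([], nrepl g x)"
    and g: "\<And>i. nf_inst_under (length G) (id_sub (length G) @ procs (p # qs))
      (length (args s)) (g i) = nshift (length G) (length (args s)) (h i)"
  shows "denotable k G s (rsub (length G) p h)"
proof -
  let ?d = "length G" and ?n = "length (args s)" and ?G = "G @ s # ts"
  let ?us = "id_sub ?d @ procs (p # qs)" and ?M = "F (eta_app ?G ?d)"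
  let ?eta = "eta s ?d (length ?G)"
  have nth_G: "?G ! ?d = s" by simp
  have M: "ptyped k (?G @ args s) ?M N \<and> interp (?G @ args s) ?M = ([], nrepl g (snd ?eta))"
    using F[of "eta_app ?G ?d"] ptyped_eta_app[of ?d ?G k] interp_eta_app[of ?d ?G]
    unfolding nth_G by simp
  have "denotable k G (foldr Arr (s # ts) s) ((s # ts) @ args s, nrepl g (snd ?eta))"
    using M ptyped_lams[of k G "(s # ts) @ args s" ?M N]
      interp_lams[of G "(s # ts) @ args s" ?M]
    unfolding denotable_def by (intro exI[of _ "foldr PLam ((s # ts) @ args s) ?M"])
      (simp add: foldr_Arr_args)
  from denotable_apps[OF this, of "p # qs"] p qs
  have "denotable k G s (args s, nf_inst_under ?d ?us ?n (nrepl g (snd ?eta)))"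
    by (simp add: nf_instp_def)
  moreover have "nf_inst_under ?d ?us ?n (nrepl g (snd ?eta)) =
      nrepl (\<lambda>i. nshift ?d ?n (h i)) (nf_inst_under ?d ?us ?n (snd ?eta))"
    unfolding g[symmetric] by (rule nf_inst_under_nrepl[OF _ refl]) simp
  moreover have "nf_instp ?d ?us ?eta = p"
    by (rule nf_instp_eta_stable)
      (use denotable_eta_stable[OF p] list_all2_lengthD[OF qs]
        in \<open>simp_all add: lookup_def nth_append\<close>)
  then have "snd p = nf_inst_under ?d ?us ?n (snd ?eta)" by (metis fst_eta nf_instp_simps(2))
  ultimately show ?thesis using denotable_eta_stable[OF p] by (simp only: rsub_def)
qed

lemma denotable_rule4:
  assumes "denotable k G s p"
  shows "denotable k G s (rsub (length G) p (fnum f))"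
  by (rule denotable_rsub[OF assms, where ts = "[]" and F = "PApp (PC f)" and g = "fnum f"])
    (auto intro: ptyped.intros simp: interp_PC_app simp del: interp.simps)

lemma denotable_rule5:
  assumes p: "denotable k G s p"
    and branches: "denotable k G N ([], a)" "denotable k G N ([], b)"
  shows "denotable k G s (rsub (length G) p (\<lambda>i. if i = 0 then a else b))"
proof -
  let ?d = "length G" and ?G = "G @ s # [N, N] @ args s"
  let ?F = "\<lambda>X. foldl PApp PIfz [X, PVar (?d + 1), PVar (?d + 2)]"
  let ?g = "\<lambda>i::nat. if i = 0 then Case (?d + 1) [] Num else Case (?d + 2) [] Num"
  have nth_G: "?G ! (?d + 1) = N" "?G ! (?d + 2) = N" by (simp_all add: nth_append)
  have F: "ptyped k ?G (?F X) N \<and> interp ?G (?F X) = ([], nrepl ?g x)"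
    if X: "ptyped k ?G X N" "interp ?G X = ([], x)" for X x
  proof
    show "ptyped k ?G (?F X) N"
    proof (rule ptyped_apps[where ss = "[N, N, N]"])
      have "ptyped k ?G (PVar (?d + 1)) (?G ! (?d + 1))"
        and "ptyped k ?G (PVar (?d + 2)) (?G ! (?d + 2))"
        by (rule ptyped_PVar, simp)+
      then show "list_all2 (ptyped k ?G) [X, PVar (?d + 1), PVar (?d + 2)] [N, N, N]"
        using X(1) unfolding nth_G by simp
    qed (simp add: ptyped.intros)
    show "interp ?G (?F X) = ([], nrepl ?g x)"
      by (rule interp_PIfz_app[OF X(2)]) (simp_all only: interp.simps nth_G eta_N)
  qed
  have g: "nf_inst_under ?d (id_sub ?d @ procs (p # [([], a), ([], b)])) n (?g i) =
      nshift ?d n (if i = 0 then a else b)" for n i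
  proof -
    let ?us = "id_sub ?d @ procs (p # [([], a), ([], b)])"
    have "lookup ?d ?us (?d + 1) = Inr (embp ([], a))"
      and "lookup ?d ?us (?d + 2) = Inr (embp ([], b))"
      by (simp_all add: lookup_def nth_append)
    from this[THEN nf_inst_under_ground_var] show ?thesis by (simp del: emb_simps)
  qed
  show ?thesis
    by (rule denotable_rsub[OF p _ F g]) (use branches in simp_all)
qed

lemma denotable_fix_plug:
  assumes e: "denotable k G (Arr (arrs ss) (arrs ss)) (arrs ss # ss, e)" and "lv (arrs ss) \<le> k"
    and qs: "list_all2 (denotable k G) ss qs"
  shows "denotable k G N ([], fix_plug (length G) ss e qs)"
proof -
  interpret fixpoint_unfolding G ss e qs
    by unfold_locales (use denotable_eta_stable[OF e] denotable_list[OF qs] in auto)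
  have "denotable k G (foldr Arr (Arr (arrs ss) (arrs ss) # ss) N)
      (Arr (arrs ss) (arrs ss) # ss, Fb ss (length G) (length G + 1))"
    using ptyped_PY[OF assms(2), of G] unfolding denotable_def
    by (intro exI[of _ "PY (arrs ss)"]) (simp add: arrs_def[symmetric])
  from denotable_apps[OF this, of "(arrs ss # ss, e) # qs"] e qs
  show ?thesis using nf_inst_Fb_eq_fix_plug[of "id_sub (length G)"] by (simp add: nf_instp_def)
qed

lemma fix_plug_unfold:
  "fix_plug d ss e qs = nunshift d (length ss + 1) (eval (d + length ss + 1)
     (plug d (length ss + 1) e
       (\<lambda>j. if j = 0 then (ss, nshift (d + 1) (length ss) e)
            else (fst (qs ! (j - 1)), nshift d (length ss + 1) (snd (qs ! (j - 1)))))))"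
  unfolding fix_plug_def fix_sub_def weaken_def ..

theorem gen_imp_denotable: "gen k G s p \<Longrightarrow> denotable k G s p"
proof (induction rule: gen.induct)
  case (rule1 x G ss qs)
  then show ?case by (intro denotable_rule1) (auto simp: list_all2_conv_all_nth)
next
  case (rule2 G s t p)
  then obtain M where "ptyped k (G @ [s]) M t" "interp (G @ [s]) M = p"
    by (auto simp: denotable_def)
  then show ?case
    unfolding denotable_def by (intro exI[of _ "PLam s M"]) (auto intro: ptyped.intros)
next
  case (rule3 G n)
  then show ?case
    unfolding denotable_def by (intro exI[of _ "PNum n"]) (auto intro: ptyped.intros)
next
  case (rule4 G s p f)
  then show ?case by (intro denotable_rule4)
next
  case (rule5 G s p d e)
  then show ?case by (intro denotable_rule5)
next
  case (rule6 G ss e qs)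
  then show ?case
    unfolding fix_plug_unfold[symmetric]
    by (intro denotable_fix_plug) (auto simp: list_all2_conv_all_nth)
qed

section \<open>Denotable procedures are generated\<close>

text \<open>Quantifying over extensions \<open>H\<close> of the environment makes weakening of \<open>reducible\<close> immediate,
  so that weakening of \<open>gen\<close> is never needed.\<close>
function reducible :: "nat \<Rightarrow> ty list \<Rightarrow> ty \<Rightarrow> nsp \<Rightarrow> bool" where
  "reducible k G s q \<longleftrightarrow> fst q = args s \<and> eta_stable G q \<and>
     (\<forall>H qs. length qs = length (args s) \<longrightarrow>
        (\<forall>i. i < length (args s) \<longrightarrow> reducible k (G @ H) (args s ! i) (qs ! i)) \<longrightarrow>
        gen k (G @ H) N
          ([], nf_inst (length (G @ H)) (id_sub (length G) @ procs qs) (snd q)))"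
  by pat_completeness auto
termination
  by (relation "measure (\<lambda>(_, _, s, _). size s)") (auto intro: size_args_nth)

declare reducible.simps [simp del]

lemma reducible_iff:
  "reducible k G s q \<longleftrightarrow> fst q = args s \<and> eta_stable G q \<and>
     (\<forall>H qs. list_all2 (reducible k (G @ H)) (args s) qs \<longrightarrow>
        gen k (G @ H) N
          ([], nf_inst (length (G @ H)) (id_sub (length G) @ procs qs) (snd q)))"
  unfolding reducible.simps[of k G s q] list_all2_conv_all_nth by metis

lemma reducible_eta_stable: "reducible k G s q \<Longrightarrow> fst q = args s \<and> eta_stable G q"
  by (simp add: reducible_iff)

lemma reducible_list:
  assumes "list_all2 (reducible k G) ss qs"
  shows "map fst qs = map args ss" "q \<in> set qs \<Longrightarrow> eta_stable G q"
proof -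
  have "list_all2 (\<lambda>s q. fst q = args s \<and> eta_stable G q) ss qs"
    using assms by (rule list_all2_mono) (rule reducible_eta_stable)
  note eta_stable_list[OF this]
  then show "map fst qs = map args ss" "q \<in> set qs \<Longrightarrow> eta_stable G q" by blast+
qed

lemma reducible_stable_entries:
  assumes "list_all2 (reducible k G) ss qs"
  shows "list_all2 (stable_entry G) (procs qs) ss"
  using reducible_list(2)[OF assms] list_all2_lengthD[OF assms]
  by (simp add: list_all2_conv_all_nth)

lemma reducible_apply:
  assumes "reducible k G s q" "list_all2 (reducible k (G @ H)) (args s) qs"
  shows "gen k (G @ H) N ([], nf_inst (length (G @ H)) (id_sub (length G) @ procs qs) (snd q))"
  using assms by (simp add: reducible_iff)

lemma reducible_weaken:
  assumes "reducible k G s q"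
  shows "reducible k (G @ H) s (weaken (length G) (length H) q)"
proof -
  let ?d = "length G" and ?h = "length H"
  have "gen k ((G @ H) @ H') N ([], nf_inst (length ((G @ H) @ H'))
      (id_sub (length (G @ H)) @ procs qs) (snd (weaken ?d ?h q)))"
    if qs: "list_all2 (reducible k ((G @ H) @ H')) (args s) qs" for H' qs
  proof -
    let ?D = "length ((G @ H) @ H')"
    have "inst ?D (id_sub (length (G @ H)) @ procs qs) 0 (emb (snd (weaken ?d ?h q))) =
        inst ?D (id_sub ?d @ procs qs) 0 (emb (snd q))"
      using inst_weaken_mid[of ?D "id_sub ?d" "map Inl [?d..<?d + ?h]" "procs qs" 0 "emb (snd q)"]
      by (simp add: weaken_def emb_nshift id_sub_add)
    then show ?thesis using reducible_apply[OF assms, of "H @ H'" qs] qs by simp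
  qed
  then show ?thesis
    using reducible_eta_stable[OF assms] eta_stable_weaken[of G q H] by (simp add: reducible_iff)
qed

lemma gen_lams: "gen k (G @ ss) t p \<Longrightarrow> gen k G (foldr Arr ss t) (ss @ fst p, snd p)"
proof (induction ss arbitrary: G)
  case (Cons s ss)
  then have "gen k (G @ [s]) (foldr Arr ss t) (ss @ fst p, snd p)" by simp
  from gen.rule2[OF this] show ?case by (simp add: lam1_def)
qed simp

lemma reducible_var:
  assumes reify: "\<And>i H q. i < length (args (G ! x)) \<Longrightarrow> reducible k (G @ H) (args (G ! x) ! i) q
      \<Longrightarrow> gen k (G @ H) (args (G ! x) ! i) q"
    and x: "x < length G"
  shows "reducible k G (G ! x) (eta (G ! x) x (length G))"
proof -
  have "gen k (G @ H) N ([], nf_inst (length (G @ H)) (id_sub (length G) @ procs qs)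
      (snd (eta (G ! x) x (length G))))"
    if qs: "list_all2 (reducible k (G @ H)) (args (G ! x)) qs" for H qs
  proof -
    have "nf_inst (length (G @ H)) (id_sub (length G) @ procs qs)
        (snd (eta (G ! x) x (length G))) = Case x qs Num"
      by (rule nf_inst_eta_saturated_stable)
        (use x reducible_list[OF qs] in \<open>auto simp: lookup_id_sub\<close>)
    moreover have "gen k (G @ H) N ([], Case x qs Num)"
      by (rule gen.rule1[where ss = "args (G ! x)"])
        (use x qs reify in \<open>auto simp: nth_append list_all2_conv_all_nth\<close>)
    ultimately show ?thesis by simp
  qed
  then show ?thesis using eta_stable_eta[OF x] by (simp add: reducible_iff)
qed

lemma gen_if_reducible:
  assumes reflect: "list_all2 (reducible k (G @ args s)) (args s) (etas (args s) (length G))"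
    and q: "reducible k G s q"
  shows "gen k G s q"
proof -
  have fst: "fst q = args s" and stable: "eta_stable G q" using reducible_eta_stable[OF q] by auto
  have "nf_inst (length (G @ args s)) (id_sub (length G) @ procs (etas (args s) (length G)))
      (snd q) = snd q"
    using eta_nf_embp[OF stable] by (simp add: eta_nf_def fst prod_eq_iff)
  then have "gen k (G @ args s) N ([], snd q)" using reducible_apply[OF q reflect] by simp
  from gen_lams[OF this] have "gen k G s (args s, snd q)" by (simp add: foldr_Arr_args)
  then show ?thesis by (simp flip: fst)
qed

lemma reflect_reify:
  shows reflect: "x < length G \<Longrightarrow> G ! x = s \<Longrightarrow> reducible k G s (eta s x (length G))"
    and reify: "reducible k G s q \<Longrightarrow> gen k G s q"
proof (induction s arbitrary: x G q rule: measure_induct_rule[of size])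
  fix s :: ty and x :: nat and G :: "ty list" and q :: nsp
  assume reflect: "\<And>t x G. size t < size s \<Longrightarrow> x < length G \<Longrightarrow> G ! x = t
      \<Longrightarrow> reducible k G t (eta t x (length G))"
    and reify: "\<And>t G q. size t < size s \<Longrightarrow> reducible k G t q \<Longrightarrow> gen k G t q"
  show "reducible k G s (eta s x (length G))" if "x < length G" "G ! x = s"
    using that reify[OF size_args_nth] by (auto intro!: reducible_var)
  show "gen k G s q" if "reducible k G s q"
  proof -
    have "reducible k (G @ args s) (args s ! j) (etas (args s) (length G) ! j)"
      if j: "j < length (args s)" for j
      using reflect[OF size_args_nth[OF j], of "length G + j" "G @ args s"] j by simp
    then have "list_all2 (reducible k (G @ args s)) (args s) (etas (args s) (length G))"
      by (simp add: list_all2_conv_all_nth)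
    then show ?thesis using that by (rule gen_if_reducible)
  qed
qed

lemma reducible_ground: "reducible k G N q \<Longrightarrow> fst q = [] \<and> gen k G N ([], snd q)"
  using reify[of k G N q] reducible_eta_stable[of k G N q] by (metis args.simps(1) prod.collapse)

definition computable :: "nat \<Rightarrow> ty list \<Rightarrow> ty \<Rightarrow> nsp \<Rightarrow> bool" where
  "computable k G' s p \<longleftrightarrow>
     (\<forall>G \<gamma> qs. list_all2 (reducible k G) G' \<gamma> \<longrightarrow> list_all2 (reducible k G) (args s) qs \<longrightarrow>
        gen k G N ([], nf_inst (length G) (procs (\<gamma> @ qs)) (snd p)))"

lemma computableI:
  assumes "\<And>G \<gamma> qs. list_all2 (reducible k G) G' \<gamma> \<Longrightarrow> list_all2 (reducible k G) (args s) qs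
    \<Longrightarrow> gen k G N ([], nf_inst (length G) (procs (\<gamma> @ qs)) (snd p))"
  shows "computable k G' s p"
  using assms by (simp add: computable_def)

lemma computableD:
  assumes "computable k G' s p" "list_all2 (reducible k G) G' \<gamma>"
    and "list_all2 (reducible k G) (args s) qs"
  shows "gen k G N ([], nf_inst (length G) (procs (\<gamma> @ qs)) (snd p))"
  using assms by (simp add: computable_def)

lemma reducible_if_computable:
  assumes computable: "computable k G' s p" and p: "fst p = args s" "eta_stable G' p"
    and \<gamma>: "list_all2 (reducible k G) G' \<gamma>"
  shows "reducible k G s (nf_instp (length G) (procs \<gamma>) p)"
proof -
  let ?d = "length G" and ?n = "length (args s)"
  have "gen k (G @ H) N ([], nf_inst (length (G @ H)) (id_sub ?d @ procs qs)
      (nf_inst_under ?d (procs \<gamma>) ?n (snd p)))"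
    if qs: "list_all2 (reducible k (G @ H)) (args s) qs" for H qs
  proof -
    let ?D = "length (G @ H)"
    define \<gamma>' where "\<gamma>' = map (weaken ?d (length H)) \<gamma>"
    have "nf_inst ?D (id_sub ?d @ procs qs) (nf_inst_under ?d (procs \<gamma>) ?n (snd p)) =
        nf_inst ?D (map (inst_entry ?D (id_sub ?d)) (procs \<gamma>) @ procs qs) (snd p)"
      using nf_inst_under_nf_inst_under[of "id_sub ?d" ?d "procs qs" ?n ?D "procs \<gamma>" 0 "snd p"]
        list_all2_lengthD[OF qs] by simp
    also have "map (inst_entry ?D (id_sub ?d)) (procs \<gamma>) = procs \<gamma>'"
      using map_inst_entry_id_sub_shift[of ?d "procs \<gamma>" "length H"]
      by (simp add: \<gamma>'_def mshiftp_embp)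
    finally have "nf_inst ?D (id_sub ?d @ procs qs) (nf_inst_under ?d (procs \<gamma>) ?n (snd p)) =
        nf_inst ?D (procs (\<gamma>' @ qs)) (snd p)" by (simp add: comp_def)
    moreover have "list_all2 (reducible k (G @ H)) G' \<gamma>'"
      using \<gamma> by (simp add: \<gamma>'_def list_all2_conv_all_nth reducible_weaken)
    ultimately show ?thesis using computableD[OF computable _ qs] by simp
  qed
  then show ?thesis
    using p eta_stable_inst[OF p(2) reducible_stable_entries[OF \<gamma>]] by (simp add: reducible_iff)
qed

lemma computable_PVar:
  assumes x: "x < length G'"
  shows "computable k G' (G' ! x) (eta (G' ! x) x (length G'))"
proof (rule computableI)
  fix G :: "ty list" and \<gamma> qs :: "nsp list"
  assume \<gamma>: "list_all2 (reducible k G) G' \<gamma>"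
    and qs: "list_all2 (reducible k G) (args (G' ! x)) qs"
  have \<gamma>x: "reducible k G (G' ! x) (\<gamma> ! x)" using list_all2_nthD[OF \<gamma> x] .
  have len: "length \<gamma> = length G'" using list_all2_lengthD[OF \<gamma>] by simp
  have "nf_inst (length G) (procs \<gamma> @ procs qs) (snd (eta (G' ! x) x (length G'))) =
      nf_inst (length G) (id_sub (length G) @ procs qs) (snd (\<gamma> ! x))"
    by (rule nf_inst_eta_applied)
      (use x len reducible_eta_stable[OF \<gamma>x] reducible_list[OF qs] in \<open>auto simp: lookup_def\<close>)
  then show "gen k G N ([], nf_inst (length G) (procs (\<gamma> @ qs))
      (snd (eta (G' ! x) x (length G'))))"
    using reducible_apply[OF \<gamma>x, of "[]" qs] qs by simp
qed

lemma computable_PC: "computable k G' (Arr N N) ([N], Case (length G') [] (fnum f))"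
proof (rule computableI)
  fix G :: "ty list" and \<gamma> qs :: "nsp list"
  let ?us = "procs (\<gamma> @ qs)"
  assume \<gamma>: "list_all2 (reducible k G) G' \<gamma>"
    and "list_all2 (reducible k G) (args (Arr N N)) qs"
  then obtain q where qs: "qs = [q]" and "reducible k G N q" by (auto simp: list_all2_Cons1)
  then have q: "fst q = []" "gen k G N ([], snd q)" using reducible_ground by auto
  have "lookup (length G) ?us (length G') = Inr (embp q)"
    using list_all2_lengthD[OF \<gamma>] by (simp add: lookup_def nth_append qs)
  from nf_inst_ground[OF this q(1), of "fnum f"]
  have "nf_inst (length G) ?us (Case (length G') [] (fnum f)) = nrepl (fnum f) (snd q)"
    by (simp add: nf_inst_under_fnum[where n = 0, unfolded add_0_right])
  moreover have "gen k G N ([], nrepl (fnum f) (snd q))"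
    using gen.rule4[OF q(2), of f] by (simp add: rsub_def)
  ultimately show "gen k G N ([], nf_inst (length G) ?us
      (snd ([N], Case (length G') [] (fnum f))))" by simp
qed

lemma computable_PIfz: "computable k G' (Arr N (Arr N (Arr N N))) (interp G' PIfz)"
proof (rule computableI)
  fix G :: "ty list" and \<gamma> qs :: "nsp list"
  let ?us = "procs (\<gamma> @ qs)"
  assume \<gamma>: "list_all2 (reducible k G) G' \<gamma>"
    and "list_all2 (reducible k G) (args (Arr N (Arr N (Arr N N)))) qs"
  then obtain q a b where qs: "qs = [q, a, b]"
    and red: "reducible k G N q" "reducible k G N a" "reducible k G N b"
    by (auto simp: list_all2_Cons1)
  note ground = red[THEN reducible_ground]
  have "nf_inst (length G) ?us (snd (interp G' PIfz)) =
      nrepl (\<lambda>i. if i = 0 then snd a else snd b) (snd q)"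
    unfolding interp.simps snd_conv
    by (rule nf_inst_ifzero)
      (use list_all2_lengthD[OF \<gamma>] ground in \<open>simp_all add: lookup_def nth_append qs\<close>)
  moreover have "gen k G N ([], nrepl (\<lambda>i. if i = 0 then snd a else snd b) (snd q))"
    using gen.rule5[of k G N "([], snd q)" "snd a" "snd b"] ground by (simp add: rsub_def)
  ultimately show "gen k G N ([], nf_inst (length G) ?us (snd (interp G' PIfz)))" by simp
qed

lemma computable_PY:
  assumes "lv s \<le> k"
  shows "computable k G' (Arr (Arr s s) s) (interp G' (PY s))"
proof (rule computableI)
  fix G :: "ty list" and \<gamma> qs :: "nsp list"
  assume \<gamma>: "list_all2 (reducible k G) G' \<gamma>"
    and "list_all2 (reducible k G) (args (Arr (Arr s s) s)) qs"
  then obtain g xs where qs: "qs = g # xs" and g: "reducible k G (Arr s s) g"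
    and xs: "list_all2 (reducible k G) (args s) xs"
    by (auto simp: list_all2_Cons1)
  have len: "length \<gamma> = length G'" using list_all2_lengthD[OF \<gamma>] by simp
  obtain e where e: "g = (s # args s, e)" using reducible_eta_stable[OF g] by (cases g) auto
  interpret fixpoint_unfolding G "args s" e xs
    by unfold_locales (use reducible_eta_stable[OF g] e reducible_list[OF xs] in auto)
  have "gen k G (Arr (arrs (args s)) (arrs (args s))) (arrs (args s) # args s, e)"
    using reify[OF g] e by simp
  then have "gen k G N ([], fix_plug (length G) (args s) e xs)"
    unfolding fix_plug_unfold
    by (rule gen.rule6) (use assms xs reify in \<open>auto simp: list_all2_conv_all_nth\<close>)
  then show "gen k G N ([], nf_inst (length G) (procs (\<gamma> @ qs)) (snd (interp G' (PY s))))"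
    using nf_inst_Fb_eq_fix_plug[of "procs \<gamma>"] len by (simp add: qs e)
qed

lemma computable_PLam:
  assumes "computable k (G' @ [s]) t p"
  shows "computable k G' (Arr s t) (lam1 s p)"
proof (rule computableI)
  fix G :: "ty list" and \<gamma> qs :: "nsp list"
  assume \<gamma>: "list_all2 (reducible k G) G' \<gamma>"
    and "list_all2 (reducible k G) (args (Arr s t)) qs"
  then obtain q xs where qs: "qs = q # xs" and q: "reducible k G s q"
    and xs: "list_all2 (reducible k G) (args t) xs"
    by (auto simp: list_all2_Cons1)
  have "list_all2 (reducible k G) (G' @ [s]) (\<gamma> @ [q])" using \<gamma> q by (simp add: list_all2_appendI)
  from computableD[OF assms this xs]
  show "gen k G N ([], nf_inst (length G) (procs (\<gamma> @ qs)) (snd (lam1 s p)))"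
    by (simp add: qs lam1_def)
qed

lemma computable_app:
  assumes p: "computable k G' (Arr s t) p" "fst p = s # args t"
    and q: "computable k G' s q" "fst q = args s" "eta_stable G' q"
  shows "computable k G' t (app (length G') p q)"
proof (rule computableI)
  fix G :: "ty list" and \<gamma> qs :: "nsp list"
  assume \<gamma>: "list_all2 (reducible k G) G' \<gamma>" and qs: "list_all2 (reducible k G) (args t) qs"
  let ?d = "length G" and ?D = "length G'" and ?n = "length (args t)"
  let ?\<gamma> = "procs \<gamma>" and ?Q = "procs qs"
  define q' where "q' = nf_instp ?d ?\<gamma> q"
  have len: "length \<gamma> = ?D" "length qs = ?n"
    using list_all2_lengthD[OF \<gamma>] list_all2_lengthD[OF qs] by auto
  have "nf_inst ?d (?\<gamma> @ ?Q) (snd (app ?D p q)) =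
      nf_inst ?d (map (inst_entry ?d ?\<gamma>) (id_sub ?D @ [Inr (embp q)]) @ ?Q) (snd p)"
    using nf_inst_under_nf_inst_under[of ?\<gamma> ?D ?Q ?n ?d "id_sub ?D @ [Inr (embp q)]" 0 "snd p"]
    by (simp add: app_eq_nf_instp[OF p(2)] len)
  also have "map (inst_entry ?d ?\<gamma>) (id_sub ?D @ [Inr (embp q)]) =
      ?\<gamma> @ [Inr (instp ?d ?\<gamma> 0 (embp q))]"
    using map_inst_entry_id_sub[of ?\<gamma> ?D ?d] len by simp
  also have "nf_inst ?d ((?\<gamma> @ [Inr (instp ?d ?\<gamma> 0 (embp q))]) @ ?Q) (snd p) =
      nf_inst ?d ((?\<gamma> @ [Inr (embp q')]) @ ?Q) (snd p)"
  proof -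
    have "nf_eq_entry ?d (Inr (instp ?d ?\<gamma> 0 (embp q))) (Inr (embp q'))"
      by (simp add: rel_proc_def q'_def)
    then have "list_all2 (nf_eq_entry ?d) ((?\<gamma> @ [Inr (instp ?d ?\<gamma> 0 (embp q))]) @ ?Q)
        ((?\<gamma> @ [Inr (embp q')]) @ ?Q)"
      by (intro list_all2_appendI list_nf_eq_entry_refl) auto
    from nf_inst_cong[OF refl _ _ this, of 0 "emb (snd p)"] show ?thesis by simp
  qed
  finally have eq: "nf_inst ?d (?\<gamma> @ ?Q) (snd (app ?D p q)) =
      nf_inst ?d (procs (\<gamma> @ q' # qs)) (snd p)" by (simp add: comp_def)
  have "reducible k G s q'" unfolding q'_def using q \<gamma> by (rule reducible_if_computable)
  then have "gen k G N ([], nf_inst ?d (procs (\<gamma> @ q' # qs)) (snd p))"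
    using qs by (intro computableD[OF p(1) \<gamma>]) simp
  then show "gen k G N ([], nf_inst ?d (procs (\<gamma> @ qs)) (snd (app ?D p q)))"
    unfolding map_append eq by simp
qed

theorem computable_interp: "ptyped k G' M s \<Longrightarrow> computable k G' s (interp G' M)"
proof (induction rule: ptyped_induct)
  case (PVar x G' k)
  then show ?case using computable_PVar by simp
next
  case (PNum k G' n)
  then show ?case by (auto intro!: computableI gen.rule3)
next
  case (PSuc k G')
  then show ?case using computable_PC[of k G' "\<lambda>i. Some (i + 1)"] by simp
next
  case (PPre k G')
  then show ?case using computable_PC[of k G' "\<lambda>i. Some (i - 1)"] by simp
next
  case (PIfz k G')
  then show ?case by (rule computable_PIfz)
next
  case (PY s k G')
  then show ?case by (rule computable_PY)
next
  case (PC k G' f)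
  then show ?case using computable_PC[of k G' f] by (simp add: fnum_def[abs_def])
next
  case (PLam k G' s M t)
  then show ?case by (simp add: computable_PLam)
next
  case (PApp k G' M s t M')
  then show ?case using computable_app interp_eta_stable by simp
qed

theorem denotable_imp_gen:
  assumes "denotable k G s p"
  shows "gen k G s p"
proof -
  have p: "fst p = args s" "eta_stable G p" using denotable_eta_stable[OF assms] by auto
  let ?\<gamma> = "map (\<lambda>x. eta (G ! x) x (length G)) [0..<length G]"
  have "list_all2 (reducible k G) G ?\<gamma>" by (simp add: list_all2_conv_all_nth reflect)
  moreover have "computable k G s p"
    using assms computable_interp by (auto simp: denotable_def)
  ultimately have "reducible k G s (nf_instp (length G) (procs ?\<gamma>) p)"
    using p by (intro reducible_if_computable)
  also have "procs ?\<gamma> = eta_sub G UNIV" by (simp add: eta_sub_def)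
  also have "nf_instp (length G) \<dots> p = p" by (rule nf_instp_eta_sub[OF p(2)])
  finally show ?thesis by (rule reify)
qed

theorem theorem3p8:
  fixes k :: nat and G :: "ty list" and s :: ty and p :: nsp
  assumes "k \<ge> 1"
  shows "denotable k G s p \<longleftrightarrow> gen k G s p"
  using gen_imp_denotable denotable_imp_gen by blast

end
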